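(* Let $\mathcal{H}=\{H_1,\ldots,H_r\}$ be a family of $2$-balanced graphs. Let $H,J\in\mathcal{H}$ be such that $d_2(H)=\min_{F\in\mathcal{H}}d_2(F)$ and $e_J=\max_{F\in\mathcal{H}}e_F$. There are constants $a,A>0$ such that, for all sufficiently large $n$, the final number of edges $M_n$ in the reverse $\mathcal{H}$-free process on $n$ vertices has expectation satisfying $$a\,n^{2-1/d_2(H)}\le\mathbb{E}M_n\le A\,n^{2-1/d_2(H)}.$$ Furthermore, for any $c>0$ we have $|M_n-\mathbb{E}M_n|\le\sqrt{\mathbb{E}M_n}\,(\log n)^{4e_J}$ with probability at least $1-n^{-c}$ for $n\ge n_0(c,\mathcal{H})$.
   Context: For a graph $G$, $v_G$ and $e_G$ denote its numbers of vertices and edges. For $v_G\ge3$ write $d_2(G)=\frac{e_G-1}{v_G-2}$. A fixed graph $H$ is $2$-balanced if it has $e_H\ge2$ edges and all its proper subgraphs $G\subsetneq H$ with $v_G\ge3$ vertices satisfy $\frac{e_G-1}{v_G-2}\le\frac{e_H-1}{v_H-2}=d_2(H)$. The reverse $\mathcal{H}$-free process: starting with the complete graph on $n$ vertices, in each step an edge is removed, chosen uniformly at random from all edges that are contained in a copy of some $F\in\mathcal{H}$ (a not necessarily induced subgraph isomorphic to $F$) in the current graph; the process ends when no such edge exists. $M_n$ is the number of edges of the final graph. *)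

theory Defs
  imports "HOL-Probability.Probability"
begin

datatype 'a ugraph = UGraph (verts: "'a set") (edges: "'a set set")

definition simple_graph :: "'a ugraph \<Rightarrow> bool" where
  "simple_graph G \<longleftrightarrow> finite (verts G) \<and> edges G \<subseteq> {e. e \<subseteq> verts G \<and> card e = 2}"

definition num_verts :: "'a ugraph \<Rightarrow> nat" where
  "num_verts G = card (verts G)"

definition num_edges :: "'a ugraph \<Rightarrow> nat" where
  "num_edges G = card (edges G)"

definition complete_graph :: "nat \<Rightarrow> nat ugraph" where
  "complete_graph n = UGraph {..<n} {e. e \<subseteq> {..<n} \<and> card e = 2}"

definition subgraph :: "'a ugraph \<Rightarrow> 'a ugraph \<Rightarrow> bool" where
  "subgraph G H \<longleftrightarrow> simple_graph G \<and> simple_graph H \<and> verts G \<subseteq> verts H \<and> edges G \<subseteq> edges H"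

definition isomorphic :: "'a ugraph \<Rightarrow> 'b ugraph \<Rightarrow> bool" where
  "isomorphic G H \<longleftrightarrow>
     (\<exists>f. bij_betw f (verts G) (verts H) \<and> edges H = (\<lambda>e. f ` e) ` edges G)"

text \<open>The subtractions are performed in the reals, so an edgeless graph on at least three
  vertices has negative density; the value is meaningful only for at least three vertices.\<close>

definition d2 :: "'a ugraph \<Rightarrow> real" where
  "d2 G = (real (num_edges G) - 1) / (real (num_verts G) - 2)"

text \<open>At least two edges already force at least three vertices.\<close>

definition two_balanced :: "'a ugraph \<Rightarrow> bool" where
  "two_balanced H \<longleftrightarrow> simple_graph H \<and> num_edges H \<ge> 2 \<and>
     (\<forall>G. subgraph G H \<and> G \<noteq> H \<and> num_verts G \<ge> 3 \<longrightarrow> d2 G \<le> d2 H)"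

definition is_copy :: "'a ugraph \<Rightarrow> 'b ugraph \<Rightarrow> 'b ugraph \<Rightarrow> bool" where
  "is_copy F G C \<longleftrightarrow> subgraph C G \<and> isomorphic F C"

definition removable_edges :: "'a ugraph set \<Rightarrow> 'b ugraph \<Rightarrow> 'b set set" where
  "removable_edges \<H> G = {e. \<exists>F\<in>\<H>. \<exists>C. is_copy F G C \<and> e \<in> edges C}"

definition delete_edge :: "'a ugraph \<Rightarrow> 'a set \<Rightarrow> 'a ugraph" where
  "delete_edge G e = UGraph (verts G) (edges G - {e})"

lemma removable_edges_subset: "removable_edges \<H> G \<subseteq> edges G"
  by (auto simp: removable_edges_def is_copy_def subgraph_def)

text \<open>Distribution of the final graph of the process started at the given graph. The finiteness
  guard only serves termination; it holds for every simple graph.\<close>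

function reverse_free_process :: "'a ugraph set \<Rightarrow> 'b ugraph \<Rightarrow> 'b ugraph pmf" where
  "reverse_free_process \<H> G =
     (if finite (edges G) \<and> removable_edges \<H> G \<noteq> {}
      then bind_pmf (pmf_of_set (removable_edges \<H> G))
             (\<lambda>e. reverse_free_process \<H> (delete_edge G e))
      else return_pmf G)"
  by auto
termination
proof (relation "Wellfounded.measure (\<lambda>(\<H>, G). card (edges G))", goal_cases)
  case 1
  show ?case by simp
next
  case (2 \<H> G e)
  then have "e \<in> removable_edges \<H> G"
    using finite_subset[OF removable_edges_subset, of G \<H>] by simp
  then have "e \<in> edges G"
    using removable_edges_subset by blast
  with 2 show ?case
    using card_Diff1_less[of "edges G" e] by (simp add: delete_edge_def)
qed

declare reverse_free_process.simps [simp del]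

definition final_edges :: "'a ugraph set \<Rightarrow> nat \<Rightarrow> nat pmf" where
  "final_edges \<H> n = map_pmf num_edges (reverse_free_process \<H> (complete_graph n))"

definition expected_final_edges :: "'a ugraph set \<Rightarrow> nat \<Rightarrow> real" where
  "expected_final_edges \<H> n = measure_pmf.expectation (final_edges \<H> n) real"

end

theory Submission
  imports Defs
begin

text \<open>Reveal the edges in a uniformly random order and remove them from the last one
  downwards. When an edge is considered, any copy in the current graph through it has it as its
  last edge, since otherwise the last edge of the copy would already have been removed. Hence the
  surviving edges are exactly those that do not complete a copy with earlier edges.

  Let \<open>p = n powr (-1/d2 H)\<close> and let \<open>N\<close> be the number of edges of the complete graph. By
  2-balancedness, among the first \<open>c N p\<close> edges a fixed edge is unlikely to complete a copy, which
  gives the lower bound on the mean. For the upper bound, a second moment computation shows that a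
  batch of order \<open>N p\<close> independent draws completes a copy of \<open>H\<close> at a fixed edge with probability
  bounded below. Independence of batches makes the probability of avoiding this exponentially small
  in the number of batches, and drawing without replacement only helps.

  Thus whp only the first \<open>k = O(N p log n)\<close> edges matter. High moments of the number of copies
  through an edge show that whp every edge is in polylogarithmically many copies among the first
  \<open>k\<close> edges, and there the number of survivors is Lipschitz in Hamming distance. Extending it to a
  Lipschitz function of all sequences and bounding the moment generating function along the
  sequential exposure of the order gives the concentration.\<close>

section \<open>Averages\<close>

text \<open>The minimum of \<open>d2\<close> fixes the scale: \<open>p\<close> solves
  \<open>n * p powr d2 H = 1\<close>, and since \<open>p \<le> 1\<close> and
  \<open>d2 F \<ge> d2 H\<close>, also \<open>n * p powr d2 F \<le> 1\<close> for every other
  member. Hence the whole family can be controlled from above at density \<open>p\<close>, while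
  \<open>H\<close> alone already removes edges fast enough. One notion, \<open>spread\<close>,
  carries 2-balancedness into all probabilistic estimates: given any partial copy, the expected
  number of its completions stays bounded. It feeds the union bound, the second moment and the high
  moments alike. Concentration meets two obstacles. One edge of the order may decide many survivors,
  so a Lipschitz bound holds only on a good set of orders; and draws without replacement are
  dependent, so exchanging two edges replaces resampling one coordinate. The power of the logarithm
  has ample room. With \<open>m\<close> the largest number of edges, the Lipschitz constant
  \<open>D\<close> has order \<open>(log n)^(2(m-1))\<close>: one factor
  \<open>(log n)^(m-1)\<close> comes from raising the density by a logarithm, the other from taking
  moments of order \<open>log n\<close>. So \<open>k D^2\<close> has order at most
  \<open>n^2 p (log n)^(4m-3)\<close>, while the squared deviation has order
  \<open>n^2 p (log n)^(8m)\<close>.\<close>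

text \<open>An expectation is any normalized linear functional on all real functions that is
  positive on \<open>X\<close>, which avoids measurability and integrability. The probability of
  \<open>P\<close> is the value at \<open>of_bool (P x)\<close>, and \<open>X\<close> plays the role
  of the support.\<close>

locale averaging =
  fixes E :: "('x \<Rightarrow> real) \<Rightarrow> real" and X :: "'x set"
  assumes add: "E (\<lambda>x. f x + g x) = E f + E g"
    and scale: "E (\<lambda>x. c * f x) = c * E f"
    and nonneg: "(\<And>x. x \<in> X \<Longrightarrow> 0 \<le> f x) \<Longrightarrow> 0 \<le> E f"
    and one: "E (\<lambda>_. 1) = 1"
begin

lemma diff: "E (\<lambda>x. f x - g x) = E f - E g"
proof -
  have "E (\<lambda>x. f x + (- 1) * g x) = E f + (- 1) * E g"
    by (simp only: add scale)
  then show ?thesis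
    by simp
qed

lemma const: "E (\<lambda>_. c) = c"
  using scale[of c "\<lambda>_. 1"] one by simp

lemma scale_right: "E (\<lambda>x. f x * c) = E f * c"
  using scale[of c f] by (simp add: mult.commute)

lemma sum: "E (\<lambda>x. \<Sum>i\<in>I. f i x) = (\<Sum>i\<in>I. E (f i))"
  by (induction I rule: infinite_finite_induct) (simp_all add: const add)

lemma mono: "(\<And>x. x \<in> X \<Longrightarrow> f x \<le> g x) \<Longrightarrow> E f \<le> E g"
  using nonneg[of "\<lambda>x. g x - f x"] by (simp add: diff)

lemma cong: "(\<And>x. x \<in> X \<Longrightarrow> f x = g x) \<Longrightarrow> E f = E g"
  by (intro antisym mono) auto

lemma abs_le: "\<bar>E f\<bar> \<le> E (\<lambda>x. \<bar>f x\<bar>)"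
proof -
  have "E f \<le> E (\<lambda>x. \<bar>f x\<bar>)"
    by (rule mono) simp
  moreover have "E (\<lambda>x. - 1 * f x) \<le> E (\<lambda>x. \<bar>f x\<bar>)"
    by (rule mono) simp
  ultimately show ?thesis
    unfolding scale by simp
qed

lemma markov:
  assumes "\<And>x. x \<in> X \<Longrightarrow> 0 \<le> f x"
  shows "t * E (\<lambda>x. of_bool (t \<le> f x)) \<le> E f"
proof -
  have "E (\<lambda>x. t * of_bool (t \<le> f x)) \<le> E f"
    using assms by (intro mono) auto
  then show ?thesis
    by (simp only: scale)
qed

lemma prob_le_one: "E (\<lambda>x. of_bool (P x)) \<le> 1"
  using mono[of "\<lambda>x. of_bool (P x)" "\<lambda>_. 1"] by (simp add: one)

lemma prob_nonneg: "0 \<le> E (\<lambda>x. of_bool (P x))"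
  by (rule nonneg) simp

lemma prob_mono: "(\<And>x. x \<in> X \<Longrightarrow> P x \<Longrightarrow> Q x) \<Longrightarrow>
    E (\<lambda>x. of_bool (P x)) \<le> E (\<lambda>x. of_bool (Q x))"
  by (rule mono) auto

lemma prob_disj: "E (\<lambda>x. of_bool (P x \<or> Q x)) \<le> E (\<lambda>x. of_bool (P x)) + E (\<lambda>x. of_bool (Q x))"
  unfolding add[symmetric] by (rule mono) auto

lemma prob_bex:
  assumes "finite I"
  shows "E (\<lambda>x. of_bool (\<exists>i\<in>I. P i x)) \<le> (\<Sum>i\<in>I. E (\<lambda>x. of_bool (P i x)))"
  unfolding sum[symmetric]
proof (rule mono)
  fix x
  show "of_bool (\<exists>i\<in>I. P i x) \<le> (\<Sum>i\<in>I. of_bool (P i x) :: real)"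
  proof (cases "\<exists>i\<in>I. P i x")
    case True
    then obtain i where "i \<in> I" "P i x" by blast
    then show ?thesis
      using member_le_sum[of i I "\<lambda>i. of_bool (P i x) :: real"] assms by auto
  qed (simp add: sum_nonneg)
qed

lemma prob_not: "E (\<lambda>x. of_bool (\<not> P x)) = 1 - E (\<lambda>x. of_bool (P x))"
proof -
  have "E (\<lambda>x. of_bool (\<not> P x)) = E (\<lambda>x. 1 - of_bool (P x))"
    by (rule cong) auto
  then show ?thesis by (simp add: diff one)
qed

text \<open>The Paley--Zygmund inequality at level zero follows from
  \<open>1 - (1 - c X)\<^sup>2 \<le> 1\<close> with the optimal \<open>c = E X / E X\<^sup>2\<close>.\<close>

lemma second_moment:
  assumes "0 \<le> m" "m \<le> E f" "E (\<lambda>x. f x ^ 2) \<le> s" "0 < s"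
  shows "m ^ 2 / s \<le> E (\<lambda>x. of_bool (f x \<noteq> 0))"
proof -
  define c where "c = m / s"
  have c: "0 \<le> c" using assms by (simp add: c_def)
  have "m ^ 2 / s = (2 * c) * m - c ^ 2 * s"
    using assms(4) by (simp add: c_def power2_eq_square field_simps)
  also have "\<dots> \<le> (2 * c) * E f - c ^ 2 * E (\<lambda>x. f x ^ 2)"
    using assms c by (intro diff_mono mult_left_mono) auto
  also have "\<dots> = E (\<lambda>x. (2 * c) * f x - c ^ 2 * f x ^ 2)"
    by (simp only: diff scale)
  also have "\<dots> \<le> E (\<lambda>x. of_bool (f x \<noteq> 0))"
  proof (rule mono)
    fix x
    have "0 \<le> (1 - c * f x) ^ 2" by simp
    then show "2 * c * f x - c\<^sup>2 * (f x)\<^sup>2 \<le> of_bool (f x \<noteq> 0)"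
      by (cases "f x = 0") (simp_all add: power2_eq_square algebra_simps)
  qed
  finally show ?thesis .
qed

end

section \<open>Sampling with and without replacement\<close>

text \<open>Expectations over independent draws and over injective sequences are represented directly as
  linear functionals, by recursion on the first draw. The value of \<open>seq_avg k S\<close> for
  \<open>k > card S\<close> is the junk value 0.\<close>

primrec iid_avg :: "'b set \<Rightarrow> nat \<Rightarrow> ('b set \<Rightarrow> real) \<Rightarrow> real" where
  "iid_avg S 0 h = h {}"
| "iid_avg S (Suc t) h = (\<Sum>x\<in>S. iid_avg S t (\<lambda>U. h (insert x U))) / real (card S)"

primrec seq_avg :: "nat \<Rightarrow> 'b set \<Rightarrow> ('b list \<Rightarrow> real) \<Rightarrow> real" where
  "seq_avg 0 S f = f []"
| "seq_avg (Suc k) S f = (\<Sum>x\<in>S. seq_avg k (S - {x}) (\<lambda>xs. f (x # xs))) / real (card S)"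

definition inj_seqs :: "nat \<Rightarrow> 'b set \<Rightarrow> 'b list set" where
  "inj_seqs k S = {xs. distinct xs \<and> set xs \<subseteq> S \<and> length xs = k}"

lemma inj_seqs_Cons: "x # xs \<in> inj_seqs (Suc k) S \<longleftrightarrow> x \<in> S \<and> xs \<in> inj_seqs k (S - {x})"
  by (auto simp: inj_seqs_def)

lemma finite_inj_seqs: "finite S \<Longrightarrow> finite (inj_seqs k S)"
  unfolding inj_seqs_def by (rule finite_subset[OF _ finite_lists_length_eq[of S k]]) auto

lemma averaging_iid_avg:
  assumes "finite S" "S \<noteq> {}"
  shows "averaging (iid_avg S t) (Pow S)"
proof
  show "iid_avg S t (\<lambda>x. f x + g x) = iid_avg S t f + iid_avg S t g" for f g
    by (induction t arbitrary: f g) (simp_all add: sum.distrib add_divide_distrib)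
  show "iid_avg S t (\<lambda>x. c * f x) = c * iid_avg S t f" for c f
    by (induction t arbitrary: f) (simp_all flip: sum_distrib_left)
  show "iid_avg S t (\<lambda>_. 1) = 1"
    using assms by (induction t) simp_all
  show "0 \<le> iid_avg S t f" if "\<And>x. x \<in> Pow S \<Longrightarrow> 0 \<le> f x" for f
    using that by (induction t arbitrary: f) (auto intro!: divide_nonneg_nonneg sum_nonneg)
qed

lemma averaging_seq_avg:
  assumes "finite S" "k \<le> card S"
  shows "averaging (seq_avg k S) (inj_seqs k S)"
proof
  show "seq_avg k S (\<lambda>x. f x + g x) = seq_avg k S f + seq_avg k S g" for f g
    by (induction k arbitrary: S f g) (simp_all add: sum.distrib add_divide_distrib)
  show "seq_avg k S (\<lambda>x. c * f x) = c * seq_avg k S f" for c f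
    by (induction k arbitrary: S f) (simp_all flip: sum_distrib_left)
  show "seq_avg k S (\<lambda>_. 1) = 1"
    using assms
  proof (induction k arbitrary: S)
    case (Suc k)
    then have "seq_avg k (S - {x}) (\<lambda>_. 1) = 1" if "x \<in> S" for x
      using that by simp
    then show ?case using Suc.prems by auto
  qed simp
  show "0 \<le> seq_avg k S f" if "\<And>x. x \<in> inj_seqs k S \<Longrightarrow> 0 \<le> f x" for f
    using that
  proof (induction k arbitrary: S f)
    case 0
    then show ?case by (simp add: inj_seqs_def)
  next
    case (Suc k)
    then show ?case
      by (auto intro!: divide_nonneg_nonneg sum_nonneg simp: inj_seqs_Cons)
  qed
qed

lemma iid_avg_add:
  assumes "finite S" "S \<noteq> {}"
  shows "iid_avg S (s + t) h = iid_avg S s (\<lambda>U. iid_avg S t (\<lambda>V. h (U \<union> V)))"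
  by (induction s arbitrary: h) (simp_all add: insert_commute)

text \<open>The remaining \<open>l\<close> draws average a constant. The bound
  \<open>k + l \<le> card S\<close> keeps that average away from the junk value 0.\<close>

lemma seq_avg_take:
  assumes "finite S" "k + l \<le> card S"
  shows "seq_avg (k + l) S (\<lambda>xs. f (take k xs)) = seq_avg k S f"
  using assms
proof (induction k arbitrary: S f)
  case 0
  then interpret averaging "seq_avg l S" "inj_seqs l S"
    by (intro averaging_seq_avg) auto
  show ?case by (simp add: const)
next
  case (Suc k)
  have "seq_avg (k + l) (S - {x}) (\<lambda>xs. f (x # take k xs)) =
      seq_avg k (S - {x}) (\<lambda>xs. f (x # xs))" if "x \<in> S" for x
    using Suc.prems that by (intro Suc.IH) auto
  then show ?case by simp
qed

text \<open>Relabelling invariance. With a transposition as \<open>\<pi>\<close> it couples the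
  continuations after two different first draws.\<close>

lemma seq_avg_image:
  assumes "inj_on \<pi> S"
  shows "seq_avg k (\<pi> ` S) f = seq_avg k S (\<lambda>xs. f (map \<pi> xs))"
  using assms
proof (induction k arbitrary: S f)
  case (Suc k)
  have "seq_avg k (\<pi> ` S - {\<pi> x}) (\<lambda>xs. f (\<pi> x # xs)) =
      seq_avg k (S - {x}) (\<lambda>xs. f (\<pi> x # map \<pi> xs))" if "x \<in> S" for x
  proof -
    have "\<pi> ` S - {\<pi> x} = \<pi> ` (S - {x})"
      using Suc.prems that by (auto simp: inj_on_def)
    then show ?thesis
      using Suc.IH[of "S - {x}"] Suc.prems by (simp add: inj_on_diff)
  qed
  then show ?case
    using Suc.prems by (simp add: sum.reindex card_image)
qed simp

lemma seq_avg_permutations: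
  assumes "finite S"
  shows "seq_avg (card S) S f = (\<Sum>xs\<in>permutations_of_set S. f xs) / fact (card S)"
  using assms
proof (induction "card S" arbitrary: S f)
  case (Suc k)
  then have ne: "S \<noteq> {}" by auto
  have "(\<Sum>xs\<in>permutations_of_set S. f xs) =
      (\<Sum>x\<in>S. \<Sum>xs\<in>(#) x ` permutations_of_set (S - {x}). f xs)"
    unfolding permutations_of_set_nonempty[OF ne]
    using Suc.prems by (intro sum.UNION_disjoint) auto
  also have "\<dots> = (\<Sum>x\<in>S. \<Sum>xs\<in>permutations_of_set (S - {x}). f (x # xs))"
    by (simp add: sum.reindex)
  also have "\<dots> = (\<Sum>x\<in>S. fact k * seq_avg k (S - {x}) (\<lambda>xs. f (x # xs)))"
  proof (rule sum.cong)
    fix x assume "x \<in> S"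
    then have "k = card (S - {x})" using Suc by simp
    then show "(\<Sum>xs\<in>permutations_of_set (S - {x}). f (x # xs)) =
        fact k * seq_avg k (S - {x}) (\<lambda>xs. f (x # xs))"
      using Suc.hyps(1)[of "S - {x}" "\<lambda>xs. f (x # xs)"] Suc.prems by simp
  qed simp
  finally show ?case
    by (simp flip: Suc.hyps(2) sum_distrib_left)
qed simp

text \<open>The recursion exposes an order from the front, the process consumes it from the back.
  Written as a sum over all permutations the average is visibly invariant under reversal.\<close>

lemma seq_avg_rev:
  assumes "finite S"
  shows "seq_avg (card S) S (\<lambda>xs. f (rev xs)) = seq_avg (card S) S f"
proof -
  have "(\<Sum>xs\<in>permutations_of_set S. f (rev xs)) = (\<Sum>xs\<in>rev ` permutations_of_set S. f xs)"
    by (subst sum.reindex) (auto simp: inj_on_def)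
  then show ?thesis
    using assms by (simp add: seq_avg_permutations)
qed

section \<open>Probability that a sample covers a fixed set\<close>

text \<open>These are the two leading terms of the binomial expansion of \<open>(k + 1) ^ j\<close>.
  At \<open>j = 0\<close> the truncated exponent \<open>j - 1\<close> is harmless because of the
  factor \<open>real j\<close>.\<close>

lemma power_Suc_step:
  fixes \<beta> :: real
  assumes "0 \<le> \<beta>"
  shows "(real k * \<beta>) ^ j + real j * (real k * \<beta>) ^ (j - 1) * \<beta> \<le> (real (Suc k) * \<beta>) ^ j"
proof -
  have "real k ^ j + real j * real k ^ (j - 1) \<le> real (Suc k) ^ j"
  proof (induction j)
    case (Suc j)
    show ?case
    proof (cases j)
      case [simp]: (Suc i)
      have a: "(1 + real k) * (real k ^ j + real j * real k ^ (j - 1)) \<le> (1 + real k) * (1 + real k) ^ j"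
        using Suc.IH by (intro mult_left_mono) auto
      have b: "real k ^ Suc j + real (Suc j) * real k ^ (Suc j - 1) \<le>
          (1 + real k) * (real k ^ j + real j * real k ^ (j - 1))"
        by (simp add: algebra_simps)
      show ?thesis using order_trans[OF b a] by simp
    qed simp
  qed simp
  then have "(real k ^ j + real j * real k ^ (j - 1)) * \<beta> ^ j \<le> real (Suc k) ^ j * \<beta> ^ j"
    using assms by (intro mult_right_mono) auto
  moreover have "real j * (real k * \<beta>) ^ (j - 1) * \<beta> = real j * real k ^ (j - 1) * \<beta> ^ j"
    by (cases j) (simp_all add: power_mult_distrib)
  ultimately show ?thesis
    by (simp only: power_mult_distrib distrib_right)
qed

text \<open>Condition on the first draw: it lies in \<open>A\<close> with probability at most
  \<open>j * \<beta>\<close> and then one element less has to be covered. Removing the drawn element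
  and one draw leaves \<open>card S - k\<close> unchanged, so one \<open>\<beta>\<close> bounds the
  probability of each single outcome at every step.\<close>

lemma hit_prob_bound:
  fixes \<beta> :: real and A :: "'b set"
  assumes "finite S" "finite A" "card A = j" "0 < \<beta>" "1 \<le> real (card S - k) * \<beta>" "k \<le> card S"
  shows "seq_avg k S (\<lambda>xs. of_bool (A \<subseteq> set xs)) \<le> (real k * \<beta>) ^ j"
  using assms
proof (induction k arbitrary: S A j)
  case 0
  then show ?case by (auto simp: power_0_left)
next
  case (Suc k)
  have pos: "0 < real (card S)" using Suc.prems by simp
  have beta: "1 / real (card S) \<le> \<beta>"
  proof -
    have "1 \<le> real (card S) * \<beta>"
      using Suc.prems by (smt (verit) mult_right_mono of_nat_diff of_nat_0_le_iff)
    then show ?thesis using pos by (simp add: field_simps)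
  qed
  have step: "seq_avg k (S - {x}) (\<lambda>xs. of_bool (A \<subseteq> set (x # xs))) \<le>
      (real k * \<beta>) ^ j + of_bool (x \<in> A) * (real k * \<beta>) ^ (j - 1)" if x: "x \<in> S" for x
  proof -
    have "seq_avg k (S - {x}) (\<lambda>xs. of_bool (A - {x} \<subseteq> set xs)) \<le> (real k * \<beta>) ^ card (A - {x})"
      using Suc.prems x by (intro Suc.IH) (auto simp: Suc_diff_Suc)
    moreover have "(A \<subseteq> set (x # xs)) = (A - {x} \<subseteq> set xs)" for xs by auto
    moreover have "card (A - {x}) = (if x \<in> A then j - 1 else j)"
      using Suc.prems by (simp add: card_Diff_singleton_if)
    ultimately show ?thesis using Suc.prems by (auto simp: add_increasing)
  qed
  have "seq_avg (Suc k) S (\<lambda>xs. of_bool (A \<subseteq> set xs)) \<le>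
      (\<Sum>x\<in>S. (real k * \<beta>) ^ j + of_bool (x \<in> A) * (real k * \<beta>) ^ (j - 1)) / real (card S)"
    using step by (auto intro!: divide_right_mono sum_mono)
  also have "\<dots> = (real k * \<beta>) ^ j + real (card (S \<inter> A)) * (real k * \<beta>) ^ (j - 1) / real (card S)"
    using pos Suc.prems(1) card_gt_0_iff[of S]
    by (simp add: sum.distrib add_divide_distrib of_bool_def sum.If_cases Int_commute
        flip: sum_distrib_right)
  also have "\<dots> \<le> (real k * \<beta>) ^ j + real j * (real k * \<beta>) ^ (j - 1) * \<beta>"
  proof -
    have "real (card (S \<inter> A)) * (real k * \<beta>) ^ (j - 1) \<le> real j * (real k * \<beta>) ^ (j - 1)"
      using Suc.prems by (intro mult_right_mono) (auto intro!: card_mono)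
    then have "real (card (S \<inter> A)) * (real k * \<beta>) ^ (j - 1) * (1 / real (card S)) \<le>
        real j * (real k * \<beta>) ^ (j - 1) * \<beta>"
      using beta Suc.prems by (intro mult_mono) (auto intro!: card_mono)
    then show ?thesis by simp
  qed
  also have "\<dots> \<le> (real (Suc k) * \<beta>) ^ j"
    using Suc.prems by (intro power_Suc_step) auto
  finally show ?case .
qed

text \<open>The recursion of \<open>hit_prob_bound\<close>; with replacement the pool never shrinks,
  so \<open>\<beta>\<close> is exactly \<open>1 / card S\<close>.\<close>

lemma iid_hit_prob_bound:
  fixes A :: "'b set"
  assumes "finite S" "S \<noteq> {}" "finite A" "card A = j"
  shows "iid_avg S t (\<lambda>U. of_bool (A \<subseteq> U)) \<le> (real t / real (card S)) ^ j"
  using assms(3,4)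
proof (induction t arbitrary: A j)
  case 0
  then show ?case by (auto simp: power_0_left)
next
  case (Suc t)
  define \<beta> where "\<beta> = 1 / real (card S)"
  have pos: "0 < real (card S)" "0 \<le> \<beta>"
    using assms by (simp_all add: card_gt_0_iff \<beta>_def)
  have step: "iid_avg S t (\<lambda>U. of_bool (A \<subseteq> insert x U)) \<le>
      (real t * \<beta>) ^ j + of_bool (x \<in> A) * (real t * \<beta>) ^ (j - 1)" for x
  proof -
    have "iid_avg S t (\<lambda>U. of_bool (A - {x} \<subseteq> U)) \<le> (real t * \<beta>) ^ card (A - {x})"
      using Suc.IH[of "A - {x}" "card (A - {x})"] Suc.prems by (simp add: \<beta>_def)
    moreover have "(A \<subseteq> insert x U) = (A - {x} \<subseteq> U)" for U by auto
    moreover have "card (A - {x}) = (if x \<in> A then j - 1 else j)"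
      using Suc.prems by (simp add: card_Diff_singleton_if)
    ultimately show ?thesis using pos by (auto simp: add_increasing)
  qed
  have "iid_avg S (Suc t) (\<lambda>U. of_bool (A \<subseteq> U)) \<le>
      (\<Sum>x\<in>S. (real t * \<beta>) ^ j + of_bool (x \<in> A) * (real t * \<beta>) ^ (j - 1)) / real (card S)"
    using step by (auto intro!: divide_right_mono sum_mono)
  also have "\<dots> = (real t * \<beta>) ^ j + real (card (S \<inter> A)) * (real t * \<beta>) ^ (j - 1) * \<beta>"
    using pos assms
    by (simp add: sum.distrib add_divide_distrib of_bool_def sum.If_cases Int_commute \<beta>_def
        flip: sum_distrib_right)
  also have "\<dots> \<le> (real t * \<beta>) ^ j + real j * (real t * \<beta>) ^ (j - 1) * \<beta>"
    using Suc.prems pos by (intro add_left_mono mult_right_mono) (auto intro: card_mono)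
  also have "\<dots> \<le> (real (Suc t) * \<beta>) ^ j"
    using pos by (intro power_Suc_step) auto
  finally show ?case by (simp add: \<beta>_def)
qed

text \<open>Drawing with replacement covers less, so it makes antitone functionals larger.\<close>

lemma seq_avg_le_iid_avg_aux:
  assumes "finite S0" "R \<inter> S = {}" "R \<union> S = S0" "k \<le> card S"
    and anti: "\<And>U V. U \<subseteq> V \<Longrightarrow> h V \<le> h U"
  shows "seq_avg k S (\<lambda>xs. h (R \<union> set xs)) \<le> iid_avg S0 k (\<lambda>U. h (R \<union> U))"
  using assms(1-4)
proof (induction k arbitrary: S R)
  case (Suc k)
  have fin: "finite S" "finite R" using Suc.prems by (auto intro: finite_subset)
  have ne: "S \<noteq> {}" using Suc.prems by auto
  interpret averaging "iid_avg S0 k" "Pow S0"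
    using Suc.prems ne by (intro averaging_iid_avg) auto
  define a where "a x = iid_avg S0 k (\<lambda>U. h (insert x R \<union> U))" for x
  define b where "b = iid_avg S0 k (\<lambda>U. h (R \<union> U))"
  have aR: "a x = b" if "x \<in> R" for x
    using that by (simp add: a_def b_def insert_absorb)
  have ab: "a x \<le> b" for x
    unfolding a_def b_def by (intro mono anti) auto
  have step: "seq_avg k (S - {x}) (\<lambda>xs. h (R \<union> set (x # xs))) \<le> a x" if "x \<in> S" for x
  proof -
    have "insert x R \<inter> (S - {x}) = {}" "insert x R \<union> (S - {x}) = S0" "k \<le> card (S - {x})"
      using Suc.prems that fin by auto
    from Suc.IH[OF Suc.prems(1) this] show ?thesis
      by (simp add: a_def)
  qed
  have "seq_avg (Suc k) S (\<lambda>xs. h (R \<union> set xs)) \<le> (\<Sum>x\<in>S. a x) / real (card S)"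
    using step by (auto intro!: divide_right_mono sum_mono)
  \<comment> \<open>A draw with replacement may also land in the set \<open>R\<close> drawn before.
    There \<open>a\<close> takes its largest value \<open>b\<close>, so enlarging the range of the
    average from \<open>S\<close> to \<open>S0\<close> can only increase it.\<close>
  also have "\<dots> \<le> (\<Sum>x\<in>S0. a x) / real (card S0)"
  proof -
    have s: "(\<Sum>x\<in>S0. a x) = (\<Sum>x\<in>S. a x) + real (card R) * b"
      using Suc.prems fin aR by (subst Suc.prems(3)[symmetric], subst sum.union_disjoint) auto
    have c: "card S0 = card R + card S"
      using Suc.prems fin card_Un_disjoint by metis
    have "(\<Sum>x\<in>S. a x) \<le> real (card S) * b"
      using sum_bounded_above[of S a b] ab by simp
    then have "(\<Sum>x\<in>S. a x) * real (card R) \<le> real (card S) * b * real (card R)"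
      by (intro mult_right_mono) auto
    moreover have "0 < card S" using ne fin by (simp add: card_gt_0_iff)
    ultimately show ?thesis
      unfolding s c by (simp add: field_simps)
  qed
  also have "\<dots> = iid_avg S0 (Suc k) (\<lambda>U. h (R \<union> U))"
    by (simp add: a_def)
  finally show ?case .
qed simp

lemma seq_avg_le_iid_avg:
  assumes "finite S" "k \<le> card S" "\<And>U V. U \<subseteq> V \<Longrightarrow> h V \<le> h U"
  shows "seq_avg k S (\<lambda>xs. h (set xs)) \<le> iid_avg S k h"
  using seq_avg_le_iid_avg_aux[of S "{}" S k h] assms by simp

text \<open>Given the first \<open>k\<close> draws, the next one is uniform on the
  \<open>card S - k\<close> elements left. For nonnegative \<open>\<psi>\<close> the sum over these
  may be enlarged to the fixed set \<open>S0\<close>, which is kept apart from \<open>S\<close>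
  because the induction shrinks \<open>S\<close>.\<close>

lemma seq_avg_next:
  assumes "finite S" "k < card S" "S \<subseteq> S0" "finite S0" "\<And>U x. 0 \<le> \<psi> U x"
  shows "seq_avg (Suc k) S (\<lambda>xs. \<psi> (set (take k xs)) (xs ! k)) \<le>
    (\<Sum>y\<in>S0. seq_avg k S (\<lambda>xs. \<psi> (set xs) y)) / real (card S - k)"
  using assms
proof (induction k arbitrary: S \<psi>)
  case 0
  then show ?case by (auto intro!: divide_right_mono sum_mono2)
next
  case (Suc k)
  have "seq_avg (Suc (Suc k)) S (\<lambda>xs. \<psi> (set (take (Suc k) xs)) (xs ! Suc k)) =
      (\<Sum>x\<in>S. seq_avg (Suc k) (S - {x}) (\<lambda>xs. \<psi> (insert x (set (take k xs))) (xs ! k))) /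
        real (card S)"
    by (simp only: seq_avg.simps take_Suc_Cons nth_Cons_Suc list.set)
  also have "\<dots> \<le> (\<Sum>x\<in>S. (\<Sum>y\<in>S0. seq_avg k (S - {x}) (\<lambda>xs. \<psi> (insert x (set xs)) y)) /
      real (card S - Suc k)) / real (card S)"
  proof (intro divide_right_mono sum_mono)
    fix x assume x: "x \<in> S"
    then have "card (S - {x}) - k = card S - Suc k" "k < card (S - {x})" "S - {x} \<subseteq> S0"
      using Suc.prems by auto
    then show "seq_avg (Suc k) (S - {x}) (\<lambda>xs. \<psi> (insert x (set (take k xs))) (xs ! k)) \<le>
        (\<Sum>y\<in>S0. seq_avg k (S - {x}) (\<lambda>xs. \<psi> (insert x (set xs)) y)) / real (card S - Suc k)"
      using Suc.IH[of "S - {x}" "\<lambda>U. \<psi> (insert x U)"] Suc.prems by (simp del: seq_avg.simps)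
  qed simp
  also have "\<dots> = (\<Sum>y\<in>S0. seq_avg (Suc k) S (\<lambda>xs. \<psi> (set xs) y)) / real (card S - Suc k)"
    by (simp add: sum.swap[of _ S S0] mult.commute flip: sum_divide_distrib)
  finally show ?case .
qed

section \<open>Concentration for injective sequences\<close>

text \<open>Hoeffding's lemma for the uniform distribution on \<open>S\<close>: oscillation
  \<open>c\<close> confines the centred values to an interval of length \<open>c\<close>.\<close>

lemma average_exp_le:
  fixes g :: "'b \<Rightarrow> real"
  assumes "finite S" "S \<noteq> {}" "0 < l" and osc: "\<And>x y. x \<in> S \<Longrightarrow> y \<in> S \<Longrightarrow> \<bar>g x - g y\<bar> \<le> c"
  defines "m \<equiv> (\<Sum>x\<in>S. g x) / real (card S)"
  shows "(\<Sum>x\<in>S. exp (l * (g x - m))) / real (card S) \<le> exp (l ^ 2 * c ^ 2 / 8)"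
proof -
  let ?M = "measure_pmf (pmf_of_set S)"
  define a where "a = Min (g ` S) - m"
  have Min: "Min (g ` S) \<in> g ` S" "\<And>x. x \<in> S \<Longrightarrow> Min (g ` S) \<le> g x"
    using assms by (auto intro: Min_in)
  have range: "g x - m \<in> {a..a + c}" if x: "x \<in> S" for x
  proof -
    obtain y where "y \<in> S" "Min (g ` S) = g y" using Min by auto
    then show ?thesis using osc[of x y] Min(2)[of x] x by (auto simp: a_def)
  qed
  have supp: "set_pmf (pmf_of_set S) = S"
    using assms by simp
  interpret prob_space ?M by (rule measure_pmf.prob_space_axioms)
  interpret interval_bounded_random_variable ?M "\<lambda>x. g x - m" a "a + c"
  proof
    show "AE x in ?M. g x - m \<in> {a..a + c}"
      using range by (auto simp: AE_measure_pmf_iff supp)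
  qed simp
  have "measure_pmf.expectation (pmf_of_set S) (\<lambda>x. g x - m) = (\<Sum>x\<in>S. g x - m) / real (card S)"
    using assms(1,2) by (intro integral_pmf_of_set)
  then have E0: "measure_pmf.expectation (pmf_of_set S) (\<lambda>x. g x - m) = 0"
    using assms by (simp add: sum_subtractf diff_divide_distrib)
  have "nn_integral ?M (\<lambda>x. exp (l * (g x - m))) = ennreal (measure_pmf.expectation (pmf_of_set S) (\<lambda>x. exp (l * (g x - m))))"
    using assms by (intro nn_integral_eq_integral integrable_measure_pmf_finite) auto
  with Hoeffdings_lemma_nn_integral_0[OF \<open>0 < l\<close> E0]
  have "measure_pmf.expectation (pmf_of_set S) (\<lambda>x. exp (l * (g x - m))) \<le> exp (l ^ 2 * c ^ 2 / 8)"
    by simp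
  then show ?thesis
    using assms by (simp add: integral_pmf_of_set)
qed

text \<open>A bounded difference argument by induction on the first draw. Let \<open>g x\<close> be
  the conditional mean given first draw \<open>x\<close>. Continuations after \<open>y\<close> are
  the images under the transposition of \<open>x\<close> and \<open>y\<close> of those after
  \<open>x\<close>, so \<open>g\<close> oscillates by at most \<open>c\<close> and Hoeffding's lemma
  applies to it; the induction hypothesis on \<open>S - {x}\<close> handles the remaining
  draws.\<close>

theorem seq_avg_mgf:
  fixes f :: "'b list \<Rightarrow> real"
  assumes "finite S" "k \<le> card S" "0 < l"
    and lip: "\<And>a b xs. a \<in> S \<Longrightarrow> b \<in> S \<Longrightarrow> xs \<in> inj_seqs k S \<Longrightarrow>
      \<bar>f (map (Transposition.transpose a b) xs) - f xs\<bar> \<le> c"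
  shows "seq_avg k S (\<lambda>xs. exp (l * (f xs - seq_avg k S f))) \<le> exp (real k * (l ^ 2 * c ^ 2 / 8))"
  using assms
proof (induction k arbitrary: S f)
  case (Suc k)
  define g where "g x = seq_avg k (S - {x}) (\<lambda>xs. f (x # xs))" for x
  define m where "m = seq_avg (Suc k) S f"
  have m: "m = (\<Sum>x\<in>S. g x) / real (card S)"
    by (simp add: m_def g_def)
  have ne: "S \<noteq> {}" using Suc.prems by auto
  have osc: "\<bar>g x - g y\<bar> \<le> c" if xy: "x \<in> S" "y \<in> S" for x y
  proof -
    interpret averaging "seq_avg k (S - {x})" "inj_seqs k (S - {x})"
      using Suc.prems xy by (intro averaging_seq_avg) auto
    have im: "S - {y} = Transposition.transpose x y ` (S - {x})"
      using xy by (subst image_set_diff) (auto simp: transpose_image_eq)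
    have gy: "g y = seq_avg k (S - {x}) (\<lambda>xs. f (map (Transposition.transpose x y) (x # xs)))"
      unfolding g_def im by (subst seq_avg_image) (auto intro: inj_on_transpose)
    have "g x - g y = seq_avg k (S - {x}) (\<lambda>xs. f (x # xs) - f (map (Transposition.transpose x y) (x # xs)))"
      unfolding gy unfolding g_def by (rule diff[symmetric])
    also have "\<bar>\<dots>\<bar> \<le> seq_avg k (S - {x}) (\<lambda>xs. \<bar>f (x # xs) - f (map (Transposition.transpose x y) (x # xs))\<bar>)"
      by (rule abs_le)
    also have "\<dots> \<le> seq_avg k (S - {x}) (\<lambda>xs. c)"
    proof (rule mono)
      fix xs assume "xs \<in> inj_seqs k (S - {x})"
      then have "x # xs \<in> inj_seqs (Suc k) S"
        using xy by (simp add: inj_seqs_Cons)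
      then show "\<bar>f (x # xs) - f (map (Transposition.transpose x y) (x # xs))\<bar> \<le> c"
        using Suc.prems(4)[of x y "x # xs"] xy by (simp add: abs_minus_commute)
    qed
    finally show ?thesis by (simp only: const)
  qed
  have step: "seq_avg k (S - {x}) (\<lambda>xs. exp (l * (f (x # xs) - m))) \<le>
      exp (l * (g x - m)) * exp (real k * (l ^ 2 * c ^ 2 / 8))" if x: "x \<in> S" for x
  proof -
    interpret averaging "seq_avg k (S - {x})" "inj_seqs k (S - {x})"
      using Suc.prems x by (intro averaging_seq_avg) auto
    have "seq_avg k (S - {x}) (\<lambda>xs. exp (l * (f (x # xs) - m))) =
        seq_avg k (S - {x}) (\<lambda>xs. exp (l * (g x - m)) * exp (l * (f (x # xs) - g x)))"
      by (simp add: algebra_simps flip: exp_add)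
    also have "\<dots> = exp (l * (g x - m)) * seq_avg k (S - {x}) (\<lambda>xs. exp (l * (f (x # xs) - g x)))"
      by (rule scale)
    also have "\<dots> \<le> exp (l * (g x - m)) * exp (real k * (l ^ 2 * c ^ 2 / 8))"
      unfolding g_def
    proof (intro mult_left_mono Suc.IH)
      fix a b xs assume *: "a \<in> S - {x}" "b \<in> S - {x}" "xs \<in> inj_seqs k (S - {x})"
      then have "x # xs \<in> inj_seqs (Suc k) S"
        using x by (simp add: inj_seqs_Cons)
      then show "\<bar>f (x # map (Transposition.transpose a b) xs) - f (x # xs)\<bar> \<le> c"
        using Suc.prems(4)[of a b "x # xs"] * by auto
    qed (use Suc.prems x in auto)
    finally show ?thesis .
  qed
  have "seq_avg (Suc k) S (\<lambda>xs. exp (l * (f xs - m))) \<le>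
      (\<Sum>x\<in>S. exp (l * (g x - m)) * exp (real k * (l ^ 2 * c ^ 2 / 8))) / real (card S)"
    using step by (auto intro!: divide_right_mono sum_mono)
  also have "\<dots> = (\<Sum>x\<in>S. exp (l * (g x - m))) / real (card S) * exp (real k * (l ^ 2 * c ^ 2 / 8))"
    by (simp flip: sum_distrib_right)
  also have "\<dots> \<le> exp (l ^ 2 * c ^ 2 / 8) * exp (real k * (l ^ 2 * c ^ 2 / 8))"
    using average_exp_le[OF Suc.prems(1) ne Suc.prems(3), of g c] osc
    by (intro mult_right_mono) (auto simp: m)
  also have "\<dots> = exp (real (Suc k) * (l ^ 2 * c ^ 2 / 8))"
    by (simp add: algebra_simps add_divide_distrib flip: exp_add)
  finally show ?case
    by (simp only: m_def)
qed simp

lemma seq_avg_tail: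
  fixes f :: "'b list \<Rightarrow> real"
  assumes "finite S" "0 < k" "k \<le> card S" "0 < t" "0 < c"
    and lip: "\<And>a b xs. a \<in> S \<Longrightarrow> b \<in> S \<Longrightarrow> xs \<in> inj_seqs k S \<Longrightarrow>
      \<bar>f (map (Transposition.transpose a b) xs) - f xs\<bar> \<le> c"
  shows "seq_avg k S (\<lambda>xs. of_bool (t \<le> \<bar>f xs - seq_avg k S f\<bar>)) \<le>
    2 * exp (- 2 * t ^ 2 / (real k * c ^ 2))"
proof -
  interpret averaging "seq_avg k S" "inj_seqs k S"
    using assms by (intro averaging_seq_avg)
  \<comment> \<open>The minimizer of the Chernoff exponent
    \<open>k * l^2 * c^2 / 8 - l * t\<close>.\<close>
  define l where "l = 4 * t / (real k * c ^ 2)"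
  have l: "0 < l" using assms by (simp add: l_def)
  have one_sided: "seq_avg k S (\<lambda>xs. of_bool (t \<le> g xs - seq_avg k S g)) \<le>
      exp (- 2 * t ^ 2 / (real k * c ^ 2))"
    if g: "\<And>a b xs. a \<in> S \<Longrightarrow> b \<in> S \<Longrightarrow> xs \<in> inj_seqs k S \<Longrightarrow>
      \<bar>g (map (Transposition.transpose a b) xs) - g xs\<bar> \<le> c" for g
  proof -
    have "exp (l * t) * seq_avg k S (\<lambda>xs. of_bool (exp (l * t) \<le> exp (l * (g xs - seq_avg k S g)))) \<le>
        seq_avg k S (\<lambda>xs. exp (l * (g xs - seq_avg k S g)))"
      by (rule markov) simp
    also have "\<dots> \<le> exp (real k * (l ^ 2 * c ^ 2 / 8))"
      using assms l g by (intro seq_avg_mgf) auto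
    also have "\<dots> = exp (l * t) * exp (real k * (l ^ 2 * c ^ 2 / 8) - l * t)"
      by (simp flip: exp_add)
    finally have "seq_avg k S (\<lambda>xs. of_bool (t \<le> g xs - seq_avg k S g)) \<le>
        exp (real k * (l ^ 2 * c ^ 2 / 8) - l * t)"
      using l by simp
    also have "real k * (l ^ 2 * c ^ 2 / 8) - l * t = - 2 * t ^ 2 / (real k * c ^ 2)"
      using assms unfolding l_def by (simp add: field_simps power2_eq_square)
    finally show ?thesis .
  qed
  have neg: "seq_avg k S (\<lambda>xs. - f xs) = - seq_avg k S f"
    using scale[of "-1" f] by simp
  have "seq_avg k S (\<lambda>xs. of_bool (t \<le> \<bar>f xs - seq_avg k S f\<bar>)) \<le>
      seq_avg k S (\<lambda>xs. of_bool (t \<le> f xs - seq_avg k S f \<or> t \<le> - f xs - seq_avg k S (\<lambda>xs. - f xs)))"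
    unfolding neg by (rule prob_mono) auto
  also have "\<dots> \<le> seq_avg k S (\<lambda>xs. of_bool (t \<le> f xs - seq_avg k S f)) +
      seq_avg k S (\<lambda>xs. of_bool (t \<le> - f xs - seq_avg k S (\<lambda>xs. - f xs)))"
    by (rule prob_disj)
  also have "\<dots> \<le> exp (- 2 * t ^ 2 / (real k * c ^ 2)) + exp (- 2 * t ^ 2 / (real k * c ^ 2))"
    using lip by (intro add_mono one_sided) (auto simp: abs_minus_commute)
  finally show ?thesis by simp
qed

section \<open>Functions that are Lipschitz only on a good set of sequences\<close>

definition hamming :: "nat \<Rightarrow> 'b list \<Rightarrow> 'b list \<Rightarrow> nat" where
  "hamming k xs ys = card {i. i < k \<and> xs ! i \<noteq> ys ! i}"

lemma hamming_le: "hamming k xs ys \<le> k"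
  unfolding hamming_def using card_mono[of "{..<k}" "{i. i < k \<and> xs ! i \<noteq> ys ! i}"] by auto

lemma hamming_triangle: "hamming k xs zs \<le> hamming k xs ys + hamming k ys zs"
proof -
  have "hamming k xs zs \<le> card ({i. i < k \<and> xs ! i \<noteq> ys ! i} \<union> {i. i < k \<and> ys ! i \<noteq> zs ! i})"
    unfolding hamming_def by (rule card_mono) auto
  also have "\<dots> \<le> hamming k xs ys + hamming k ys zs"
    unfolding hamming_def by (rule card_Un_le)
  finally show ?thesis .
qed

lemma hamming_commute: "hamming k xs ys = hamming k ys xs"
  unfolding hamming_def by metis

text \<open>In a distinct list each of \<open>a\<close> and \<open>b\<close> occupies at most one
  position.\<close>

lemma hamming_transpose:
  assumes "distinct xs" "length xs = k"
  shows "hamming k (map (Transposition.transpose a b) xs) xs \<le> 2"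
proof -
  have "hamming k (map (Transposition.transpose a b) xs) xs \<le> card {i. i < k \<and> xs ! i \<in> {a, b}}"
    unfolding hamming_def using assms by (intro card_mono) (auto simp: Transposition.transpose_def split: if_splits)
  also have "\<dots> = card ((!) xs ` {i. i < k \<and> xs ! i \<in> {a, b}})"
    using assms by (intro card_image[symmetric]) (auto simp: inj_on_def nth_eq_iff_index_eq)
  also have "\<dots> \<le> card {a, b}"
    by (intro card_mono) auto
  also have "\<dots> \<le> 2"
    by (simp add: card_insert_if)
  finally show ?thesis .
qed

text \<open>The largest Lipschitz extension, \<open>F xs = Min (f ys + D * hamming k xs ys)\<close>
  over \<open>ys\<close> in \<open>\<Gamma>\<close>. Its values exceed those of \<open>f\<close> by
  at most \<open>D * k\<close> because the distance never exceeds \<open>k\<close>.\<close>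

lemma mcshane_extension:
  fixes f :: "'b list \<Rightarrow> real"
  assumes "finite \<Gamma>" "\<Gamma> \<noteq> {}" "0 \<le> D"
    and lip: "\<And>xs ys. xs \<in> \<Gamma> \<Longrightarrow> ys \<in> \<Gamma> \<Longrightarrow> f xs \<le> f ys + D * real (hamming k xs ys)"
    and range: "\<And>xs. xs \<in> \<Gamma> \<Longrightarrow> 0 \<le> f xs \<and> f xs \<le> M"
  obtains F where "\<And>xs. xs \<in> \<Gamma> \<Longrightarrow> F xs = f xs"
    and "\<And>xs. 0 \<le> F xs \<and> F xs \<le> M + D * real k"
    and "\<And>xs ys. F xs \<le> F ys + D * real (hamming k xs ys)"
proof
  define F where "F xs = Min ((\<lambda>ys. f ys + D * real (hamming k xs ys)) ` \<Gamma>)" for xs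
  have le: "F xs \<le> f ys + D * real (hamming k xs ys)" if "ys \<in> \<Gamma>" for xs ys
    unfolding F_def using assms that by (intro Min_le) auto
  have ex: "\<exists>ys\<in>\<Gamma>. F xs = f ys + D * real (hamming k xs ys)" for xs
  proof -
    have "F xs \<in> (\<lambda>ys. f ys + D * real (hamming k xs ys)) ` \<Gamma>"
      unfolding F_def using assms by (intro Min_in) auto
    then show ?thesis by auto
  qed
  show "F xs = f xs" if "xs \<in> \<Gamma>" for xs
  proof (rule antisym)
    show "F xs \<le> f xs"
      using le[OF that, of xs] by (simp add: hamming_def)
    obtain ys where "ys \<in> \<Gamma>" "F xs = f ys + D * real (hamming k xs ys)" using ex by blast
    then show "f xs \<le> F xs" using lip[OF that] by simp
  qed
  show "0 \<le> F xs \<and> F xs \<le> M + D * real k" for xs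
  proof -
    obtain ys where ys: "ys \<in> \<Gamma>" "F xs = f ys + D * real (hamming k xs ys)" using ex by blast
    have "D * real (hamming k xs ys) \<le> D * real k"
      using assms hamming_le[of k xs ys] by (intro mult_left_mono) auto
    then show ?thesis using ys range[of ys] \<open>0 \<le> D\<close> by auto
  qed
  show "F xs \<le> F ys + D * real (hamming k xs ys)" for xs ys
  proof -
    obtain zs where zs: "zs \<in> \<Gamma>" "F ys = f zs + D * real (hamming k ys zs)" using ex by blast
    have "D * real (hamming k xs zs) \<le> D * real (hamming k xs ys + hamming k ys zs)"
      using assms hamming_triangle[of k xs zs ys] by (intro mult_left_mono) auto
    then show ?thesis using le[OF zs(1), of xs] zs(2) by (simp add: algebra_simps)
  qed
qed

text \<open>The tail bound applies to the extension \<open>F\<close> of \<open>f\<close> from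
  \<open>\<Gamma>\<close>. Outside \<open>\<Gamma>\<close> the two differ by at most
  \<open>M + D * k\<close>, so their means differ by at most
  \<open>(M + D * k) * \<epsilon>\<close>, which is added to the deviation. A transposition moves
  two positions, hence \<open>2 * D\<close> in the exponent.\<close>

theorem seq_avg_concentration:
  fixes f :: "'b list \<Rightarrow> real"
  assumes S: "finite S" "0 < k" "k \<le> card S" and "0 < t" "0 < D"
    and \<Gamma>: "\<Gamma> \<subseteq> inj_seqs k S"
    and lip: "\<And>xs ys. xs \<in> \<Gamma> \<Longrightarrow> ys \<in> \<Gamma> \<Longrightarrow> f xs \<le> f ys + D * real (hamming k xs ys)"
    and range: "\<And>xs. xs \<in> inj_seqs k S \<Longrightarrow> 0 \<le> f xs \<and> f xs \<le> M"
    and \<epsilon>: "seq_avg k S (\<lambda>xs. of_bool (xs \<notin> \<Gamma>)) \<le> \<epsilon>"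
  shows "seq_avg k S (\<lambda>xs. of_bool (t + (M + D * real k) * \<epsilon> \<le> \<bar>f xs - seq_avg k S f\<bar>)) \<le>
    2 * exp (- 2 * t ^ 2 / (real k * (2 * D) ^ 2)) + \<epsilon>"
proof (cases "\<Gamma> = {}")
  case True
  interpret averaging "seq_avg k S" "inj_seqs k S"
    using S by (intro averaging_seq_avg)
  \<comment> \<open>With an empty \<open>\<Gamma>\<close> there is nothing to extend, but the
    claimed bound then exceeds 1.\<close>
  have "1 \<le> \<epsilon>" using \<epsilon> True by (simp add: one)
  moreover have "0 \<le> 2 * exp (- 2 * t ^ 2 / (real k * (2 * D) ^ 2))" by simp
  moreover have "seq_avg k S (\<lambda>xs. of_bool (t + (M + D * real k) * \<epsilon> \<le> \<bar>f xs - seq_avg k S f\<bar>)) \<le> 1"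
    by (rule prob_le_one)
  ultimately show ?thesis by linarith
next
  case False
  interpret averaging "seq_avg k S" "inj_seqs k S"
    using S by (intro averaging_seq_avg)
  have fin: "finite \<Gamma>" using \<Gamma> finite_inj_seqs[OF S(1)] by (rule finite_subset)
  obtain F where F: "\<And>xs. xs \<in> \<Gamma> \<Longrightarrow> F xs = f xs"
    "\<And>xs. 0 \<le> F xs \<and> F xs \<le> M + D * real k"
    "\<And>xs ys. F xs \<le> F ys + D * real (hamming k xs ys)"
  proof (rule mcshane_extension[OF fin False less_imp_le[OF \<open>0 < D\<close>]])
    show "f xs \<le> f ys + D * real (hamming k xs ys)" if "xs \<in> \<Gamma>" "ys \<in> \<Gamma>" for xs ys
      using lip that .
    show "0 \<le> f xs \<and> f xs \<le> M" if "xs \<in> \<Gamma>" for xs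
      using range \<Gamma> that by blast
  qed (rule that)
  have E: "\<bar>seq_avg k S F - seq_avg k S f\<bar> \<le> (M + D * real k) * \<epsilon>"
  proof -
    have "\<bar>seq_avg k S F - seq_avg k S f\<bar> \<le> seq_avg k S (\<lambda>xs. \<bar>F xs - f xs\<bar>)"
      unfolding diff[symmetric] by (rule abs_le)
    also have "\<dots> \<le> seq_avg k S (\<lambda>xs. (M + D * real k) * of_bool (xs \<notin> \<Gamma>))"
    proof (rule mono)
      fix xs assume "xs \<in> inj_seqs k S"
      moreover have "0 \<le> D * real k" using \<open>0 < D\<close> by simp
      ultimately show "\<bar>F xs - f xs\<bar> \<le> (M + D * real k) * of_bool (xs \<notin> \<Gamma>)"
        using F(1)[of xs] F(2)[of xs] range[of xs] by (cases "xs \<in> \<Gamma>") auto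
    qed
    also have "\<dots> = (M + D * real k) * seq_avg k S (\<lambda>xs. of_bool (xs \<notin> \<Gamma>))"
      by (rule scale)
    also have "\<dots> \<le> (M + D * real k) * \<epsilon>"
      using F(2)[of "[]"] \<epsilon> by (intro mult_left_mono) auto
    finally show ?thesis .
  qed
  have lipF: "\<bar>F (map (Transposition.transpose a b) xs) - F xs\<bar> \<le> 2 * D"
    if "a \<in> S" "b \<in> S" "xs \<in> inj_seqs k S" for a b xs
  proof -
    have "hamming k (map (Transposition.transpose a b) xs) xs \<le> 2"
      using that by (intro hamming_transpose) (auto simp: inj_seqs_def)
    then have "D * real (hamming k (map (Transposition.transpose a b) xs) xs) \<le> D * 2"
      using \<open>0 < D\<close> by (intro mult_left_mono) auto
    then show ?thesis
      using F(3)[of xs "map (Transposition.transpose a b) xs"] F(3)[of "map (Transposition.transpose a b) xs" xs]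
      by (simp add: hamming_commute[of k xs])
  qed
  have "seq_avg k S (\<lambda>xs. of_bool (t + (M + D * real k) * \<epsilon> \<le> \<bar>f xs - seq_avg k S f\<bar>)) \<le>
      seq_avg k S (\<lambda>xs. of_bool (t \<le> \<bar>F xs - seq_avg k S F\<bar> \<or> xs \<notin> \<Gamma>))"
  proof (rule prob_mono)
    fix xs
    assume "t + (M + D * real k) * \<epsilon> \<le> \<bar>f xs - seq_avg k S f\<bar>"
    with E F(1)[of xs] show "t \<le> \<bar>F xs - seq_avg k S F\<bar> \<or> xs \<notin> \<Gamma>"
      by (cases "xs \<in> \<Gamma>") auto
  qed
  also have "\<dots> \<le> seq_avg k S (\<lambda>xs. of_bool (t \<le> \<bar>F xs - seq_avg k S F\<bar>)) +
      seq_avg k S (\<lambda>xs. of_bool (xs \<notin> \<Gamma>))"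
    by (rule prob_disj)
  also have "\<dots> \<le> 2 * exp (- 2 * t ^ 2 / (real k * (2 * D) ^ 2)) + \<epsilon>"
    using \<open>0 < t\<close> \<open>0 < D\<close> S lipF \<epsilon> by (intro add_mono seq_avg_tail) auto
  finally show ?thesis .
qed

section \<open>Moments of counts of spread families\<close>

text \<open>A set of at most \<open>r\<close> elements is coded by a list of length exactly
  \<open>r\<close> over \<open>U\<close> and one extra symbol; \<open>None\<close> serves as
  padding.\<close>

lemma card_small_subsets:
  assumes "finite U"
  shows "card {B. B \<subseteq> U \<and> card B \<le> r} \<le> (card U + 1) ^ r"
proof -
  let ?L = "{l. set l \<subseteq> insert None (Some ` U) \<and> length l = r}"
  have "{B. B \<subseteq> U \<and> card B \<le> r} \<subseteq> (\<lambda>l. {x. Some x \<in> set l}) ` ?L"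
  proof
    fix B assume "B \<in> {B. B \<subseteq> U \<and> card B \<le> r}"
    then have B: "B \<subseteq> U" "card B \<le> r" "finite B"
      using finite_subset[OF _ assms] by auto
    obtain xs where xs: "set xs = B" "distinct xs" using finite_distinct_list[OF B(3)] by blast
    define l where "l = map Some xs @ replicate (r - length xs) None"
    have "length xs \<le> r" using xs B distinct_card[of xs] by simp
    then have "l \<in> ?L" using xs B by (auto simp: l_def)
    moreover have "B = {x. Some x \<in> set l}" using xs by (auto simp: l_def)
    ultimately show "B \<in> (\<lambda>l. {x. Some x \<in> set l}) ` ?L" by blast
  qed
  moreover have fin: "finite ?L" using assms by (intro finite_lists_length_eq) auto
  ultimately have "card {B. B \<subseteq> U \<and> card B \<le> r} \<le> card ((\<lambda>l. {x. Some x \<in> set l}) ` ?L)"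
    by (intro card_mono finite_imageI)
  also have "\<dots> \<le> card ?L"
    using fin by (rule card_image_le)
  also have "\<dots> = (card U + 1) ^ r"
    using assms by (subst card_lists_length_eq) (auto simp: card_image)
  finally show ?thesis .
qed

text \<open>For a random set containing each element independently with probability
  \<open>p\<close>, the sum is the expected number of members of the family that contain
  \<open>B\<close> and lie inside the random set, given that \<open>B\<close> does. The bound
  \<open>K\<close> must hold for every \<open>B\<close>; the empty set gives the plain mean.\<close>

definition spread :: "'i set \<Rightarrow> ('i \<Rightarrow> 'b set) \<Rightarrow> nat \<Rightarrow> real \<Rightarrow> real \<Rightarrow> bool" where
  "spread I A r p K \<longleftrightarrow> finite I \<and> (\<forall>i\<in>I. finite (A i) \<and> card (A i) \<le> r) \<and>
     (\<forall>B. finite B \<longrightarrow> (\<Sum>i | i \<in> I \<and> B \<subseteq> A i. p ^ (card (A i) - card B)) \<le> K)"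

lemma spread_nonneg: "spread I A r p K \<Longrightarrow> 0 \<le> p \<Longrightarrow> 0 \<le> K"
  unfolding spread_def by (meson finite.emptyI order_trans sum_nonneg zero_le_power)

text \<open>Group the members by their trace \<open>B\<close> on \<open>U\<close>. There are at most
  \<open>(card U + 1) ^ r\<close> traces, and \<open>spread\<close> bounds the contribution of each
  by \<open>K\<close>.\<close>

lemma spread_sum:
  assumes "spread I A r p K" "0 \<le> p" "finite U"
  shows "(\<Sum>i\<in>I. p ^ card (A i - U)) \<le> K * real (card U + 1) ^ r"
proof -
  let ?B = "{B. B \<subseteq> U \<and> card B \<le> r}"
  have I: "finite I" "\<And>i. i \<in> I \<Longrightarrow> finite (A i)" "\<And>i. i \<in> I \<Longrightarrow> card (A i) \<le> r"
    using assms by (auto simp: spread_def)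
  have finB: "finite ?B" using assms by (intro finite_subset[of ?B "Pow U"]) auto
  have "(\<Sum>i\<in>I. p ^ card (A i - U)) = (\<Sum>B\<in>?B. \<Sum>i | i \<in> I \<and> A i \<inter> U = B. p ^ card (A i - U))"
  proof (intro sum.group[symmetric] I finB subsetI)
    fix B assume "B \<in> (\<lambda>i. A i \<inter> U) ` I"
    then obtain i where i: "i \<in> I" "B = A i \<inter> U" by auto
    then have "card B \<le> card (A i)" using I by (intro card_mono) auto
    then show "B \<in> ?B" using i I(3)[of i] by auto
  qed
  also have "\<dots> \<le> (\<Sum>B\<in>?B. K)"
  proof (rule sum_mono)
    fix B assume B: "B \<in> ?B"
    then have "finite B" using finite_subset[OF _ assms(3)] by auto
    have "(\<Sum>i | i \<in> I \<and> A i \<inter> U = B. p ^ card (A i - U)) =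
        (\<Sum>i | i \<in> I \<and> A i \<inter> U = B. p ^ (card (A i) - card B))"
      using I \<open>finite B\<close> by (intro sum.cong) (auto simp: card_Diff_subset_Int)
    also have "\<dots> \<le> (\<Sum>i | i \<in> I \<and> B \<subseteq> A i. p ^ (card (A i) - card B))"
      using I assms by (intro sum_mono2) auto
    also have "\<dots> \<le> K"
      using assms \<open>finite B\<close> by (simp add: spread_def)
    finally show "(\<Sum>i | i \<in> I \<and> A i \<inter> U = B. p ^ card (A i - U)) \<le> K" .
  qed
  also have "\<dots> = K * real (card ?B)" by simp
  also have "\<dots> \<le> K * real (card U + 1) ^ r"
    using of_nat_mono[OF card_small_subsets[OF \<open>finite U\<close>, of r], where 'a = real]
      spread_nonneg[OF assms(1,2)]
    by (intro mult_left_mono) (simp_all add: add.commute)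
  finally show ?thesis .
qed

context averaging
begin

text \<open>Expand one factor of the power at a time. Choosing \<open>i\<close> enlarges the set
  that must be present from \<open>U\<close> to \<open>U \<union> A i\<close>, which costs
  \<open>p ^ card (A i - U)\<close>, and \<open>spread_sum\<close> adds this up over
  \<open>i\<close>. The number \<open>u\<close> bounds the size of that set through all
  \<open>q\<close> steps.\<close>

lemma moment_bound_aux:
  fixes V :: "'x \<Rightarrow> 'b set" and A :: "'i \<Rightarrow> 'b set"
  assumes sp: "spread I A r p K" and p: "0 \<le> p"
    and hit: "\<And>C. finite C \<Longrightarrow> E (\<lambda>x. of_bool (C \<subseteq> V x)) \<le> p ^ card C"
    and U: "finite U" "card U + q * r \<le> u"
  shows "E (\<lambda>x. (\<Sum>i\<in>I. of_bool (A i \<subseteq> V x)) ^ q * of_bool (U \<subseteq> V x)) \<le>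
    p ^ card U * (K * real (u + 1) ^ r) ^ q"
  using U
proof (induction q arbitrary: U)
  case 0
  then show ?case using hit by simp
next
  case (Suc q)
  have I: "\<And>i. i \<in> I \<Longrightarrow> finite (A i)" "\<And>i. i \<in> I \<Longrightarrow> card (A i) \<le> r"
    using sp by (auto simp: spread_def)
  have K: "0 \<le> K" using spread_nonneg[OF sp p] .
  have "E (\<lambda>x. (\<Sum>i\<in>I. of_bool (A i \<subseteq> V x)) ^ Suc q * of_bool (U \<subseteq> V x)) =
      E (\<lambda>x. \<Sum>i\<in>I. (\<Sum>i\<in>I. of_bool (A i \<subseteq> V x)) ^ q * of_bool (U \<union> A i \<subseteq> V x))"
  proof (rule cong)
    fix x
    have "of_bool (A i \<subseteq> V x) * (z * of_bool (U \<subseteq> V x)) = z * of_bool (U \<union> A i \<subseteq> V x)"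
      for z :: real and i
      by (cases "A i \<subseteq> V x"; cases "U \<subseteq> V x") auto
    then show "(\<Sum>i\<in>I. of_bool (A i \<subseteq> V x)) ^ Suc q * of_bool (U \<subseteq> V x) =
        (\<Sum>i\<in>I. (\<Sum>i\<in>I. of_bool (A i \<subseteq> V x)) ^ q * of_bool (U \<union> A i \<subseteq> V x) :: real)"
      by (simp only: power_Suc sum_distrib_right mult.assoc)
  qed
  also have "\<dots> = (\<Sum>i\<in>I. E (\<lambda>x. (\<Sum>i\<in>I. of_bool (A i \<subseteq> V x)) ^ q * of_bool (U \<union> A i \<subseteq> V x)))"
    by (rule sum)
  also have "\<dots> \<le> (\<Sum>i\<in>I. p ^ card (U \<union> A i) * (K * real (u + 1) ^ r) ^ q)"
  proof (rule sum_mono)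
    fix i assume i: "i \<in> I"
    have "card (U \<union> A i) \<le> card U + r"
      using card_Un_le[of U "A i"] I(2)[OF i] by linarith
    then show "E (\<lambda>x. (\<Sum>i\<in>I. of_bool (A i \<subseteq> V x)) ^ q * of_bool (U \<union> A i \<subseteq> V x)) \<le>
        p ^ card (U \<union> A i) * (K * real (u + 1) ^ r) ^ q"
      using Suc.prems I i by (intro Suc.IH) auto
  qed
  also have "\<dots> = p ^ card U * (K * real (u + 1) ^ r) ^ q * (\<Sum>i\<in>I. p ^ card (A i - U))"
  proof -
    have "card (U \<union> A i) = card U + card (A i - U)" if "i \<in> I" for i
      using Suc.prems I that card_Un_disjoint[of U "A i - U"] by auto
    then show ?thesis
      unfolding sum_distrib_left by (intro sum.cong) (simp_all add: power_add mult_ac)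
  qed
  also have "\<dots> \<le> p ^ card U * (K * real (u + 1) ^ r) ^ q * (K * real (u + 1) ^ r)"
  proof (intro mult_left_mono)
    have "(\<Sum>i\<in>I. p ^ card (A i - U)) \<le> K * real (card U + 1) ^ r"
      using Suc.prems by (intro spread_sum[OF sp p])
    also have "\<dots> \<le> K * real (u + 1) ^ r"
      using Suc.prems K by (intro mult_left_mono power_mono) auto
    finally show "(\<Sum>i\<in>I. p ^ card (A i - U)) \<le> K * real (u + 1) ^ r" .
  qed (use K p in auto)
  finally show ?case by (simp add: mult_ac)
qed

lemma moment_bound:
  fixes V :: "'x \<Rightarrow> 'b set" and A :: "'i \<Rightarrow> 'b set"
  assumes "spread I A r p K" "0 \<le> p"
    and "\<And>C. finite C \<Longrightarrow> E (\<lambda>x. of_bool (C \<subseteq> V x)) \<le> p ^ card C"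
  shows "E (\<lambda>x. (\<Sum>i\<in>I. of_bool (A i \<subseteq> V x)) ^ q) \<le> (K * real (q * r + 1) ^ r) ^ q"
  using moment_bound_aux[OF assms, of "{}" q "q * r"] by simp

end

section \<open>Hitting a spread family by independent draws\<close>

lemma iid_miss:
  assumes "finite S" "a \<in> S"
  shows "iid_avg S s (\<lambda>U. of_bool (a \<notin> U)) = (1 - 1 / real (card S)) ^ s"
proof (induction s)
  case (Suc s)
  have c: "0 < card S" using assms by (auto simp: card_gt_0_iff)
  interpret averaging "iid_avg S s" "Pow S"
    using assms by (intro averaging_iid_avg) auto
  have "iid_avg S s (\<lambda>U. of_bool (a \<notin> insert x U)) =
      of_bool (x \<noteq> a) * (1 - 1 / real (card S)) ^ s" for x
    using Suc by (cases "x = a") (simp_all add: const)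
  then have "iid_avg S (Suc s) (\<lambda>U. of_bool (a \<notin> U)) =
      real (card S - 1) * (1 - 1 / real (card S)) ^ s / real (card S)"
    using assms by (simp add: of_bool_def sum.If_cases flip: sum_distrib_right)
      (simp add: Collect_neg_eq Diff_eq[symmetric] card_Diff_singleton_if)
  then show ?case using c by (simp add: of_nat_diff field_simps)
qed simp

text \<open>By induction \<open>(1 - y) ^ s \<le> 1 - s * y / 2\<close> as long as
  \<open>s * y \<le> 1\<close>; here \<open>y = 1 / card S\<close>.\<close>

lemma iid_hit_single_lower:
  assumes "finite S" "a \<in> S" "s \<le> card S"
  shows "real s / (2 * real (card S)) \<le> iid_avg S s (\<lambda>U. of_bool (a \<in> U))"
proof -
  define y where "y = 1 / real (card S)"
  have c: "0 < card S" using assms by (auto simp: card_gt_0_iff)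
  then have y: "0 < y" "y \<le> 1" by (auto simp: y_def)
  have "(1 - y) ^ s \<le> 1 - real s * y / 2" if "real s * y \<le> 1"
    using that
  proof (induction s)
    case (Suc s)
    then have *: "real s * y \<le> 1" using y by (simp add: algebra_simps)
    have "(1 - y) ^ Suc s \<le> (1 - y) * (1 - real s * y / 2)"
      using Suc.IH[OF *] y by (simp add: mult_left_mono)
    also have "\<dots> = 1 - real (Suc s) * y / 2 - y / 2 * (1 - real s * y)"
      by (simp add: field_simps)
    also have "\<dots> \<le> 1 - real (Suc s) * y / 2"
      using * y by simp
    finally show ?case .
  qed simp
  moreover have "real s * y \<le> 1"
    using assms c by (simp add: y_def)
  ultimately have "iid_avg S s (\<lambda>U. of_bool (a \<notin> U)) \<le> 1 - real s * y / 2"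
    using iid_miss[OF assms(1,2), of s] by (simp add: y_def)
  moreover interpret averaging "iid_avg S s" "Pow S"
    using assms by (intro averaging_iid_avg) auto
  have "iid_avg S s (\<lambda>U. of_bool (a \<notin> U)) = 1 - iid_avg S s (\<lambda>U. of_bool (a \<in> U))"
    by (rule prob_not)
  ultimately show ?thesis by (simp add: y_def)
qed

text \<open>Reserve a separate group of \<open>s\<close> draws for each of the \<open>r\<close>
  elements. The groups are independent, so the lower bounds multiply.\<close>

lemma iid_hit_lower:
  assumes "finite S" "s \<le> card S" "A \<subseteq> S" "card A = r"
  shows "(real s / (2 * real (card S))) ^ r \<le> iid_avg S (r * s) (\<lambda>U. of_bool (A \<subseteq> U))"
  using assms(3,4)
proof (induction r arbitrary: A)
  case 0
  then have "A = {}" using assms by (auto dest: finite_subset)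
  then show ?case by simp
next
  case (Suc r)
  then obtain a A' where A: "A = insert a A'" "a \<notin> A'" "card A' = r" "a \<in> S" "A' \<subseteq> S"
    by (metis card_Suc_eq insert_subset)
  have ne: "S \<noteq> {}" using A by auto
  interpret s: averaging "iid_avg S s" "Pow S" using assms ne by (intro averaging_iid_avg)
  interpret r: averaging "iid_avg S (r * s)" "Pow S" using assms ne by (intro averaging_iid_avg)
  let ?x = "real s / (2 * real (card S))"
  let ?P = "iid_avg S (r * s) (\<lambda>V. of_bool (A' \<subseteq> V))"
  have "?x ^ Suc r \<le> iid_avg S s (\<lambda>U. of_bool (a \<in> U)) * ?P"
    unfolding power_Suc using Suc.IH[OF A(5,3)] iid_hit_single_lower[OF assms(1) A(4) assms(2)]
    by (intro mult_mono) (auto intro: s.prob_nonneg)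
  also have "\<dots> = iid_avg S s (\<lambda>U. of_bool (a \<in> U) * ?P)"
    by (rule s.scale_right[symmetric])
  also have "\<dots> = iid_avg S s (\<lambda>U. iid_avg S (r * s) (\<lambda>V. of_bool (a \<in> U) * of_bool (A' \<subseteq> V)))"
    by (simp only: r.scale)
  also have "\<dots> \<le> iid_avg S s (\<lambda>U. iid_avg S (r * s) (\<lambda>V. of_bool (A \<subseteq> U \<union> V)))"
    by (intro s.mono r.mono) (auto simp: A)
  also have "\<dots> = iid_avg S (Suc r * s) (\<lambda>U. of_bool (A \<subseteq> U))"
    using iid_avg_add[OF assms(1) ne, of s "r * s" "\<lambda>U. of_bool (A \<subseteq> U)"] by simp
  finally show ?case .
qed

text \<open>Second moment method for the number of members covered by \<open>r * s\<close> draws: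
  the mean is at least \<open>\<eta>\<close> by \<open>iid_hit_lower\<close>, and
  \<open>moment_bound\<close> with \<open>q = 2\<close> bounds the second moment.\<close>

lemma iid_hits_family:
  assumes S: "finite S" "S \<noteq> {}" "s \<le> card S"
    and sp: "spread I A r (real (r * s) / real (card S)) K" "0 < K"
    and A: "\<And>i. i \<in> I \<Longrightarrow> A i \<subseteq> S \<and> card (A i) = r"
    and \<eta>: "0 \<le> \<eta>" "\<eta> \<le> real (card I) * (real s / (2 * real (card S))) ^ r"
  shows "\<eta>\<^sup>2 / (K * real (2 * r + 1) ^ r)\<^sup>2 \<le> iid_avg S (r * s) (\<lambda>U. of_bool (\<exists>i\<in>I. A i \<subseteq> U))"
proof -
  interpret averaging "iid_avg S (r * s)" "Pow S"
    using S by (intro averaging_iid_avg)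
  let ?X = "\<lambda>U. \<Sum>i\<in>I. of_bool (A i \<subseteq> U) :: real"
  have fin: "finite I" using sp by (simp add: spread_def)
  have "\<eta>\<^sup>2 / (K * real (2 * r + 1) ^ r)\<^sup>2 \<le> iid_avg S (r * s) (\<lambda>U. of_bool (?X U \<noteq> 0))"
  proof (rule second_moment[OF \<eta>(1)])
    have "real (card I) * (real s / (2 * real (card S))) ^ r =
        (\<Sum>i\<in>I. (real s / (2 * real (card S))) ^ r)" by simp
    also have "\<dots> \<le> (\<Sum>i\<in>I. iid_avg S (r * s) (\<lambda>U. of_bool (A i \<subseteq> U)))"
      using S A by (intro sum_mono iid_hit_lower) auto
    also have "\<dots> = iid_avg S (r * s) ?X" by (rule sum[symmetric])
    finally show "\<eta> \<le> iid_avg S (r * s) ?X" using \<eta> by simp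
    show "iid_avg S (r * s) (\<lambda>U. (?X U)\<^sup>2) \<le> (K * real (2 * r + 1) ^ r)\<^sup>2"
      using S by (intro moment_bound[OF sp(1)] iid_hit_prob_bound) auto
    show "0 < (K * real (2 * r + 1) ^ r)\<^sup>2" using sp by simp
  qed
  also have "\<dots> \<le> iid_avg S (r * s) (\<lambda>U. of_bool (\<exists>i\<in>I. A i \<subseteq> U))"
    using fin by (intro prob_mono) (auto simp: sum_nonneg_eq_0_iff)
  finally show ?thesis .
qed

text \<open>Blocks of draws are independent, so a constant hitting probability per block suffices.\<close>

lemma iid_avoid_power:
  assumes S: "finite S" "S \<noteq> {}"
    and anti: "\<And>U V. P (U \<union> V) \<Longrightarrow> P U \<and> P V"
    and \<rho>: "iid_avg S k (\<lambda>U. of_bool (P U)) \<le> \<rho>"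
  shows "iid_avg S t (\<lambda>U. of_bool (P U)) \<le> \<rho> ^ (t div k)"
proof -
  have avg: "averaging (iid_avg S t) (Pow S)" for t
    using S by (rule averaging_iid_avg)
  have \<rho>0: "0 \<le> \<rho>" using averaging.prob_nonneg[OF avg] \<rho> by (rule order_trans)
  have mult: "iid_avg S (s + t) (\<lambda>U. of_bool (P U)) \<le>
      iid_avg S s (\<lambda>U. of_bool (P U)) * iid_avg S t (\<lambda>U. of_bool (P U))" for s t
  proof -
    have "iid_avg S (s + t) (\<lambda>U. of_bool (P U)) =
        iid_avg S s (\<lambda>U. iid_avg S t (\<lambda>V. of_bool (P (U \<union> V))))"
      using S by (rule iid_avg_add)
    also have "\<dots> \<le> iid_avg S s (\<lambda>U. iid_avg S t (\<lambda>V. of_bool (P U) * of_bool (P V)))"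
      by (intro averaging.mono[OF avg]) (auto dest: anti)
    also have "\<dots> = iid_avg S s (\<lambda>U. of_bool (P U)) * iid_avg S t (\<lambda>U. of_bool (P U))"
      by (simp only: averaging.scale[OF avg] averaging.scale_right[OF avg])
    finally show ?thesis .
  qed
  have pow: "iid_avg S (j * k) (\<lambda>U. of_bool (P U)) \<le> \<rho> ^ j" for j
  proof (induction j)
    case 0
    then show ?case by simp
  next
    case (Suc j)
    have "iid_avg S (Suc j * k) (\<lambda>U. of_bool (P U)) \<le>
        iid_avg S k (\<lambda>U. of_bool (P U)) * iid_avg S (j * k) (\<lambda>U. of_bool (P U))"
      using mult[of k "j * k"] by simp
    also have "\<dots> \<le> \<rho> * \<rho> ^ j"
      using Suc \<rho> \<rho>0 by (intro mult_mono averaging.prob_nonneg[OF avg]) auto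
    finally show ?case by simp
  qed
  have "iid_avg S t (\<lambda>U. of_bool (P U)) \<le>
      iid_avg S (t div k * k) (\<lambda>U. of_bool (P U)) * iid_avg S (t mod k) (\<lambda>U. of_bool (P U))"
    using mult[of "t div k * k" "t mod k"] by simp
  also have "\<dots> \<le> \<rho> ^ (t div k) * 1"
    using pow \<rho>0 by (intro mult_mono averaging.prob_nonneg[OF avg] averaging.prob_le_one[OF avg]) auto
  finally show ?thesis by simp
qed

section \<open>The process as a uniformly random order\<close>

definition closes :: "'b set set \<Rightarrow> 'b set \<Rightarrow> 'b \<Rightarrow> bool" where
  "closes \<C> U x \<longleftrightarrow> (\<exists>C\<in>\<C>. x \<in> C \<and> C - {x} \<subseteq> U)"

definition survivors :: "'b set set \<Rightarrow> nat \<Rightarrow> 'b list \<Rightarrow> nat" where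
  "survivors \<C> k xs = card {i. i < k \<and> \<not> closes \<C> (set (take i xs)) (xs ! i)}"

lemma closes_mono: "closes \<C> U x \<Longrightarrow> U \<subseteq> V \<Longrightarrow> closes \<C> V x"
  unfolding closes_def by blast

lemma survivors_snoc:
  "survivors \<C> (Suc (length xs)) (xs @ [x]) =
    survivors \<C> (length xs) xs + (if closes \<C> (set xs) x then 0 else 1)"
proof -
  let ?I = "{i. i < length xs \<and> \<not> closes \<C> (set (take i xs)) (xs ! i)}"
  have "{i. i < Suc (length xs) \<and> \<not> closes \<C> (set (take i (xs @ [x]))) ((xs @ [x]) ! i)} =
      (if closes \<C> (set xs) x then ?I else insert (length xs) ?I)"
    by (auto simp: less_Suc_eq nth_append)
  then show ?thesis
    unfolding survivors_def by auto
qed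

lemma survivors_sum:
  "real (survivors \<C> k xs) = (\<Sum>i<k. of_bool (\<not> closes \<C> (set (take i xs)) (xs ! i)))"
  unfolding survivors_def of_bool_def by (simp add: sum.If_cases lessThan_def Int_def)

lemma survivors_le: "survivors \<C> k xs \<le> k"
  unfolding survivors_def
  using card_mono[of "{..<k}" "{i. i < k \<and> \<not> closes \<C> (set (take i xs)) (xs ! i)}"] by auto

lemma survivors_take: "survivors \<C> k (take k xs) = survivors \<C> k xs"
  unfolding survivors_def by (intro arg_cong[of _ _ card]) (auto simp: min_def)

text \<open>The head of the list is the last element of the random order, which the process
  considers first. This is the direction in which the removal process can be unrolled.\<close>

primrec survivors_rev :: "'b set set \<Rightarrow> 'b list \<Rightarrow> nat" where
  "survivors_rev \<C> [] = 0"
| "survivors_rev \<C> (x # xs) = (if closes \<C> (set xs) x then 0 else 1) + survivors_rev \<C> xs"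

lemma survivors_rev: "survivors \<C> (length xs) xs = survivors_rev \<C> (rev xs)"
proof (induction xs rule: rev_induct)
  case Nil
  then show ?case by (simp add: survivors_def)
next
  case (snoc x xs)
  then show ?case by (simp add: survivors_snoc)
qed

definition removable :: "'b set set \<Rightarrow> 'b set \<Rightarrow> 'b set" where
  "removable \<C> E = {e. \<exists>C\<in>\<C>. C \<subseteq> E \<and> e \<in> C}"

text \<open>An element contained in no member of \<open>\<C>\<close> inside \<open>E\<close> survives and does not influence the
  rest of the process, so the largest element of the random order can be revealed first.\<close>

lemma removal_functional:
  fixes P :: "'b set \<Rightarrow> (nat \<Rightarrow> real) \<Rightarrow> real"
  assumes rec: "\<And>E g. E \<subseteq> E0 \<Longrightarrow> P E g = (if removable \<C> E = {} then g (card E)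
      else (\<Sum>e\<in>removable \<C> E. P (E - {e}) g) / real (card (removable \<C> E)))"
    and E: "finite E0" "E \<subseteq> E0"
  shows "P E g = seq_avg (card E) E (\<lambda>xs. g (survivors_rev \<C> xs))"
proof -
  have sub: "removable \<C> E \<subseteq> E" for E by (auto simp: removable_def)
  \<comment> \<open>The function \<open>g\<close> has to be arbitrary: an element that is never
    removed is accounted for by shifting \<open>g\<close> to
    \<open>\<lambda>m. g (Suc m)\<close>.\<close>
  have kept: "P E g = P (E - {e}) (\<lambda>m. g (Suc m))"
    if "E \<subseteq> E0" "e \<in> E" "e \<notin> removable \<C> E" for E e g
    using that
  proof (induction "card E" arbitrary: E g rule: less_induct)
    case less
    have fin: "finite E" using less.prems E by (auto intro: finite_subset[of E E0])
    have R: "removable \<C> (E - {e}) = removable \<C> E"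
      using less.prems by (auto simp: removable_def)
    have "P (E - {f}) g = P (E - {e} - {f}) (\<lambda>m. g (Suc m))" if f: "f \<in> removable \<C> E" for f
    proof -
      have fE: "f \<in> E" "f \<noteq> e" using sub f less.prems by auto
      have "e \<notin> removable \<C> (E - {f})"
        using less.prems by (auto simp: removable_def)
      then have "P (E - {f}) g = P (E - {f} - {e}) (\<lambda>m. g (Suc m))"
        using less.prems fE card_Diff1_less[OF fin fE(1)] by (intro less.hyps) auto
      moreover have "E - {f} - {e} = E - {e} - {f}" by blast
      ultimately show ?thesis by simp
    qed
    moreover have "Suc (card (E - {e})) = card E"
      using fin less.prems by (simp only: card_Suc_Diff1)
    moreover have "E - {e} \<subseteq> E0"
      using less.prems by auto
    ultimately show ?case
      using rec[of E g] rec[of "E - {e}" "\<lambda>m. g (Suc m)"] less.prems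
      by (simp add: R del: card_Diff_insert)
  qed
  show ?thesis
    using E(2)
  proof (induction "card E" arbitrary: E g)
    case 0
    then have "E = {}" using E by (auto dest: finite_subset)
    then show ?case using rec[of "{}" g] by (auto simp: removable_def)
  next
    case (Suc k)
    let ?R = "removable \<C> E"
    have fin: "finite E" using Suc.prems E by (auto intro: finite_subset[of E E0])
    have ne: "0 < card E" using Suc by simp
    have step: "seq_avg k (E - {x}) (\<lambda>xs. g (survivors_rev \<C> (x # xs))) =
        (if x \<in> ?R then P (E - {x}) g else P E g)" if x: "x \<in> E" for x
    proof -
      have k: "k = card (E - {x})" using Suc.hyps(2) fin x by simp
      interpret averaging "seq_avg k (E - {x})" "inj_seqs k (E - {x})"
        using fin k by (intro averaging_seq_avg) auto
      \<comment> \<open>The other entries exhaust \<open>E - {x}\<close>, so completing a member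
        with earlier elements is the same as being removable now.\<close>
      have cl: "closes \<C> (set xs) x \<longleftrightarrow> x \<in> ?R" if "xs \<in> inj_seqs k (E - {x})" for xs
      proof -
        have "set xs = E - {x}"
          using that fin k by (intro card_subset_eq) (auto simp: inj_seqs_def distinct_card)
        then show ?thesis using x by (auto simp: closes_def removable_def)
      qed
      have "seq_avg k (E - {x}) (\<lambda>xs. g (survivors_rev \<C> (x # xs))) =
          seq_avg k (E - {x}) (\<lambda>xs. g ((if x \<in> ?R then 0 else 1) + survivors_rev \<C> xs))"
        by (rule cong) (simp add: cl)
      also have "\<dots> = P (E - {x}) (\<lambda>m. g ((if x \<in> ?R then 0 else 1) + m))"
        using Suc.hyps(1)[OF k, of "\<lambda>m. g ((if x \<in> ?R then 0 else 1) + m)"] Suc.prems k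
        by (simp add: subset_insertI2 Diff_subset_conv)
      also have "\<dots> = (if x \<in> ?R then P (E - {x}) g else P E g)"
        using kept[of E x g] Suc.prems x by simp
      finally show ?thesis .
    qed
    \<comment> \<open>Lazy version of one removal step: by the recursion the removable elements
      contribute \<open>P E g\<close> on average, and each of the others contributes exactly
      \<open>P E g\<close>.\<close>
    have "(\<Sum>x\<in>E. if x \<in> ?R then P (E - {x}) g else P E g) = real (card E) * P E g"
    proof -
      have "(\<Sum>x\<in>E. if x \<in> ?R then P (E - {x}) g else P E g) =
          (\<Sum>x\<in>?R. P (E - {x}) g) + real (card (E - ?R)) * P E g"
        using fin sub[of E] by (simp add: sum.If_cases Int_absorb1 Diff_eq)
      moreover have "(\<Sum>x\<in>?R. P (E - {x}) g) = real (card ?R) * P E g"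
        using rec[of E g] Suc.prems finite_subset[OF sub[of E] fin] by (cases "?R = {}") auto
      moreover have "card E = card ?R + card (E - ?R)"
        using fin sub[of E] by (simp add: card_Diff_subset finite_subset card_mono)
      ultimately show ?thesis by (simp add: algebra_simps)
    qed
    then show ?case
      using step ne by (simp flip: Suc.hyps(2))
  qed
qed

section \<open>Copies in the complete graph as a family of edge sets\<close>

definition embeddings :: "'a ugraph \<Rightarrow> nat \<Rightarrow> ('a \<Rightarrow> nat) set" where
  "embeddings F n = {\<phi> \<in> verts F \<rightarrow>\<^sub>E {..<n}. inj_on \<phi> (verts F)}"

definition image_edges :: "'a ugraph \<Rightarrow> ('a \<Rightarrow> nat) \<Rightarrow> nat set set" where
  "image_edges F \<phi> = (`) \<phi> ` edges F"

text \<open>Vertex sets are dropped: the process only depends on which edges lie in a copy, so it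
  becomes a removal process on a plain family of sets.\<close>

definition copies :: "'a ugraph set \<Rightarrow> nat \<Rightarrow> nat set set set" where
  "copies \<H> n = {image_edges F \<phi> |F \<phi>. F \<in> \<H> \<and> \<phi> \<in> embeddings F n}"

abbreviation complete_edges :: "nat \<Rightarrow> nat set set" where
  "complete_edges n \<equiv> edges (complete_graph n)"

lemma complete_edges: "complete_edges n = {e. e \<subseteq> {..<n} \<and> card e = 2}"
  by (simp add: complete_graph_def)

lemma finite_complete_edges: "finite (complete_edges n)"
  unfolding complete_edges by (rule finite_subset[of _ "Pow {..<n}"]) auto

lemma card_complete_edges: "card (complete_edges n) = n choose 2"
  unfolding complete_edges using n_subsets[of "{..<n}" 2] by simp

lemma image_edges_subset:
  assumes "simple_graph F" "\<phi> \<in> embeddings F n"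
  shows "image_edges F \<phi> \<subseteq> complete_edges n"
proof
  fix e assume "e \<in> image_edges F \<phi>"
  then obtain f where f: "f \<in> edges F" "e = \<phi> ` f" by (auto simp: image_edges_def)
  then have "f \<subseteq> verts F" "card f = 2" using assms by (auto simp: simple_graph_def)
  then show "e \<in> complete_edges n"
    using f assms inj_on_subset[of \<phi> "verts F" f]
    by (auto simp: complete_edges embeddings_def card_image PiE_iff)
qed

text \<open>An isomorphism onto a copy, restricted to \<open>verts F\<close>, is an embedding;
  conversely an embedding carries \<open>F\<close> isomorphically onto its image.\<close>

lemma removable_edges_eq:
  assumes "\<And>F. F \<in> \<H> \<Longrightarrow> simple_graph F" "E \<subseteq> complete_edges n"
  shows "removable_edges \<H> (UGraph {..<n} E) = removable (copies \<H> n) E"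
proof (intro equalityI subsetI)
  fix e assume "e \<in> removable_edges \<H> (UGraph {..<n} E)"
  then obtain F C f where F: "F \<in> \<H>" and C: "subgraph C (UGraph {..<n} E)" "e \<in> edges C"
    and f: "bij_betw f (verts F) (verts C)" "edges C = (`) f ` edges F"
    unfolding removable_edges_def is_copy_def isomorphic_def by blast
  define \<phi> where "\<phi> = restrict f (verts F)"
  have "\<phi> \<in> embeddings F n"
    using f C unfolding \<phi>_def embeddings_def subgraph_def bij_betw_def
    by (auto simp: inj_on_def)
  moreover have "\<phi> ` d = f ` d" if "d \<in> edges F" for d
  proof -
    have "d \<subseteq> verts F" using assms(1)[OF F] that by (auto simp: simple_graph_def)
    then show ?thesis by (auto simp: \<phi>_def image_def)
  qed
  then have "image_edges F \<phi> = edges C"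
    by (auto simp: image_edges_def f)
  moreover have "edges C \<subseteq> E" using C by (simp add: subgraph_def)
  ultimately show "e \<in> removable (copies \<H> n) E"
    using F C unfolding removable_def copies_def by blast
next
  fix e assume "e \<in> removable (copies \<H> n) E"
  then obtain F \<phi> where F: "F \<in> \<H>" "\<phi> \<in> embeddings F n" "image_edges F \<phi> \<subseteq> E"
      "e \<in> image_edges F \<phi>"
    unfolding removable_def copies_def by blast
  define C where "C = UGraph (\<phi> ` verts F) (image_edges F \<phi>)"
  have vF: "finite (verts F)" "\<And>d. d \<in> edges F \<Longrightarrow> d \<subseteq> verts F"
    using assms(1)[OF F(1)] by (auto simp: simple_graph_def)
  have "simple_graph C"
    using F vF image_edges_subset[OF assms(1)[OF F(1)] F(2)]
    by (auto simp: simple_graph_def C_def complete_edges image_edges_def)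
  moreover have "simple_graph (UGraph {..<n} E)"
    using assms(2) by (auto simp: simple_graph_def complete_edges)
  moreover have "\<phi> ` verts F \<subseteq> {..<n}"
    using F(2) by (auto simp: embeddings_def)
  ultimately have "subgraph C (UGraph {..<n} E)"
    using F by (simp add: subgraph_def C_def)
  moreover have "isomorphic F C"
    unfolding isomorphic_def using F(2)
    by (intro exI[of _ \<phi>]) (auto simp: C_def embeddings_def bij_betw_def image_edges_def)
  moreover have "e \<in> edges C" using F by (simp add: C_def)
  ultimately show "e \<in> removable_edges \<H> (UGraph {..<n} E)"
    using F(1) unfolding removable_edges_def is_copy_def by blast
qed

lemma finite_set_pmf_process: "finite (set_pmf (reverse_free_process \<H> G))"
proof (induction \<H> G rule: reverse_free_process.induct)
  case (1 \<H> G)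
  show ?case
  proof (cases "finite (edges G) \<and> removable_edges \<H> G \<noteq> {}")
    case True
    then have "finite (removable_edges \<H> G)"
      using finite_subset[OF removable_edges_subset] by blast
    then show ?thesis
      using 1 True by (subst reverse_free_process.simps) auto
  qed (subst reverse_free_process.simps, auto)
qed

text \<open>The process satisfies the recursion required by \<open>removal_functional\<close>, and
  \<open>seq_avg_rev\<close> turns the resulting order around. Since \<open>g\<close> is arbitrary
  this transfers the mean as well as all probabilities, and the pmf can be left behind.\<close>

theorem final_edges_expectation:
  fixes g :: "nat \<Rightarrow> real"
  assumes simple: "\<And>F. F \<in> \<H> \<Longrightarrow> simple_graph F"
  shows "measure_pmf.expectation (final_edges \<H> n) g =
    seq_avg (card (complete_edges n)) (complete_edges n)
      (\<lambda>xs. g (survivors (copies \<H> n) (card (complete_edges n)) xs))"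
proof -
  define P where "P E g = measure_pmf.expectation (reverse_free_process \<H> (UGraph {..<n} E))
    (\<lambda>G. g (num_edges G) :: real)" for E g
  let ?K = "complete_edges n" and ?C = "copies \<H> n"
  have rec: "P E g = (if removable ?C E = {} then g (card E)
      else (\<Sum>e\<in>removable ?C E. P (E - {e}) g) / real (card (removable ?C E)))"
    if E: "E \<subseteq> ?K" for E g
  proof -
    have R: "removable_edges \<H> (UGraph {..<n} E) = removable ?C E"
      using simple E by (rule removable_edges_eq)
    have fin: "finite E" using E finite_complete_edges by (rule finite_subset)
    then have finR: "finite (removable ?C E)"
      by (rule finite_subset[rotated]) (auto simp: removable_def)
    show ?thesis
    proof (cases "removable ?C E = {}")
      case True
      then show ?thesis
        unfolding P_def by (subst reverse_free_process.simps) (simp add: R num_edges_def)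
    next
      case False
      then show ?thesis
        unfolding P_def using fin finR
        by (subst reverse_free_process.simps)
          (simp add: R pmf_expectation_bind_pmf_of_set finite_set_pmf_process delete_edge_def
            divide_inverse_commute sum_distrib_left)
    qed
  qed
  have "measure_pmf.expectation (final_edges \<H> n) g = P ?K g"
    by (simp add: P_def final_edges_def complete_graph_def)
  also have "\<dots> = seq_avg (card ?K) ?K (\<lambda>xs. g (survivors_rev ?C xs))"
    using rec finite_complete_edges subset_refl by (rule removal_functional)
  also have "\<dots> = seq_avg (card ?K) ?K (\<lambda>xs. g (survivors_rev ?C (rev xs)))"
    using finite_complete_edges by (rule seq_avg_rev[symmetric])
  also have "\<dots> = seq_avg (card ?K) ?K (\<lambda>xs. g (survivors ?C (card ?K) xs))"
  proof -
    interpret averaging "seq_avg (card ?K) ?K" "inj_seqs (card ?K) ?K"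
      using finite_complete_edges by (intro averaging_seq_avg) auto
    show ?thesis
      by (rule cong) (auto simp: inj_seqs_def simp flip: survivors_rev)
  qed
  finally show ?thesis .
qed

text \<open>Suppose a position carries the same edge \<open>e\<close> in both orders, and
  \<open>e\<close> survives in \<open>xs\<close> but not in \<open>ys\<close>. The copy that
  \<open>e\<close> completes in \<open>ys\<close> contains an edge that comes earlier in
  \<open>ys\<close> but not in \<open>xs\<close>, hence sits at a position where the orders differ.
  Each differing position accounts for at most \<open>D\<close> such \<open>e\<close>, plus one for
  itself.\<close>

lemma survivors_lipschitz:
  assumes xs: "distinct xs" "length xs = k" and ys: "distinct ys" "length ys = k"
    and codegree: "\<And>g. g \<in> set ys \<Longrightarrow> card {e. \<exists>C\<in>\<C>. g \<in> C \<and> e \<in> C \<and> C \<subseteq> set ys} \<le> D"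
  shows "survivors \<C> k xs \<le> survivors \<C> k ys + (D + 1) * hamming k xs ys"
proof -
  define \<Delta> where "\<Delta> = {i. i < k \<and> xs ! i \<noteq> ys ! i}"
  define I where "I zs = {i. i < k \<and> \<not> closes \<C> (set (take i zs)) (zs ! i)}" for zs
  define N where "N g = {e. \<exists>C\<in>\<C>. g \<in> C \<and> e \<in> C \<and> C \<subseteq> set ys}" for g
  define Z where "Z = I xs - I ys - \<Delta>"
  have fin: "finite \<Delta>" "finite (I zs)" "finite Z" for zs
    by (auto simp: \<Delta>_def I_def Z_def)
  have finN: "finite (N g)" for g
    by (rule finite_subset[of _ "set ys"]) (auto simp: N_def)
  have "(!) ys ` Z \<subseteq> (\<Union>j\<in>\<Delta>. N (ys ! j))"
  proof
    fix e assume "e \<in> (!) ys ` Z"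
    then obtain i where "i \<in> Z" "e = ys ! i" by auto
    then have i: "i < k" "e = ys ! i" "xs ! i = ys ! i"
        "\<not> closes \<C> (set (take i xs)) e" "closes \<C> (set (take i ys)) e"
      by (auto simp: Z_def I_def \<Delta>_def)
    from i(5) obtain C where C: "C \<in> \<C>" "e \<in> C" "C - {e} \<subseteq> set (take i ys)"
      unfolding closes_def by blast
    then have "\<not> C - {e} \<subseteq> set (take i xs)"
      using i(4) unfolding closes_def by blast
    then obtain g where g: "g \<in> C" "g \<in> set (take i ys)" "g \<notin> set (take i xs)"
      using C by blast
    then obtain j where j: "j < i" "g = ys ! j"
      using i(1) ys(2) unfolding in_set_conv_nth[of g] by auto
    have "xs ! j \<noteq> ys ! j"
    proof
      assume "xs ! j = ys ! j"
      then have "g = take i xs ! j" using j by simp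
      moreover have "take i xs ! j \<in> set (take i xs)"
        using j i(1) xs by (intro nth_mem) simp
      ultimately show False using g by simp
    qed
    moreover have "C \<subseteq> set ys"
    proof
      fix h assume "h \<in> C"
      then show "h \<in> set ys"
        using C(3) i(1,2) ys(2) set_take_subset[of i ys] by (cases "h = e") auto
    qed
    ultimately have "j \<in> \<Delta>" "e \<in> N (ys ! j)"
      using C(1,2) g(1) j i(1) unfolding \<Delta>_def N_def by auto
    then show "e \<in> (\<Union>j\<in>\<Delta>. N (ys ! j))" by blast
  qed
  then have "card ((!) ys ` Z) \<le> card (\<Union>j\<in>\<Delta>. N (ys ! j))"
    using fin finN by (intro card_mono finite_UN_I) auto
  moreover have "card ((!) ys ` Z) = card Z"
    using ys by (intro card_image) (auto simp: inj_on_def Z_def I_def nth_eq_iff_index_eq)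
  ultimately have "card Z \<le> card (\<Union>j\<in>\<Delta>. N (ys ! j))"
    by simp
  also have "\<dots> \<le> (\<Sum>j\<in>\<Delta>. card (N (ys ! j)))"
    by (rule card_UN_le[OF fin(1)])
  also have "\<dots> \<le> (\<Sum>j\<in>\<Delta>. D)"
    using codegree ys by (intro sum_mono) (auto simp: N_def \<Delta>_def)
  finally have Z: "card Z \<le> D * card \<Delta>" by (simp add: mult.commute)
  have "card (I xs) \<le> card (I ys \<union> \<Delta> \<union> Z)"
    using fin by (intro card_mono) (auto simp: Z_def)
  also have "\<dots> \<le> card (I ys) + card \<Delta> + card Z"
    using card_Un_le[of "I ys \<union> \<Delta>" Z] card_Un_le[of "I ys" \<Delta>] by linarith
  finally show ?thesis
    using Z by (simp add: survivors_def hamming_def I_def \<Delta>_def)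
qed

section \<open>Counting copies of 2-balanced graphs\<close>

lemma two_balanced_simple: "two_balanced F \<Longrightarrow> simple_graph F"
  by (simp add: two_balanced_def)

lemma simple_graph_edge:
  assumes "simple_graph F" "e \<in> edges F"
  shows "e \<subseteq> verts F" "card e = 2" "finite e"
proof -
  show "e \<subseteq> verts F" "card e = 2" using assms by (auto simp: simple_graph_def)
  then show "finite e" by (metis card.infinite zero_neq_numeral)
qed

lemma simple_graph_finite:
  assumes "simple_graph F"
  shows "finite (verts F)" "finite (edges F)"
proof -
  show *: "finite (verts F)" using assms by (simp add: simple_graph_def)
  show "finite (edges F)"
    using assms * by (intro finite_subset[of "edges F" "Pow (verts F)"]) (auto simp: simple_graph_def)
qed

lemma two_balanced_verts:
  assumes "two_balanced F"
  shows "3 \<le> num_verts F"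
proof (rule ccontr)
  assume "\<not> 3 \<le> num_verts F"
  then have "card (verts F) choose 2 \<le> 2 choose 2"
    by (intro binomial_right_mono) (simp add: num_verts_def)
  moreover have "card (edges F) \<le> card (verts F) choose 2"
    using assms two_balanced_simple[OF assms]
    by (subst n_subsets[symmetric]) (auto simp: simple_graph_def intro!: card_mono)
  ultimately show False
    using assms by (simp add: two_balanced_def num_edges_def)
qed

lemma num_edges_conv_d2:
  assumes "two_balanced F"
  shows "real (num_edges F) - 1 = d2 F * (real (num_verts F) - 2)"
  using two_balanced_verts[OF assms] by (simp add: d2_def)

text \<open>Balancedness applied to the graph spanned by \<open>B\<close>. If \<open>B\<close> spans
  only two vertices the definition is silent, but then \<open>B\<close> is a single edge and both
  sides vanish.\<close>

lemma two_balanced_density: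
  assumes F: "two_balanced F" and B: "B \<subseteq> edges F" "B \<noteq> {}"
  shows "2 \<le> card (\<Union>B)" "card (\<Union>B) \<le> num_verts F"
    and "real (card B) - 1 \<le> d2 F * (real (card (\<Union>B)) - 2)"
proof -
  note simple = two_balanced_simple[OF F]
  note edge = simple_graph_edge[OF simple]
  have sub: "\<Union>B \<subseteq> verts F" using B edge by blast
  have fin: "finite (\<Union>B)" using sub simple_graph_finite(1)[OF simple] by (rule finite_subset)
  obtain e where e: "e \<in> B" using B by auto
  show two: "2 \<le> card (\<Union>B)"
    using edge(2)[of e] e B card_mono[OF fin Union_upper[OF e]] by auto
  show "card (\<Union>B) \<le> num_verts F"
    unfolding num_verts_def using sub simple_graph_finite[OF simple] by (intro card_mono)
  show "real (card B) - 1 \<le> d2 F * (real (card (\<Union>B)) - 2)"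
  proof (cases "card (\<Union>B) = 2")
    case True
    have "B \<subseteq> {\<Union>B}"
    proof
      fix f assume f: "f \<in> B"
      then have "f = \<Union>B"
        using True edge(2)[of f] B fin by (intro card_subset_eq) auto
      then show "f \<in> {\<Union>B}" by simp
    qed
    then have "card B \<le> 1" using card_mono[of "{\<Union>B}" B] by simp
    then show ?thesis using True by simp
  next
    case False
    define G where "G = UGraph (\<Union>B) B"
    have "subgraph G F"
      using fin sub B simple edge by (auto simp: subgraph_def G_def simple_graph_def)
    moreover have "3 \<le> num_verts G" using False two by (simp add: G_def num_verts_def)
    ultimately have "d2 G \<le> d2 F"
      using F by (cases "G = F") (auto simp: two_balanced_def)
    moreover have "0 < real (card (\<Union>B)) - 2" using False two by simp
    moreover have "d2 G = (real (card B) - 1) / (real (card (\<Union>B)) - 2)"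
      by (simp add: d2_def G_def num_verts_def num_edges_def)
    ultimately show ?thesis
      by (simp only: pos_divide_le_eq)
  qed
qed

text \<open>Two edges span at most four vertices, so \<open>two_balanced_density\<close> gives
  \<open>1 \<le> d2 F * X\<close> with \<open>X \<le> 2\<close>. Two disjoint edges attain the
  bound. It makes the exponent \<open>2 - 1 / d2 F\<close> nonnegative.\<close>

lemma d2_ge_half:
  assumes F: "two_balanced F"
  shows "1 / 2 \<le> d2 F"
proof -
  have "2 \<le> card (edges F)" using F by (simp add: two_balanced_def num_edges_def)
  then obtain B where B: "B \<subseteq> edges F" "card B = 2"
    by (metis obtain_subset_with_card_n)
  then obtain e f where ef: "B = {e, f}" by (auto simp: card_2_iff)
  have "card (\<Union>B) \<le> card e + card f"
    using card_Un_le[of e f] by (simp add: ef)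
  also have "\<dots> = 4"
    using B ef simple_graph_edge(2)[OF two_balanced_simple[OF F]] by simp
  finally have "real (card (\<Union>B)) - 2 \<le> 2" by simp
  moreover have "B \<noteq> {}" using ef by simp
  moreover define X where "X = real (card (\<Union>B)) - 2"
  ultimately have X: "1 \<le> d2 F * X" "0 \<le> X" "X \<le> 2"
    using two_balanced_density[OF F B(1)] B(2) by auto
  show ?thesis
  proof (rule ccontr)
    assume less: "\<not> 1 / 2 \<le> d2 F"
    then have "d2 F * X \<le> 1 / 2 * X"
      using X by (intro mult_right_mono) auto
    then have "X = 2" using X by linarith
    then show False using X(1) less by simp
  qed
qed

lemma finite_embeddings: "finite (verts F) \<Longrightarrow> finite (embeddings F n)"
  unfolding embeddings_def by (rule finite_subset[of _ "verts F \<rightarrow>\<^sub>E {..<n}"]) (auto intro: finite_PiE)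

lemma inj_on_image_edges:
  assumes "simple_graph F" "\<phi> \<in> embeddings F n"
  shows "inj_on ((`) \<phi>) (edges F)"
proof -
  have "inj_on ((`) \<phi>) (Pow (verts F))"
    using assms by (intro inj_on_image_Pow) (simp add: embeddings_def)
  then show ?thesis
    by (rule inj_on_subset) (use assms in \<open>auto simp: simple_graph_def\<close>)
qed

lemma card_image_edges:
  assumes "simple_graph F" "\<phi> \<in> embeddings F n"
  shows "card (image_edges F \<phi>) = num_edges F"
  unfolding image_edges_def num_edges_def
  using inj_on_image_edges[OF assms] by (rule card_image)

text \<open>The vertices covered by \<open>B\<close> must go into those covered by
  \<open>B'\<close>, which leaves boundedly many choices; only the remaining vertices are free to
  range over all \<open>n\<close>.\<close>

lemma card_embeddings_fixing:
  assumes F: "simple_graph F" and B: "B \<subseteq> edges F"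
  shows "card {\<phi> \<in> embeddings F n. (`) \<phi> ` B = B'} \<le>
    num_verts F ^ num_verts F * n ^ (num_verts F - card (\<Union>B))"
proof (cases "{\<phi> \<in> embeddings F n. (`) \<phi> ` B = B'} = {}")
  case False
  then obtain \<phi> where \<phi>: "\<phi> \<in> embeddings F n" "(`) \<phi> ` B = B'" by auto
  have sub: "\<Union>B \<subseteq> verts F" using B simple_graph_edge(1)[OF F] by blast
  note finV = simple_graph_finite(1)[OF F]
  have fin: "finite (\<Union>B)" using sub finV by (rule finite_subset)
  have B': "\<Union>B' = \<phi> ` \<Union>B" using \<phi>(2) by auto
  have "inj_on \<phi> (\<Union>B)"
    using \<phi>(1) sub by (auto simp: embeddings_def intro: inj_on_subset)
  then have k: "card (\<Union>B') = card (\<Union>B)" unfolding B' by (rule card_image)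
  define W where "W = \<Union>B"
  define W' where "W' = \<Union>B'"
  let ?Q = "PiE (verts F) (\<lambda>x. if x \<in> W then W' else {..<n})"
  have "{\<phi> \<in> embeddings F n. (`) \<phi> ` B = B'} \<subseteq> ?Q"
  proof
    fix \<psi> assume "\<psi> \<in> {\<phi> \<in> embeddings F n. (`) \<phi> ` B = B'}"
    then have \<psi>: "\<psi> \<in> verts F \<rightarrow>\<^sub>E {..<n}" "\<And>f. f \<in> B \<Longrightarrow> \<psi> ` f \<in> B'"
      by (auto simp: embeddings_def)
    show "\<psi> \<in> ?Q"
    proof (rule PiE_I)
      show "\<psi> x \<in> (if x \<in> W then W' else {..<n})" if "x \<in> verts F" for x
      proof (cases "x \<in> W")
        case True
        then obtain f where "f \<in> B" "x \<in> f" by (auto simp: W_def)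
        then have "\<psi> x \<in> W'" using \<psi>(2)[of f] by (auto simp: W'_def)
        then show ?thesis using True by simp
      next
        case False
        then show ?thesis using PiE_mem[OF \<psi>(1) that] by simp
      qed
      show "\<psi> x = undefined" if "x \<notin> verts F" for x
        using PiE_arb[OF \<psi>(1) that] .
    qed
  qed
  moreover have "finite ?Q"
    using finV fin unfolding W'_def B' by (intro finite_PiE) auto
  ultimately have "card {\<phi> \<in> embeddings F n. (`) \<phi> ` B = B'} \<le> card ?Q"
    by (intro card_mono)
  also have "\<dots> = (\<Prod>x\<in>verts F. if x \<in> W then card W else n)"
    unfolding card_PiE[OF finV] by (rule prod.cong) (simp_all add: W_def W'_def k)
  also have "\<dots> = (\<Prod>x\<in>verts F - W. if x \<in> W then card W else n) *
      (\<Prod>x\<in>W. if x \<in> W then card W else n)"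
    using finV sub unfolding W_def by (intro prod.subset_diff)
  also have "(\<Prod>x\<in>verts F - W. if x \<in> W then card W else n) = (\<Prod>x\<in>verts F - W. n)"
    by (rule prod.cong) auto
  also have "\<dots> = n ^ (num_verts F - card W)"
    using sub fin unfolding W_def by (simp add: card_Diff_subset num_verts_def)
  also have "(\<Prod>x\<in>W. if x \<in> W then card W else n) = (\<Prod>x\<in>W. card W)"
    by (rule prod.cong) auto
  also have "\<dots> = card W ^ card W"
    by simp
  also have "n ^ (num_verts F - card W) * card W ^ card W =
      card (\<Union>B) ^ card (\<Union>B) * n ^ (num_verts F - card (\<Union>B))"
    by (simp add: W_def)
  also have "\<dots> \<le> num_verts F ^ num_verts F * n ^ (num_verts F - card (\<Union>B))"
  proof (intro mult_right_mono)
    have le: "card (\<Union>B) \<le> num_verts F"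
      unfolding num_verts_def using sub finV by (intro card_mono)
    show "card (\<Union>B) ^ card (\<Union>B) \<le> num_verts F ^ num_verts F"
    proof (cases "num_verts F = 0")
      case False
      have "card (\<Union>B) ^ card (\<Union>B) \<le> num_verts F ^ card (\<Union>B)"
        using le by (intro power_mono) auto
      also have "\<dots> \<le> num_verts F ^ num_verts F"
        using le False by (intro power_increasing) auto
      finally show ?thesis .
    qed (use le in simp)
  qed simp
  finally show ?thesis .
next
  case True
  show ?thesis unfolding True by simp
qed

text \<open>The factor \<open>2 ^ num_edges F\<close> counts the edge sets of \<open>F\<close> that
  may be mapped onto a prescribed set, the next factor counts the placements of their vertices, and
  \<open>T\<close> bounds \<open>n * p powr d2 F\<close> per free vertex, of which there are at most
  \<open>num_verts F - 2\<close>.\<close>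

definition spread_const :: "'a ugraph \<Rightarrow> real \<Rightarrow> real" where
  "spread_const F T = 2 ^ num_edges F * real (num_verts F) ^ num_verts F * T ^ (num_verts F - 2)"

text \<open>The 2-balancedness is exactly what makes every partial copy at least as expected as the
  whole copy.\<close>

lemma embeddings_spread:
  assumes F: "two_balanced F" and B': "B' \<noteq> {}"
    and p: "0 < p" "p \<le> 1" and T: "real n * p powr d2 F \<le> T" "1 \<le> T"
  shows "(\<Sum>\<phi> | \<phi> \<in> embeddings F n \<and> B' \<subseteq> image_edges F \<phi>. p ^ (num_edges F - card B')) \<le>
    spread_const F T"
proof -
  note simple = two_balanced_simple[OF F]
  let ?v = "num_verts F" and ?e = "num_edges F" and ?j = "card B'"
  define \<BB> where "\<BB> = {B. B \<subseteq> edges F \<and> B \<noteq> {} \<and> card B = ?j}"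
  have fin\<BB>: "finite \<BB>" "card \<BB> \<le> 2 ^ ?e"
  proof -
    have fe: "finite (edges F)" using simple_graph_finite[OF simple] by simp
    show "finite \<BB>" unfolding \<BB>_def by (rule finite_subset[of _ "Pow (edges F)"]) (use fe in auto)
    have "card \<BB> \<le> card (Pow (edges F))"
      unfolding \<BB>_def using fe by (intro card_mono) auto
    then show "card \<BB> \<le> 2 ^ ?e" using fe by (simp add: card_Pow num_edges_def)
  qed
  have "{\<phi> \<in> embeddings F n. B' \<subseteq> image_edges F \<phi>} \<subseteq>
      (\<Union>B\<in>\<BB>. {\<phi> \<in> embeddings F n. (`) \<phi> ` B = B'})"
  proof
    fix \<phi> assume \<phi>: "\<phi> \<in> {\<phi> \<in> embeddings F n. B' \<subseteq> image_edges F \<phi>}"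
    define B where "B = {f \<in> edges F. \<phi> ` f \<in> B'}"
    have BE: "B \<subseteq> edges F" by (auto simp: B_def)
    have im: "(`) \<phi> ` B = B'"
    proof (intro equalityI subsetI)
      fix b assume "b \<in> B'"
      then obtain f where "f \<in> edges F" "b = \<phi> ` f" using \<phi> by (auto simp: image_edges_def)
      then show "b \<in> (`) \<phi> ` B" using \<open>b \<in> B'\<close> by (auto simp: B_def)
    qed (auto simp: B_def)
    have "inj_on ((`) \<phi>) B"
      using inj_on_image_edges[OF simple, of \<phi> n] \<phi>
      by (intro inj_on_subset[OF _ BE]) auto
    then have "card B = ?j" using card_image[of "(`) \<phi>" B] im by simp
    moreover have "B \<noteq> {}" using im B' by blast
    ultimately have "B \<in> \<BB>" using BE by (simp add: \<BB>_def)
    with im \<phi> show "\<phi> \<in> (\<Union>B\<in>\<BB>. {\<phi> \<in> embeddings F n. (`) \<phi> ` B = B'})" by blast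
  qed
  moreover have "finite (\<Union>B\<in>\<BB>. {\<phi> \<in> embeddings F n. (`) \<phi> ` B = B'})"
    using fin\<BB> finite_embeddings[OF simple_graph_finite(1)[OF simple]] by auto
  ultimately have "card {\<phi> \<in> embeddings F n. B' \<subseteq> image_edges F \<phi>} \<le>
      card (\<Union>B\<in>\<BB>. {\<phi> \<in> embeddings F n. (`) \<phi> ` B = B'})"
    by (intro card_mono)
  also have "\<dots> \<le> (\<Sum>B\<in>\<BB>. card {\<phi> \<in> embeddings F n. (`) \<phi> ` B = B'})"
    using fin\<BB> by (intro card_UN_le)
  also have "\<dots> \<le> (\<Sum>B\<in>\<BB>. ?v ^ ?v * n ^ (?v - card (\<Union>B)))"
    by (intro sum_mono card_embeddings_fixing[OF simple]) (auto simp: \<BB>_def)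
  finally have count: "card {\<phi> \<in> embeddings F n. B' \<subseteq> image_edges F \<phi>} \<le>
      (\<Sum>B\<in>\<BB>. ?v ^ ?v * n ^ (?v - card (\<Union>B)))" .
  have bound: "real n ^ (?v - card (\<Union>B)) * p ^ (?e - ?j) \<le> T ^ (?v - 2)" if "B \<in> \<BB>" for B
  proof -
    have B: "B \<subseteq> edges F" "B \<noteq> {}" "card B = ?j" using that by (auto simp: \<BB>_def)
    let ?k = "card (\<Union>B)"
    note dens = two_balanced_density[OF F B(1,2)]
    have je: "?j \<le> ?e"
      unfolding num_edges_def B(3)[symmetric]
      using B(1) simple_graph_finite(2)[OF simple] by (rule card_mono[rotated])
    have "p ^ (?e - ?j) = p powr (real (?e - ?j))"
      using p by (simp add: powr_realpow)
    also have "\<dots> \<le> p powr (d2 F * real (?v - ?k))"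
    proof (rule powr_mono')
      \<comment> \<open>The balance inequality for \<open>B\<close> is subtracted from the equality
        for \<open>F\<close>: every free vertex brings at least \<open>d2 F\<close> further edges on
        average.\<close>
      have "real ?e - 1 - (real ?j - 1) \<ge> d2 F * (real ?v - 2) - d2 F * (real ?k - 2)"
        using dens(3) num_edges_conv_d2[OF F] B(3) by linarith
      then show "d2 F * real (?v - ?k) \<le> real (?e - ?j)"
        using dens je by (simp add: of_nat_diff algebra_simps)
    qed (use p in auto)
    also have "\<dots> = (p powr d2 F) ^ (?v - ?k)"
      using p powr_realpow[of "p powr d2 F" "?v - ?k"] by (simp add: powr_powr)
    finally have "real n ^ (?v - ?k) * p ^ (?e - ?j) \<le> real n ^ (?v - ?k) * (p powr d2 F) ^ (?v - ?k)"
      by (intro mult_left_mono) auto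
    also have "\<dots> = (real n * p powr d2 F) ^ (?v - ?k)"
      by (simp add: power_mult_distrib)
    also have "\<dots> \<le> T ^ (?v - ?k)"
      using T by (intro power_mono) auto
    also have "\<dots> \<le> T ^ (?v - 2)"
      using T dens by (intro power_increasing) auto
    finally show ?thesis .
  qed
  have "(\<Sum>\<phi> | \<phi> \<in> embeddings F n \<and> B' \<subseteq> image_edges F \<phi>. p ^ (?e - ?j)) =
      real (card {\<phi> \<in> embeddings F n. B' \<subseteq> image_edges F \<phi>}) * p ^ (?e - ?j)"
    by simp
  also have "\<dots> \<le> real (\<Sum>B\<in>\<BB>. ?v ^ ?v * n ^ (?v - card (\<Union>B))) * p ^ (?e - ?j)"
    using of_nat_mono[OF count, where 'a = real] p by (intro mult_right_mono) auto
  also have "\<dots> = (\<Sum>B\<in>\<BB>. real ?v ^ ?v * (real n ^ (?v - card (\<Union>B)) * p ^ (?e - ?j)))"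
    by (simp add: sum_distrib_right mult.assoc)
  also have "\<dots> \<le> (\<Sum>B\<in>\<BB>. real ?v ^ ?v * T ^ (?v - 2))"
    using bound by (intro sum_mono mult_left_mono) auto
  also have "\<dots> = real (card \<BB>) * (real ?v ^ ?v * T ^ (?v - 2))"
    by simp
  also have "\<dots> \<le> 2 ^ ?e * (real ?v ^ ?v * T ^ (?v - 2))"
    using of_nat_mono[OF fin\<BB>(2), where 'a = real] T by (intro mult_right_mono) auto
  finally show ?thesis
    by (simp add: spread_const_def mult_ac)
qed

text \<open>Map a fixed edge of \<open>F\<close> onto \<open>y\<close> and give every other vertex
  its own residue class modulo \<open>num_verts F\<close>. The choices are then independent and
  injectivity is automatic.\<close>

lemma card_embeddings_through:
  assumes F: "simple_graph F" and f: "f \<in> edges F" and y: "y \<in> complete_edges n"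
    and n: "6 * num_verts F \<le> n"
  shows "(real n / (2 * real (num_verts F))) ^ (num_verts F - 2) \<le>
    real (card {\<phi> \<in> embeddings F n. y \<in> image_edges F \<phi>})"
proof -
  let ?V = "verts F" and ?v = "num_verts F"
  note finV = simple_graph_finite(1)[OF F]
  obtain a b where ab: "f = {a, b}" "a \<noteq> b"
    using simple_graph_edge(2)[OF F f] by (auto simp: card_2_iff)
  have abV: "a \<in> ?V" "b \<in> ?V" using simple_graph_edge(1)[OF F f] ab by auto
  have v: "0 < ?v" using abV finV by (auto simp: num_verts_def card_gt_0_iff)
  obtain u w where uw: "y = {u, w}" "u \<noteq> w" "u < n" "w < n"
    using y by (auto simp: complete_edges card_2_iff)
  have "\<exists>g. bij_betw g ?V {..<?v}"
    by (rule finite_same_card_bij) (simp_all add: finV num_verts_def)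
  then obtain g where g: "bij_betw g ?V {..<?v}" by blast
  \<comment> \<open>Admissible images of \<open>x\<close>: the bijection \<open>g\<close> assigns
    the residue classes, and the ends of \<open>y\<close> are left to \<open>a\<close> and
    \<open>b\<close>.\<close>
  define Q where "Q x = (if x = a then {u} else if x = b then {w} else
    {z. z < n \<and> z mod ?v = g x} - {u, w})" for x
  have "PiE ?V Q \<subseteq> {\<phi> \<in> embeddings F n. y \<in> image_edges F \<phi>}"
  proof
    fix \<phi> assume \<phi>: "\<phi> \<in> PiE ?V Q"
    have mem: "\<phi> x \<in> Q x" if "x \<in> ?V" for x using PiE_mem[OF \<phi> that] .
    have \<phi>a: "\<phi> a = u" and \<phi>b: "\<phi> b = w"
      using mem[OF abV(1)] mem[OF abV(2)] ab(2) by (simp_all add: Q_def)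
    have other: "\<phi> x < n" "\<phi> x mod ?v = g x" "\<phi> x \<noteq> u" "\<phi> x \<noteq> w"
      if "x \<in> ?V" "x \<noteq> a" "x \<noteq> b" for x
      using mem[OF that(1)] that(2,3) by (simp_all add: Q_def)
    have key: "x = a" if "x \<in> ?V" "\<phi> x = u" for x
    proof (rule ccontr)
      assume "x \<noteq> a"
      then show False using that other(3)[OF that(1)] \<phi>b uw(2) by (cases "x = b") simp_all
    qed
    have key': "x = b" if "x \<in> ?V" "\<phi> x = w" for x
    proof (rule ccontr)
      assume "x \<noteq> b"
      then show False using that other(4)[OF that(1)] \<phi>a uw(2) by (cases "x = a") simp_all
    qed
    have "x = x'" if x: "x \<in> ?V" "x' \<in> ?V" "\<phi> x = \<phi> x'" for x x'
    proof -
      consider "\<phi> x = u" | "\<phi> x = w" | "\<phi> x \<noteq> u" "\<phi> x \<noteq> w" by blast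
      then show ?thesis
      proof cases
        case 1
        then have "x = a" "x' = a" using key[OF x(1)] key[OF x(2)] x(3) by simp_all
        then show ?thesis by simp
      next
        case 2
        then have "x = b" "x' = b" using key'[OF x(1)] key'[OF x(2)] x(3) by simp_all
        then show ?thesis by simp
      next
        case 3
        then have "x \<noteq> a" "x \<noteq> b" using \<phi>a \<phi>b by auto
        moreover have "x' \<noteq> a" "x' \<noteq> b" using 3 \<phi>a \<phi>b x(3) by auto
        ultimately have "g x = g x'" using other(2)[OF x(1)] other(2)[OF x(2)] x(3) by simp
        then show ?thesis by (rule inj_onD[OF bij_betw_imp_inj_on[OF g] _ x(1,2)])
      qed
    qed
    then have "inj_on \<phi> ?V" by (rule inj_onI)
    moreover have "\<phi> x < n" if "x \<in> ?V" for x
    proof -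
      consider "x = a" | "x = b" | "x \<noteq> a" "x \<noteq> b" by blast
      then show ?thesis using other(1)[OF that] \<phi>a \<phi>b uw(3,4) by cases simp_all
    qed
    ultimately have "\<phi> \<in> embeddings F n"
      using \<phi> unfolding embeddings_def PiE_iff by simp
    moreover have "y = \<phi> ` f" using \<phi>a \<phi>b ab(1) uw(1) by simp
    then have "y \<in> image_edges F \<phi>" unfolding image_edges_def using f by (rule image_eqI)
    ultimately show "\<phi> \<in> {\<phi> \<in> embeddings F n. y \<in> image_edges F \<phi>}" by simp
  qed
  then have "card (PiE ?V Q) \<le> card {\<phi> \<in> embeddings F n. y \<in> image_edges F \<phi>}"
    using finite_embeddings[OF finV] by (intro card_mono) auto
  moreover have "card (PiE ?V Q) = (\<Prod>x\<in>?V - {a, b}. card (Q x))"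
  proof -
    have "card (PiE ?V Q) = (\<Prod>x\<in>?V. card (Q x))" using finV by (rule card_PiE)
    also have "\<dots> = (\<Prod>x\<in>?V - {a, b}. card (Q x)) * (\<Prod>x\<in>{a, b}. card (Q x))"
      using finV abV by (intro prod.subset_diff) auto
    finally show ?thesis using ab by (simp add: Q_def)
  qed
  moreover have "(real n / (2 * real ?v)) ^ (?v - 2) \<le> real (\<Prod>x\<in>?V - {a, b}. card (Q x))"
  proof -
    have "real n / (2 * real ?v) \<le> real (card (Q x))" if x: "x \<in> ?V - {a, b}" for x
    proof -
      have gx: "g x < ?v" using g x by (auto simp: bij_betw_def)
      have "n div ?v \<le> card {z. z < n \<and> z mod ?v = g x}"
      proof -
        have "inj_on (\<lambda>q. q * ?v + g x) {..<n div ?v}" using v by (auto simp: inj_on_def)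
        then have "n div ?v = card ((\<lambda>q. q * ?v + g x) ` {..<n div ?v})"
          by (simp add: card_image)
        also have "\<dots> \<le> card {z. z < n \<and> z mod ?v = g x}"
        proof (intro card_mono subsetI)
          fix z assume "z \<in> (\<lambda>q. q * ?v + g x) ` {..<n div ?v}"
          then obtain q where q: "q < n div ?v" "z = q * ?v + g x" by auto
          have "z < (q + 1) * ?v" using q gx by simp
          also have "\<dots> \<le> n div ?v * ?v" using q by (intro mult_right_mono) auto
          also have "\<dots> \<le> n" by simp
          finally show "z \<in> {z. z < n \<and> z mod ?v = g x}" using q gx by simp
        qed simp
        finally show ?thesis .
      qed
      also have "\<dots> \<le> card (Q x) + 2"
      proof -
        have "card {z. z < n \<and> z mod ?v = g x} \<le> card (Q x \<union> {u, w})"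
          using x by (intro card_mono) (auto simp: Q_def)
        also have "\<dots> \<le> card (Q x) + card {u, w}" by (rule card_Un_le)
        finally show ?thesis using uw by simp
      qed
      finally have "n div ?v \<le> card (Q x) + 2" .
      moreover have "real n < (real (n div ?v) + 1) * real ?v"
      proof -
        have "n < (n div ?v + 1) * ?v"
          using v by (metis add.commute dividend_less_div_times mult.commute mult_Suc plus_1_eq_Suc)
        then show ?thesis by (metis of_nat_1 of_nat_add of_nat_less_iff of_nat_mult)
      qed
      moreover have "(real (n div ?v) + 1) * real ?v \<le> (real (card (Q x)) + 3) * real ?v"
        using \<open>n div ?v \<le> card (Q x) + 2\<close> by (intro mult_right_mono) auto
      ultimately have "real n < (real (card (Q x)) + 3) * real ?v"
        by linarith
      then have "real n / real ?v < real (card (Q x)) + 3"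
        using v by (simp add: divide_less_eq)
      \<comment> \<open>Each free vertex has more than \<open>n / v - 3\<close> choices, which is at
        least \<open>n / (2 * v)\<close> precisely when \<open>n / v \<ge> 6\<close>.\<close>
      moreover have "6 \<le> real n / real ?v"
        using n v of_nat_mono[OF n, where 'a = real] by (simp add: le_divide_eq)
      ultimately show ?thesis by (simp add: field_simps)
    qed
    then have "(\<Prod>x\<in>?V - {a, b}. real n / (2 * real ?v)) \<le> (\<Prod>x\<in>?V - {a, b}. real (card (Q x)))"
      by (intro prod_mono) auto
    moreover have "card (?V - {a, b}) = ?v - 2"
      using finV abV ab by (simp add: card_Diff_subset num_verts_def)
    ultimately show ?thesis by simp
  qed
  ultimately have "(real n / (2 * real ?v)) ^ (?v - 2) \<le> real (card (PiE ?V Q))"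
      "real (card (PiE ?V Q)) \<le> real (card {\<phi> \<in> embeddings F n. y \<in> image_edges F \<phi>})"
    by (simp_all only: of_nat_le_iff)
  then show ?thesis by (rule order_trans)
qed

section \<open>Copies through one fixed edge\<close>

text \<open>Indexing by pairs instead of by edge sets turns counts of copies into sums over
  embeddings; an edge set may occur several times.\<close>

definition copies_at :: "'a ugraph set \<Rightarrow> nat \<Rightarrow> nat set \<Rightarrow> ('a ugraph \<times> ('a \<Rightarrow> nat)) set" where
  "copies_at \<H> n y = (SIGMA F:\<H>. {\<phi> \<in> embeddings F n. y \<in> image_edges F \<phi>})"

definition remainder :: "nat set \<Rightarrow> 'a ugraph \<times> ('a \<Rightarrow> nat) \<Rightarrow> nat set set" where
  "remainder y = (\<lambda>(F, \<phi>). image_edges F \<phi> - {y})"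

lemma closes_copies_iff:
  "closes (copies \<H> n) U y \<longleftrightarrow> (\<exists>i\<in>copies_at \<H> n y. remainder y i \<subseteq> U)"
  unfolding closes_def copies_def copies_at_def remainder_def by auto

text \<open>A remainder contains \<open>B\<close> exactly when the whole copy contains
  \<open>insert y B\<close>. This set is never empty, so \<open>embeddings_spread\<close> applies
  even to empty \<open>B\<close>; if \<open>B\<close> contains \<open>y\<close>, no remainder
  contains it.\<close>

lemma copies_at_spread:
  assumes \<H>: "finite \<H>" "\<And>F. F \<in> \<H> \<Longrightarrow> two_balanced F" "\<And>F. F \<in> \<H> \<Longrightarrow> num_edges F - 1 \<le> r"
    and p: "0 < p" "p \<le> 1" and T: "\<And>F. F \<in> \<H> \<Longrightarrow> real n * p powr d2 F \<le> T" "1 \<le> T"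
  shows "spread (copies_at \<H> n y) (remainder y) r p (\<Sum>F\<in>\<H>. spread_const F T)"
proof -
  have simple: "\<And>F. F \<in> \<H> \<Longrightarrow> simple_graph F" using \<H>(2) two_balanced_simple by blast
  have finE: "finite (embeddings F n)" if "F \<in> \<H>" for F
    using finite_embeddings simple_graph_finite(1) simple that by blast
  have fin: "finite (copies_at \<H> n y)"
    unfolding copies_at_def using \<H>(1) finE by (intro finite_SigmaI) auto
  have rem: "finite (remainder y (F, \<phi>))" "card (remainder y (F, \<phi>)) = num_edges F - 1"
    if "(F, \<phi>) \<in> copies_at \<H> n y" for F \<phi>
  proof -
    have F: "F \<in> \<H>" "\<phi> \<in> embeddings F n" "y \<in> image_edges F \<phi>"
      using that by (auto simp: copies_at_def)
    show "finite (remainder y (F, \<phi>))"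
      using simple_graph_finite(2)[OF simple[OF F(1)]] by (simp add: remainder_def image_edges_def)
    show "card (remainder y (F, \<phi>)) = num_edges F - 1"
      using F card_image_edges[OF simple[OF F(1)] F(2)] by (simp add: remainder_def)
  qed
  have "(\<Sum>i | i \<in> copies_at \<H> n y \<and> B \<subseteq> remainder y i. p ^ (card (remainder y i) - card B)) \<le>
      (\<Sum>F\<in>\<H>. spread_const F T)" if B: "finite B" for B
  proof (cases "y \<in> B")
    case True
    then have "{i. i \<in> copies_at \<H> n y \<and> B \<subseteq> remainder y i} = {}"
      by (auto simp: remainder_def)
    moreover have "0 \<le> (\<Sum>F\<in>\<H>. spread_const F T)"
      using T(2) by (auto intro!: sum_nonneg simp: spread_const_def)
    ultimately show ?thesis by (simp only: sum.empty)
  next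
    case False
    have "{i. i \<in> copies_at \<H> n y \<and> B \<subseteq> remainder y i} =
        (SIGMA F:\<H>. {\<phi>. \<phi> \<in> embeddings F n \<and> insert y B \<subseteq> image_edges F \<phi>})"
      using False by (auto simp: copies_at_def remainder_def)
    moreover have "(\<Sum>i\<in>(SIGMA F:\<H>. {\<phi>. \<phi> \<in> embeddings F n \<and> insert y B \<subseteq> image_edges F \<phi>}).
          p ^ (card (remainder y i) - card B)) =
        (\<Sum>(F, \<phi>)\<in>(SIGMA F:\<H>. {\<phi>. \<phi> \<in> embeddings F n \<and> insert y B \<subseteq> image_edges F \<phi>}).
          p ^ (num_edges F - card (insert y B)))"
      using False B rem by (intro sum.cong) (auto simp: copies_at_def)
    moreover have "\<dots> = (\<Sum>F\<in>\<H>. \<Sum>\<phi> | \<phi> \<in> embeddings F n \<and> insert y B \<subseteq> image_edges F \<phi>.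
          p ^ (num_edges F - card (insert y B)))"
      using \<H>(1) finE by (intro sum.Sigma[symmetric]) auto
    moreover have "\<dots> \<le> (\<Sum>F\<in>\<H>. spread_const F T)"
      using \<H>(2) p T by (intro sum_mono embeddings_spread) auto
    ultimately show ?thesis by simp
  qed
  then show ?thesis
    unfolding spread_def using fin rem \<H>(3) by (auto simp: copies_at_def)
qed

text \<open>Every copy inside \<open>V\<close> through \<open>g\<close> contributes at most
  \<open>m\<close> edges. This reduces the hypothesis of \<open>survivors_lipschitz\<close> to a
  count whose moments are controlled by \<open>moment_bound\<close>.\<close>

lemma codegree_le:
  assumes \<H>: "finite \<H>" "\<And>F. F \<in> \<H> \<Longrightarrow> simple_graph F" "\<And>F. F \<in> \<H> \<Longrightarrow> num_edges F \<le> m"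
  shows "real (card {e. \<exists>C\<in>copies \<H> n. g \<in> C \<and> e \<in> C \<and> C \<subseteq> V}) \<le>
    real m * (\<Sum>i\<in>copies_at \<H> n g. of_bool (remainder g i \<subseteq> V))"
proof -
  let ?I = "{i \<in> copies_at \<H> n g. remainder g i \<subseteq> V}"
  have finE: "finite (embeddings F n)" if "F \<in> \<H>" for F
    using finite_embeddings simple_graph_finite(1) \<H>(2) that by blast
  have fin: "finite (copies_at \<H> n g)"
    unfolding copies_at_def using \<H>(1) finE by (intro finite_SigmaI) auto
  have im: "finite (image_edges (fst i) (snd i))" "card (image_edges (fst i) (snd i)) \<le> m"
    if "i \<in> ?I" for i
  proof -
    have i: "fst i \<in> \<H>" "snd i \<in> embeddings (fst i) n" using that by (auto simp: copies_at_def)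
    show "finite (image_edges (fst i) (snd i))"
      using simple_graph_finite(2)[OF \<H>(2)[OF i(1)]] by (simp add: image_edges_def)
    show "card (image_edges (fst i) (snd i)) \<le> m"
      using card_image_edges[OF \<H>(2)[OF i(1)] i(2)] \<H>(3)[OF i(1)] by simp
  qed
  have "{e. \<exists>C\<in>copies \<H> n. g \<in> C \<and> e \<in> C \<and> C \<subseteq> V} \<subseteq> (\<Union>i\<in>?I. image_edges (fst i) (snd i))"
  proof
    fix e assume "e \<in> {e. \<exists>C\<in>copies \<H> n. g \<in> C \<and> e \<in> C \<and> C \<subseteq> V}"
    then obtain F \<phi> where *: "F \<in> \<H>" "\<phi> \<in> embeddings F n" "g \<in> image_edges F \<phi>"
        "e \<in> image_edges F \<phi>" "image_edges F \<phi> \<subseteq> V"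
      by (auto simp: copies_def)
    then have "(F, \<phi>) \<in> ?I" by (auto simp: copies_at_def remainder_def)
    then show "e \<in> (\<Union>i\<in>?I. image_edges (fst i) (snd i))" using * by force
  qed
  then have "card {e. \<exists>C\<in>copies \<H> n. g \<in> C \<and> e \<in> C \<and> C \<subseteq> V} \<le>
      card (\<Union>i\<in>?I. image_edges (fst i) (snd i))"
    using fin im by (intro card_mono finite_UN_I) auto
  also have "\<dots> \<le> (\<Sum>i\<in>?I. card (image_edges (fst i) (snd i)))"
    using fin by (intro card_UN_le) auto
  also have "\<dots> \<le> (\<Sum>i\<in>?I. m)"
    using im by (intro sum_mono) auto
  finally have "real (card {e. \<exists>C\<in>copies \<H> n. g \<in> C \<and> e \<in> C \<and> C \<subseteq> V}) \<le> real (card ?I * m)"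
    by (simp only: sum_constant of_nat_le_iff of_nat_id)
  moreover have "(\<Sum>i\<in>copies_at \<H> n g. of_bool (remainder g i \<subseteq> V) :: real) = real (card ?I)"
    using fin by (simp add: of_bool_def sum.If_cases Int_def)
  ultimately show ?thesis by (simp add: mult.commute)
qed

section \<open>The expected number of surviving edges\<close>

text \<open>A geometric series in which every term is repeated \<open>k\<close> times.\<close>

lemma sum_power_div_le:
  fixes \<rho> :: real
  assumes "0 \<le> \<rho>" "\<rho> < 1" "0 < k"
  shows "(\<Sum>i<l * k. \<rho> ^ (i div k)) \<le> real k / (1 - \<rho>)"
proof -
  have "(\<Sum>i<l * k. \<rho> ^ (i div k)) = (\<Sum>j<l. \<Sum>i\<in>{j * k..<j * k + k}. \<rho> ^ (i div k))"
    by (rule sum.nat_group[symmetric])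
  also have "\<dots> = (\<Sum>j<l. real k * \<rho> ^ j)"
  proof (rule sum.cong)
    fix j
    have "i div k = j" if "i \<in> {j * k..<j * k + k}" for i
      using that by (intro div_nat_eqI) (auto simp: mult.commute)
    then show "(\<Sum>i\<in>{j * k..<j * k + k}. \<rho> ^ (i div k)) = real k * \<rho> ^ j"
      by simp
  qed simp
  also have "\<dots> = real k * (\<Sum>j<l. \<rho> ^ j)"
    by (rule sum_distrib_left[symmetric])
  also have "\<dots> = real k * ((1 - \<rho> ^ l) / (1 - \<rho>))"
    using assms by (simp add: sum_gp_strict)
  also have "\<dots> \<le> real k * (1 / (1 - \<rho>))"
    using assms by (intro mult_left_mono divide_right_mono) auto
  finally show ?thesis by simp
qed

lemma card_complete_edges_bounds:
  assumes "2 \<le> n"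
  shows "(real n)\<^sup>2 / 4 \<le> real (card (complete_edges n))"
    and "real (card (complete_edges n)) \<le> (real n)\<^sup>2 / 2"
proof -
  have "real (card (complete_edges n)) = real n * (real n - 1) / 2"
    using assms by (simp add: card_complete_edges choose_two real_of_nat_div of_nat_diff)
  moreover have "real n * 2 \<le> real n * real n" using assms by (intro mult_left_mono) auto
  ultimately show "(real n)\<^sup>2 / 4 \<le> real (card (complete_edges n))"
    and "real (card (complete_edges n)) \<le> (real n)\<^sup>2 / 2"
    by (simp_all add: power2_eq_square field_simps)
qed

section \<open>Parameters of a fixed family and the order of the mean\<close>

locale balanced_family =
  fixes \<H> :: "'a ugraph set" and H :: "'a ugraph" and m :: nat
  assumes fin: "finite \<H>"
    and bal: "\<And>F. F \<in> \<H> \<Longrightarrow> two_balanced F"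
    and H: "H \<in> \<H>"
    and min_d2: "\<And>F. F \<in> \<H> \<Longrightarrow> d2 H \<le> d2 F"
    and max_edges: "\<And>F. F \<in> \<H> \<Longrightarrow> num_edges F \<le> m"
begin

abbreviation "N n \<equiv> card (complete_edges n)"

abbreviation "\<C> \<equiv> copies \<H>"

text \<open>The density at which \<open>n ^ (v - 2) * p ^ (e - 1) = 1\<close> for \<open>H\<close>
  with \<open>v\<close> vertices and \<open>e\<close> edges, so a fixed edge lies in a constant
  expected number of potential copies of \<open>H\<close>.\<close>

definition "threshold n = real n powr (- (1 / d2 H))"

definition "magnitude n = real n powr (2 - 1 / d2 H)"

definition "draws n = nat \<lceil>magnitude n\<rceil>"

text \<open>One batch: \<open>draws n\<close> draws for each of the \<open>num_edges H - 1\<close>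
  edges that a copy of \<open>H\<close> through a given edge still needs.\<close>

definition "block n = (num_edges H - 1) * draws n"

definition "final_mean n = seq_avg (N n) (complete_edges n) (\<lambda>xs. real (survivors (\<C> n) (N n) xs))"

lemma simple: "F \<in> \<H> \<Longrightarrow> simple_graph F"
  using bal two_balanced_simple by blast

lemma edges_ge_2: "F \<in> \<H> \<Longrightarrow> 2 \<le> num_edges F"
  using bal by (simp add: two_balanced_def)

lemma m_ge_2: "2 \<le> m"
  using edges_ge_2[OF H] max_edges[OF H] by simp

lemma d2_H: "1 / 2 \<le> d2 H" "0 < d2 H"
  using d2_ge_half[OF bal[OF H]] by auto

lemma averaging_seq: "k \<le> N n \<Longrightarrow> averaging (seq_avg k (complete_edges n)) (inj_seqs k (complete_edges n))"
  by (rule averaging_seq_avg[OF finite_complete_edges])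

lemma threshold_pos: "1 \<le> n \<Longrightarrow> 0 < threshold n"
  by (simp add: threshold_def)

lemma threshold_le_one: "1 \<le> n \<Longrightarrow> threshold n \<le> 1"
  using d2_H powr_mono[of "- (1 / d2 H)" 0 "real n"] by (simp add: threshold_def)

lemma magnitude_eq: "1 \<le> n \<Longrightarrow> magnitude n = (real n)\<^sup>2 * threshold n"
  by (simp add: magnitude_def threshold_def powr_diff powr_minus divide_inverse powr_numeral)

lemma magnitude_ge_one: "1 \<le> n \<Longrightarrow> 1 \<le> magnitude n"
  unfolding magnitude_def using d2_H by (intro ge_one_powr_ge_zero) (auto simp: field_simps)

lemma draws_bounds:
  assumes "1 \<le> n"
  shows "magnitude n \<le> real (draws n)" "real (draws n) \<le> 2 * magnitude n" "1 \<le> draws n"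
  using magnitude_ge_one[OF assms] unfolding draws_def by linarith+

lemma block_pos: "1 \<le> n \<Longrightarrow> 0 < block n"
  using draws_bounds(3)[of n] edges_ge_2[OF H] by (simp add: block_def)

lemma draws_le_block: "draws n \<le> block n"
proof -
  have "1 * draws n \<le> (num_edges H - 1) * draws n"
    using edges_ge_2[OF H] by (intro mult_right_mono) linarith+
  then show ?thesis by (simp add: block_def)
qed

lemma block_le: "1 \<le> n \<Longrightarrow> real (block n) \<le> 2 * real (num_edges H - 1) * magnitude n"
  using mult_left_mono[OF draws_bounds(2)[of n], of "real (num_edges H - 1)"]
  by (simp add: block_def mult_ac)

lemma ratio_le:
  assumes "2 \<le> n" "0 \<le> x" "x \<le> c * magnitude n"
  shows "x / real (N n) \<le> 4 * c * threshold n"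
proof -
  have n: "0 < (real n)\<^sup>2 / 4" using assms by simp
  have "x / real (N n) \<le> x / ((real n)\<^sup>2 / 4)"
    using assms n card_complete_edges_bounds(1)[OF assms(1)]
    by (intro divide_left_mono mult_pos_pos) linarith+
  also have "\<dots> \<le> c * magnitude n / ((real n)\<^sup>2 / 4)"
    using assms n by (intro divide_right_mono) auto
  also have "\<dots> = 4 * c * threshold n"
    using assms by (simp add: magnitude_eq)
  finally show ?thesis .
qed

text \<open>Minimality of \<open>d2 H\<close> enters here: for \<open>p \<le> 1\<close> the power
  with the larger exponent \<open>d2 F\<close> is the smaller one.\<close>

lemma density_bound:
  assumes "1 \<le> n" "1 \<le> L" "0 < p" "p \<le> L * threshold n" "L * threshold n \<le> 1" "F \<in> \<H>"
  shows "real n * p powr d2 F \<le> L powr d2 H"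
proof -
  have "p powr d2 F \<le> p powr d2 H"
    using assms min_d2[OF assms(6)] by (intro powr_mono') auto
  also have "\<dots> \<le> (L * threshold n) powr d2 H"
    using assms d2_H by (intro powr_mono2) auto
  also have "\<dots> = L powr d2 H * real n powr (- 1)"
    using assms d2_H by (simp add: powr_mult threshold_def powr_powr)
  finally have "real n * p powr d2 F \<le> real n * (L powr d2 H * real n powr (- 1))"
    by (intro mult_left_mono) auto
  also have "\<dots> = L powr d2 H"
    using assms by (simp add: powr_minus)
  finally show ?thesis .
qed

lemma powr_ge_one: "1 \<le> L \<Longrightarrow> 1 \<le> L powr d2 H"
  using d2_H by (intro ge_one_powr_ge_zero) auto

lemma spread_copies:
  assumes "1 \<le> n" "1 \<le> L" "0 < p" "p \<le> L * threshold n" "L * threshold n \<le> 1"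
  shows "spread (copies_at \<H> n y) (remainder y) (m - 1) p (\<Sum>F\<in>\<H>. spread_const F (L powr d2 H))"
  using assms density_bound[OF assms] powr_ge_one max_edges
  by (intro copies_at_spread fin bal) (auto intro: diff_le_mono)

lemma spread_copies_H:
  assumes "1 \<le> n" "1 \<le> L" "0 < p" "p \<le> L * threshold n" "L * threshold n \<le> 1"
  shows "spread (copies_at {H} n y) (remainder y) (num_edges H - 1) p (spread_const H (L powr d2 H))"
proof -
  have "spread (copies_at {H} n y) (remainder y) (num_edges H - 1) p
      (\<Sum>F\<in>{H}. spread_const F (L powr d2 H))"
    using assms density_bound[OF assms] powr_ge_one H bal
    by (intro copies_at_spread) auto
  then show ?thesis by simp
qed

lemma spread_const_pos: "1 \<le> T \<Longrightarrow> 0 < spread_const H T"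
  using two_balanced_verts[OF bal[OF H]] by (simp add: spread_const_def)

text \<open>\<open>iid_hits_family\<close> for the copies of \<open>H\<close> through
  \<open>y\<close>. All constants depend on \<open>H\<close> only, because at this density the mean
  and the spread constant are both of constant order.\<close>

lemma block_hits:
  obtains \<delta> L :: real where "0 < \<delta>" "1 \<le> L"
    and "\<And>n y. 6 * num_verts H \<le> n \<Longrightarrow> L * threshold n \<le> 1 \<Longrightarrow> y \<in> complete_edges n \<Longrightarrow>
      \<delta> \<le> iid_avg (complete_edges n) (block n) (\<lambda>U. of_bool (closes (\<C> n) U y))"
proof
  let ?r = "num_edges H - 1" and ?v = "num_verts H"
  \<comment> \<open>A batch has at most \<open>2 * r * magnitude n\<close> draws, and dividing by
    the number of edges costs the factor 4 of \<open>ratio_le\<close>.\<close>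
  define L where "L = 8 * real ?r"
  define K where "K = spread_const H (L powr d2 H)"
  \<comment> \<open>At least \<open>(n / (2 * v)) ^ (v - 2)\<close> embeddings pass through
    \<open>y\<close>, each is covered with probability at least \<open>threshold n ^ r\<close>, and
    \<open>n ^ (v - 2) * threshold n ^ r = 1\<close>.\<close>
  define \<eta> where "\<eta> = (1 / (2 * real ?v)) ^ (?v - 2)"
  have r: "1 \<le> ?r" and v: "3 \<le> ?v"
    using edges_ge_2[OF H] two_balanced_verts[OF bal[OF H]] by auto
  show L: "1 \<le> L" using r by (simp add: L_def)
  have K: "0 < K" unfolding K_def by (intro spread_const_pos powr_ge_one L)
  have \<eta>: "0 < \<eta>" using v by (simp add: \<eta>_def)
  show "0 < \<eta>\<^sup>2 / (K * real (2 * ?r + 1) ^ ?r)\<^sup>2" using \<eta> K by simp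
  fix n y
  assume n: "6 * ?v \<le> n" and p0: "L * threshold n \<le> 1" and y: "y \<in> complete_edges n"
  have n1: "2 \<le> n" "1 \<le> n" using n v by auto
  define p where "p = real (?r * draws n) / real (N n)"
  have S: "complete_edges n \<noteq> {}" using y by auto
  have Npos: "0 < N n" using S finite_complete_edges by (simp add: card_gt_0_iff)
  have p: "0 < p" "p \<le> L * threshold n"
  proof -
    show "0 < p" using Npos block_pos[OF n1(2)] by (simp add: p_def block_def)
    have "p \<le> 4 * (2 * real ?r) * threshold n"
      unfolding p_def using block_le[OF n1(2)] by (intro ratio_le n1) (auto simp: block_def)
    then show "p \<le> L * threshold n" by (simp add: L_def)
  qed
  have draws_N: "draws n \<le> N n"
  proof -
    have "p \<le> 1" using p p0 by simp
    then have "real (?r * draws n) \<le> real (N n)"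
      using Npos by (simp add: p_def divide_le_eq)
    then have "?r * draws n \<le> N n" by (simp only: of_nat_le_iff)
    then show ?thesis using draws_le_block[of n] unfolding block_def by (rule order_trans[rotated])
  qed
  obtain f where f: "f \<in> edges H"
    using edges_ge_2[OF H] by (force simp: num_edges_def)
  have Hs: "simple_graph H" using simple[OF H] .
  have "\<eta> \<le> real (card (copies_at {H} n y)) * (real (draws n) / (2 * real (N n))) ^ ?r"
  proof -
    have "copies_at {H} n y = Pair H ` {\<phi> \<in> embeddings H n. y \<in> image_edges H \<phi>}"
      by (auto simp: copies_at_def)
    then have "card (copies_at {H} n y) = card {\<phi> \<in> embeddings H n. y \<in> image_edges H \<phi>}"
      by (simp add: card_image inj_on_def)
    then have 1: "(real n / (2 * real ?v)) ^ (?v - 2) \<le> real (card (copies_at {H} n y))"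
      using card_embeddings_through[OF Hs f y n] by simp
    have 2: "threshold n \<le> real (draws n) / (2 * real (N n))"
    proof -
      have "threshold n * (2 * real (N n)) \<le> threshold n * (real n)\<^sup>2"
        using card_complete_edges_bounds(2)[OF n1(1)] threshold_pos[OF n1(2)]
        by (intro mult_left_mono) auto
      also have "\<dots> \<le> real (draws n)"
        using draws_bounds(1)[OF n1(2)] magnitude_eq[OF n1(2)] by (simp add: mult.commute)
      finally show ?thesis using Npos by (simp add: le_divide_eq)
    qed
    have 3: "real n ^ (?v - 2) * threshold n ^ ?r = 1"
    proof -
      have "real ?r = d2 H * real (?v - 2)"
        using num_edges_conv_d2[OF bal[OF H]] r v by (simp add: of_nat_diff)
      then have "- (1 / d2 H) * real ?r = - real (?v - 2)"
        using d2_H by simp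
      then have "threshold n ^ ?r = real n powr (- real (?v - 2))"
        using n1 powr_realpow[of "threshold n" ?r] threshold_pos[of n]
        by (simp only: threshold_def powr_powr)
      then show ?thesis
        using n1 powr_realpow[of "real n" "?v - 2"] by (simp add: powr_minus)
    qed
    have "\<eta> = (real n / (2 * real ?v)) ^ (?v - 2) * threshold n ^ ?r"
      using 3 by (simp add: \<eta>_def power_divide power_mult_distrib)
    also have "\<dots> \<le> real (card (copies_at {H} n y)) * (real (draws n) / (2 * real (N n))) ^ ?r"
      using 1 2 threshold_pos[OF n1(2)] by (intro mult_mono power_mono) auto
    finally show ?thesis .
  qed
  moreover have "remainder y i \<subseteq> complete_edges n \<and> card (remainder y i) = ?r"
    if "i \<in> copies_at {H} n y" for i
  proof -
    obtain \<phi> where \<phi>: "i = (H, \<phi>)" "\<phi> \<in> embeddings H n" "y \<in> image_edges H \<phi>"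
      using \<open>i \<in> copies_at {H} n y\<close> by (auto simp: copies_at_def)
    then show ?thesis
      using image_edges_subset[OF Hs \<phi>(2)] card_image_edges[OF Hs \<phi>(2)]
      by (auto simp: remainder_def)
  qed
  moreover have "spread (copies_at {H} n y) (remainder y) ?r p K"
    unfolding K_def using n1 L p p0 by (intro spread_copies_H)
  ultimately have "\<eta>\<^sup>2 / (K * real (2 * ?r + 1) ^ ?r)\<^sup>2 \<le>
      iid_avg (complete_edges n) (?r * draws n) (\<lambda>U. of_bool (\<exists>i\<in>copies_at {H} n y. remainder y i \<subseteq> U))"
    using S draws_N K \<eta> unfolding p_def
    by (intro iid_hits_family finite_complete_edges) auto
  also have "\<dots> \<le> iid_avg (complete_edges n) (?r * draws n) (\<lambda>U. of_bool (closes (\<C> n) U y))"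
    using H by (intro averaging.prob_mono[OF averaging_iid_avg[OF finite_complete_edges S]])
      (auto simp: closes_copies_iff copies_at_def)
  finally show "\<eta>\<^sup>2 / (K * real (2 * ?r + 1) ^ ?r)\<^sup>2 \<le>
      iid_avg (complete_edges n) (block n) (\<lambda>U. of_bool (closes (\<C> n) U y))"
    by (simp add: block_def)
qed

lemma iid_block_le_one:
  assumes "y \<in> complete_edges n"
  shows "iid_avg (complete_edges n) t (\<lambda>U. of_bool (P U)) \<le> 1"
  using assms averaging.prob_le_one[OF averaging_iid_avg[OF finite_complete_edges]] by blast

text \<open>Not being closed is antitone in the drawn set. Hence the comparison with independent
  draws applies, and so does the product over batches.\<close>

lemma avoid_prob:
  assumes "y \<in> complete_edges n" "t \<le> N n"
    and "\<delta> \<le> iid_avg (complete_edges n) (block n) (\<lambda>U. of_bool (closes (\<C> n) U y))"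
  shows "seq_avg t (complete_edges n) (\<lambda>xs. of_bool (\<not> closes (\<C> n) (set xs) y)) \<le>
    (1 - \<delta>) ^ (t div block n)"
proof -
  have S: "complete_edges n \<noteq> {}" using assms by auto
  interpret averaging "iid_avg (complete_edges n) (block n)" "Pow (complete_edges n)"
    using finite_complete_edges S by (rule averaging_iid_avg)
  have "seq_avg t (complete_edges n) (\<lambda>xs. of_bool (\<not> closes (\<C> n) (set xs) y)) \<le>
      iid_avg (complete_edges n) t (\<lambda>U. of_bool (\<not> closes (\<C> n) U y))"
  proof (rule seq_avg_le_iid_avg[OF finite_complete_edges assms(2)])
    fix U V :: "nat set set" assume "U \<subseteq> V"
    from closes_mono[OF _ this, of "\<C> n" y]
    show "of_bool (\<not> closes (\<C> n) V y) \<le> (of_bool (\<not> closes (\<C> n) U y) :: real)"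
      by (simp add: of_bool_def)
  qed
  also have "\<dots> \<le> (1 - \<delta>) ^ (t div block n)"
  proof (rule iid_avoid_power[where P = "\<lambda>U. \<not> closes (\<C> n) U y", OF finite_complete_edges S])
    fix U V :: "nat set set" assume "\<not> closes (\<C> n) (U \<union> V) y"
    then show "\<not> closes (\<C> n) U y \<and> \<not> closes (\<C> n) V y"
      using closes_mono[of "\<C> n" U y "U \<union> V"] closes_mono[of "\<C> n" V y "U \<union> V"] by blast
  next
    show "iid_avg (complete_edges n) (block n) (\<lambda>U. of_bool (\<not> closes (\<C> n) U y)) \<le> 1 - \<delta>"
      using assms(3) by (simp add: prob_not)
  qed
  finally show ?thesis .
qed

lemma seq_avg_prefix:
  assumes "k \<le> N n"
  shows "seq_avg (N n) (complete_edges n) (\<lambda>xs. f (take k xs)) = seq_avg k (complete_edges n) f"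
  using seq_avg_take[OF finite_complete_edges, of k "N n - k" n f] assms by simp

text \<open>An edge surviving beyond position \<open>k\<close> is in particular not closed by the
  first \<open>k\<close> edges; a union bound over all edges removes the dependence on its
  position.\<close>

lemma late_survivors:
  assumes \<delta>: "\<And>y. y \<in> complete_edges n \<Longrightarrow>
      \<delta> \<le> iid_avg (complete_edges n) (block n) (\<lambda>U. of_bool (closes (\<C> n) U y))"
    and k: "k \<le> N n"
  shows "seq_avg (N n) (complete_edges n)
      (\<lambda>xs. of_bool (survivors (\<C> n) (N n) xs \<noteq> survivors (\<C> n) k xs)) \<le>
    real (N n) * (1 - \<delta>) ^ (k div block n)"
proof -
  interpret n: averaging "seq_avg (N n) (complete_edges n)" "inj_seqs (N n) (complete_edges n)"
    by (rule averaging_seq) simp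
  interpret k: averaging "seq_avg k (complete_edges n)" "inj_seqs k (complete_edges n)"
    using k by (rule averaging_seq)
  have "seq_avg (N n) (complete_edges n)
      (\<lambda>xs. of_bool (survivors (\<C> n) (N n) xs \<noteq> survivors (\<C> n) k xs)) \<le>
    seq_avg (N n) (complete_edges n)
      (\<lambda>xs. of_bool (\<exists>y\<in>complete_edges n. \<not> closes (\<C> n) (set (take k xs)) y))"
  proof (rule n.prob_mono)
    fix xs assume xs: "xs \<in> inj_seqs (N n) (complete_edges n)"
      and neq: "survivors (\<C> n) (N n) xs \<noteq> survivors (\<C> n) k xs"
    have "\<exists>i. i < N n \<and> k \<le> i \<and> \<not> closes (\<C> n) (set (take i xs)) (xs ! i)"
    proof (rule ccontr)
      assume *: "\<nexists>i. i < N n \<and> k \<le> i \<and> \<not> closes (\<C> n) (set (take i xs)) (xs ! i)"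
      have "i < N n \<and> \<not> closes (\<C> n) (set (take i xs)) (xs ! i) \<longleftrightarrow>
          i < k \<and> \<not> closes (\<C> n) (set (take i xs)) (xs ! i)" for i
        using * k by (cases "i < k") auto
      then show False using neq by (simp only: survivors_def)
    qed
    then obtain i where i: "i < N n" "k \<le> i" "\<not> closes (\<C> n) (set (take i xs)) (xs ! i)"
      by blast
    have "\<not> closes (\<C> n) (set (take k xs)) (xs ! i)"
      using i(3) closes_mono[OF _ set_take_subset_set_take[OF i(2)]] by (rule contrapos_nn)
    moreover have "xs ! i \<in> complete_edges n"
      using xs i(1) nth_mem[of i xs] by (auto simp: inj_seqs_def)
    ultimately show "\<exists>y\<in>complete_edges n. \<not> closes (\<C> n) (set (take k xs)) y" by blast
  qed
  also have "\<dots> = seq_avg k (complete_edges n)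
      (\<lambda>xs. of_bool (\<exists>y\<in>complete_edges n. \<not> closes (\<C> n) (set xs) y))"
    using k by (rule seq_avg_prefix)
  also have "\<dots> \<le> (\<Sum>y\<in>complete_edges n.
      seq_avg k (complete_edges n) (\<lambda>xs. of_bool (\<not> closes (\<C> n) (set xs) y)))"
    by (rule k.prob_bex[OF finite_complete_edges])
  also have "\<dots> \<le> (\<Sum>y\<in>complete_edges n. (1 - \<delta>) ^ (k div block n))"
    using \<delta> k by (intro sum_mono avoid_prob)
  finally show ?thesis by simp
qed

text \<open>In the first half of the order the next edge is uniform on at least half of all edges,
  whence the factor 2.\<close>

lemma next_survives_prob:
  fixes Q :: "nat set set \<Rightarrow> nat set \<Rightarrow> bool"
  assumes "2 * i \<le> N n" "0 < N n"
    and "\<And>y. y \<in> complete_edges n \<Longrightarrow> seq_avg i (complete_edges n) (\<lambda>xs. of_bool (Q (set xs) y)) \<le> b"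
  shows "seq_avg (N n) (complete_edges n) (\<lambda>xs. of_bool (Q (set (take i xs)) (xs ! i))) \<le> 2 * b"
proof -
  have i: "i < N n" using assms by simp
  interpret i: averaging "seq_avg i (complete_edges n)" "inj_seqs i (complete_edges n)"
    using i by (intro averaging_seq) simp
  obtain y where "y \<in> complete_edges n" using assms(2) by (auto simp: card_gt_0_iff)
  then have b: "0 \<le> b" using i.prob_nonneg assms(3) by (meson order_trans)
  have "seq_avg (N n) (complete_edges n) (\<lambda>xs. of_bool (Q (set (take i xs)) (xs ! i))) =
      seq_avg (N n) (complete_edges n)
        (\<lambda>xs. of_bool (Q (set (take i (take (Suc i) xs))) (take (Suc i) xs ! i)))"
    by simp
  also have "\<dots> = seq_avg (Suc i) (complete_edges n) (\<lambda>xs. of_bool (Q (set (take i xs)) (xs ! i)))"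
    using i by (intro seq_avg_prefix) simp
  also have "\<dots> \<le> (\<Sum>y\<in>complete_edges n.
      seq_avg i (complete_edges n) (\<lambda>xs. of_bool (Q (set xs) y))) / real (N n - i)"
    using i by (intro seq_avg_next[where \<psi> = "\<lambda>U x. of_bool (Q U x)"] finite_complete_edges) auto
  also have "\<dots> \<le> (\<Sum>y\<in>complete_edges n. b) / real (N n - i)"
    using assms(3) by (intro divide_right_mono sum_mono) auto
  also have "\<dots> = real (N n) / real (N n - i) * b"
    by simp
  also have "\<dots> \<le> 2 * b"
    using assms(1) i b by (intro mult_right_mono) (auto simp: divide_le_eq of_nat_diff)
  finally show ?thesis .
qed

text \<open>The survival probability at position \<open>i\<close> decays geometrically in the number
  of batches before \<open>i\<close>, so the sum is of the order of one batch, whatever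
  \<open>l\<close> is.\<close>

lemma mean_prefix_upper:
  assumes \<delta>: "0 < \<delta>" "\<And>y. y \<in> complete_edges n \<Longrightarrow>
      \<delta> \<le> iid_avg (complete_edges n) (block n) (\<lambda>U. of_bool (closes (\<C> n) U y))"
    and n: "2 \<le> n" and l: "2 * (l * block n) \<le> N n"
  shows "seq_avg (N n) (complete_edges n) (\<lambda>xs. real (survivors (\<C> n) (l * block n) xs)) \<le>
    2 * real (block n) / \<delta>"
proof -
  interpret n: averaging "seq_avg (N n) (complete_edges n)" "inj_seqs (N n) (complete_edges n)"
    by (rule averaging_seq) simp
  have N: "0 < N n"
    using card_complete_edges_bounds(1)[OF n] n by (intro gr0I) auto
  then obtain y where y: "y \<in> complete_edges n" by (auto simp: card_gt_0_iff)
  have \<delta>1: "\<delta> \<le> 1" using \<delta>(2)[OF y] iid_block_le_one[OF y] by (rule order_trans)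
  have "seq_avg (N n) (complete_edges n) (\<lambda>xs. real (survivors (\<C> n) (l * block n) xs)) =
      (\<Sum>i<l * block n. seq_avg (N n) (complete_edges n)
        (\<lambda>xs. of_bool (\<not> closes (\<C> n) (set (take i xs)) (xs ! i))))"
    unfolding survivors_sum by (rule n.sum)
  also have "\<dots> \<le> (\<Sum>i<l * block n. 2 * (1 - \<delta>) ^ (i div block n))"
  proof (rule sum_mono)
    fix i assume "i \<in> {..<l * block n}"
    then have "2 * i \<le> N n" using l by simp
    then show "seq_avg (N n) (complete_edges n)
        (\<lambda>xs. of_bool (\<not> closes (\<C> n) (set (take i xs)) (xs ! i))) \<le> 2 * (1 - \<delta>) ^ (i div block n)"
      using N \<delta> by (intro next_survives_prob avoid_prob) auto
  qed
  also have "\<dots> = 2 * (\<Sum>i<l * block n. (1 - \<delta>) ^ (i div block n))"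
    by (rule sum_distrib_left[symmetric])
  also have "\<dots> \<le> 2 * (real (block n) / (1 - (1 - \<delta>)))"
    using \<delta> \<delta>1 n block_pos[of n] by (intro mult_left_mono sum_power_div_le) auto
  finally show ?thesis by simp
qed

text \<open>The two counts differ by at most \<open>N n\<close>, and only on the event of
  \<open>late_survivors\<close>.\<close>

lemma mean_prefix_diff:
  assumes \<delta>: "\<And>y. y \<in> complete_edges n \<Longrightarrow>
      \<delta> \<le> iid_avg (complete_edges n) (block n) (\<lambda>U. of_bool (closes (\<C> n) U y))"
    and k: "k \<le> N n"
  shows "\<bar>final_mean n - seq_avg (N n) (complete_edges n) (\<lambda>xs. real (survivors (\<C> n) k xs))\<bar> \<le>
    real (N n) * (real (N n) * (1 - \<delta>) ^ (k div block n))"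
proof -
  interpret n: averaging "seq_avg (N n) (complete_edges n)" "inj_seqs (N n) (complete_edges n)"
    by (rule averaging_seq) simp
  have "\<bar>final_mean n - seq_avg (N n) (complete_edges n) (\<lambda>xs. real (survivors (\<C> n) k xs))\<bar> \<le>
      seq_avg (N n) (complete_edges n)
        (\<lambda>xs. \<bar>real (survivors (\<C> n) (N n) xs) - real (survivors (\<C> n) k xs)\<bar>)"
    unfolding final_mean_def n.diff[symmetric] by (rule n.abs_le)
  also have "\<dots> \<le> seq_avg (N n) (complete_edges n)
      (\<lambda>xs. real (N n) * of_bool (survivors (\<C> n) (N n) xs \<noteq> survivors (\<C> n) k xs))"
  proof (rule n.mono)
    fix xs
    have "survivors (\<C> n) (N n) xs \<le> N n" "survivors (\<C> n) k xs \<le> N n"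
      using survivors_le order_trans[OF survivors_le k] by blast+
    then show "\<bar>real (survivors (\<C> n) (N n) xs) - real (survivors (\<C> n) k xs)\<bar> \<le>
        real (N n) * of_bool (survivors (\<C> n) (N n) xs \<noteq> survivors (\<C> n) k xs)"
      by auto
  qed
  also have "\<dots> = real (N n) * seq_avg (N n) (complete_edges n)
      (\<lambda>xs. of_bool (survivors (\<C> n) (N n) xs \<noteq> survivors (\<C> n) k xs))"
    by (rule n.scale)
  also have "\<dots> \<le> real (N n) * (real (N n) * (1 - \<delta>) ^ (k div block n))"
    using late_survivors[OF \<delta> k] by (intro mult_left_mono) auto
  finally show ?thesis .
qed

lemma hit_prob:
  assumes "2 * k \<le> N n" "0 < N n" "finite C"
  shows "seq_avg k (complete_edges n) (\<lambda>xs. of_bool (C \<subseteq> set xs)) \<le> (2 * real k / real (N n)) ^ card C"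
proof -
  have "seq_avg k (complete_edges n) (\<lambda>xs. of_bool (C \<subseteq> set xs)) \<le> (real k * (2 / real (N n))) ^ card C"
    using assms by (intro hit_prob_bound finite_complete_edges) (auto simp: field_simps of_nat_diff)
  then show ?thesis by (simp add: mult.commute)
qed

text \<open>Among the first \<open>k\<close> positions, with \<open>k\<close> a small multiple of
  \<open>magnitude n\<close>, each edge survives with probability at least one half. A union bound
  over all copies suffices, because every remainder has at least one edge and thus gains a factor
  \<open>c\<close>.\<close>

lemma mean_lower:
  obtains a where "0 < a" and
    "\<And>n. 2 \<le> n \<Longrightarrow> 2 * draws n \<le> N n \<Longrightarrow> a * magnitude n \<le> final_mean n"
proof
  define K where "K = (\<Sum>F\<in>\<H>. spread_const F 1)"
  \<comment> \<open>Chosen so that \<open>2 * (c * K) \<le> 1 / 2\<close>; the 2 comes from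
    \<open>next_survives_prob\<close>.\<close>
  define c where "c = 1 / (4 * (K + 1))"
  have K: "0 \<le> K" unfolding K_def by (intro sum_nonneg) (simp add: spread_const_def)
  then have c: "0 < c" "c \<le> 1" "2 * (c * K) \<le> 1 / 2" by (auto simp: c_def field_simps)
  show "0 < c / 16" using c by simp
  fix n assume n: "2 \<le> n" and drN: "2 * draws n \<le> N n"
  have n1: "1 \<le> n" using n by simp
  interpret n: averaging "seq_avg (N n) (complete_edges n)" "inj_seqs (N n) (complete_edges n)"
    by (rule averaging_seq) simp
  have N: "0 < N n"
    using card_complete_edges_bounds(1)[OF n] n by (intro gr0I) auto
  \<comment> \<open>The 8 makes \<open>2 * i / N n\<close> at most \<open>c * threshold n\<close>
    for all \<open>i < k\<close>, after the factor 4 of \<open>ratio_le\<close>.\<close>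
  define k where "k = nat \<lceil>c * magnitude n / 8\<rceil>"
  have k_draws: "k \<le> draws n"
    unfolding k_def draws_def using c magnitude_ge_one[OF n1]
    by (intro nat_mono ceiling_mono) (simp add: field_simps mult_le_one)
  have closes_prob: "seq_avg i (complete_edges n) (\<lambda>xs. of_bool (closes (\<C> n) (set xs) y)) \<le> c * K"
    if i: "i < k" for i y
  proof -
    have iN: "2 * i \<le> N n" using i k_draws drN by simp
    interpret i: averaging "seq_avg i (complete_edges n)" "inj_seqs i (complete_edges n)"
      using iN by (intro averaging_seq) simp
    have "real i \<le> c * magnitude n / 8" using i unfolding k_def by linarith
    then have "2 * real i / real (N n) \<le> 4 * (c / 4) * threshold n"
      using n by (intro ratio_le) auto
    then have p: "2 * real i / real (N n) \<le> c * threshold n" by simp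
    have sp: "spread (copies_at \<H> n y) (remainder y) (m - 1) (threshold n) K"
      using spread_copies[OF n1, of 1 "threshold n" y] threshold_pos[OF n1] threshold_le_one[OF n1]
      by (simp add: K_def)
    have "seq_avg i (complete_edges n) (\<lambda>xs. of_bool (closes (\<C> n) (set xs) y)) \<le>
        (\<Sum>j\<in>copies_at \<H> n y. seq_avg i (complete_edges n) (\<lambda>xs. of_bool (remainder y j \<subseteq> set xs)))"
      unfolding closes_copies_iff using sp by (intro i.prob_bex) (simp add: spread_def)
    also have "\<dots> \<le> (\<Sum>j\<in>copies_at \<H> n y. c * threshold n ^ card (remainder y j))"
    proof (rule sum_mono)
      fix j assume j: "j \<in> copies_at \<H> n y"
      then obtain F \<phi> where F: "j = (F, \<phi>)" "F \<in> \<H>" "\<phi> \<in> embeddings F n" "y \<in> image_edges F \<phi>"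
        by (auto simp: copies_at_def)
      have "card (remainder y j) = num_edges F - 1"
        using F card_image_edges[OF simple[OF F(2)] F(3)] by (simp add: remainder_def)
      then have pos: "1 \<le> card (remainder y j)" using edges_ge_2[OF F(2)] by simp
      have "seq_avg i (complete_edges n) (\<lambda>xs. of_bool (remainder y j \<subseteq> set xs)) \<le>
          (2 * real i / real (N n)) ^ card (remainder y j)"
        using iN N sp j by (intro hit_prob) (auto simp: spread_def)
      also have "\<dots> \<le> (c * threshold n) ^ card (remainder y j)"
        using p by (intro power_mono) auto
      also have "\<dots> = c ^ card (remainder y j) * threshold n ^ card (remainder y j)"
        by (rule power_mult_distrib)
      also have "\<dots> \<le> c * threshold n ^ card (remainder y j)"
        using c pos threshold_pos[OF n1] power_decreasing[of 1 "card (remainder y j)" c]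
        by (intro mult_right_mono) auto
      finally show "seq_avg i (complete_edges n) (\<lambda>xs. of_bool (remainder y j \<subseteq> set xs)) \<le>
          c * threshold n ^ card (remainder y j)" .
    qed
    also have "\<dots> = c * (\<Sum>j\<in>copies_at \<H> n y. threshold n ^ card (remainder y j))"
      by (rule sum_distrib_left[symmetric])
    also have "\<dots> \<le> c * K"
      using c spread_sum[OF sp, of "{}"] threshold_pos[OF n1] by (intro mult_left_mono) auto
    finally show ?thesis .
  qed
  have "c * magnitude n / 16 \<le> real k / 2" unfolding k_def by linarith
  also have "\<dots> = (\<Sum>i<k. 1 / 2)" by simp
  also have "\<dots> \<le> (\<Sum>i<k. seq_avg (N n) (complete_edges n)
      (\<lambda>xs. of_bool (\<not> closes (\<C> n) (set (take i xs)) (xs ! i))))"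
  proof (rule sum_mono)
    fix i assume i: "i \<in> {..<k}"
    then have "2 * i \<le> N n" using k_draws drN by simp
    then have "seq_avg (N n) (complete_edges n)
        (\<lambda>xs. of_bool (closes (\<C> n) (set (take i xs)) (xs ! i))) \<le> 2 * (c * K)"
      using N i closes_prob by (intro next_survives_prob) auto
    then show "1 / 2 \<le> seq_avg (N n) (complete_edges n)
        (\<lambda>xs. of_bool (\<not> closes (\<C> n) (set (take i xs)) (xs ! i)))"
      unfolding n.prob_not using c by simp
  qed
  also have "\<dots> \<le> (\<Sum>i<N n. seq_avg (N n) (complete_edges n)
      (\<lambda>xs. of_bool (\<not> closes (\<C> n) (set (take i xs)) (xs ! i))))"
    using k_draws drN by (intro sum_mono2) (auto intro: n.prob_nonneg)
  also have "\<dots> = final_mean n"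
    unfolding final_mean_def survivors_sum by (rule n.sum[symmetric])
  finally show "c / 16 * magnitude n \<le> final_mean n" by simp
qed

end

section \<open>Concentration of the number of surviving edges\<close>

context balanced_family
begin

definition "spread_total = (\<Sum>F\<in>\<H>. spread_const F 1)"

lemma spread_total_pos: "0 < spread_total"
proof -
  have "spread_const H 1 \<le> spread_total"
    unfolding spread_total_def using fin H by (intro member_le_sum) (auto simp: spread_const_def)
  then show ?thesis using spread_const_pos[of 1] by simp
qed

text \<open>Since \<open>d2 H * (v - 2) \<le> d2 F * (v - 2) = e - 1\<close>, the spread constants
  grow at most like \<open>L ^ (m - 1)\<close>. The explicit exponent matters because
  \<open>L\<close> will be of order \<open>ln n\<close>.\<close>

lemma spread_sum_le:
  assumes "1 \<le> L"
  shows "(\<Sum>F\<in>\<H>. spread_const F (L powr d2 H)) \<le> spread_total * L ^ (m - 1)"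
  unfolding spread_total_def sum_distrib_right
proof (rule sum_mono)
  fix F assume F: "F \<in> \<H>"
  note bF = bal[OF F]
  have v: "3 \<le> num_verts F" using two_balanced_verts[OF bF] .
  have "(L powr d2 H) ^ (num_verts F - 2) = L powr (d2 H * real (num_verts F - 2))"
    using assms powr_realpow[of "L powr d2 H" "num_verts F - 2"] by (simp add: powr_powr)
  also have "\<dots> \<le> L powr real (num_edges F - 1)"
  proof (rule powr_mono)
    have "d2 H * real (num_verts F - 2) \<le> d2 F * real (num_verts F - 2)"
      using min_d2[OF F] by (intro mult_right_mono) auto
    also have "\<dots> = real (num_edges F - 1)"
      using num_edges_conv_d2[OF bF] v edges_ge_2[OF F] by (simp add: of_nat_diff)
    finally show "d2 H * real (num_verts F - 2) \<le> real (num_edges F - 1)" .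
  qed (use assms in simp)
  also have "\<dots> = L ^ (num_edges F - 1)"
    using assms by (intro powr_realpow) simp
  also have "\<dots> \<le> L ^ (m - 1)"
    using assms max_edges[OF F] by (intro power_increasing) auto
  finally have "(L powr d2 H) ^ (num_verts F - 2) \<le> L ^ (m - 1)" .
  then have "2 ^ num_edges F * real (num_verts F) ^ num_verts F * (L powr d2 H) ^ (num_verts F - 2) \<le>
      2 ^ num_edges F * real (num_verts F) ^ num_verts F * L ^ (m - 1)"
    by (intro mult_left_mono) auto
  then show "spread_const F (L powr d2 H) \<le> spread_const F 1 * L ^ (m - 1)"
    by (simp add: spread_const_def)
qed

text \<open>The \<open>q\<close>-th moment is at most \<open>M ^ q\<close>, so Markov's inequality
  at level \<open>e * M\<close> gains a factor \<open>1 / e\<close> per power.\<close>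

lemma codegree_tail:
  fixes q :: nat
  assumes n: "1 \<le> n" and k: "2 * k \<le> N n" "0 < N n"
    and L: "1 \<le> L" "2 * real k / real (N n) \<le> L * threshold n" "L * threshold n \<le> 1"
  defines "M \<equiv> spread_total * L ^ (m - 1) * real (q * (m - 1) + 1) ^ (m - 1)"
  shows "seq_avg k (complete_edges n)
      (\<lambda>xs. of_bool (exp 1 * M \<le> (\<Sum>i\<in>copies_at \<H> n g. of_bool (remainder g i \<subseteq> set xs)))) \<le>
    exp (- real q)"
proof -
  interpret averaging "seq_avg k (complete_edges n)" "inj_seqs k (complete_edges n)"
    using k by (intro averaging_seq) simp
  let ?X = "\<lambda>xs. \<Sum>i\<in>copies_at \<H> n g. of_bool (remainder g i \<subseteq> set xs) :: real"
  let ?p = "L * threshold n"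
  let ?K = "\<Sum>F\<in>\<H>. spread_const F (L powr d2 H)"
  have p: "0 < ?p" using L threshold_pos[OF n] by simp
  have "0 < real (q * (m - 1) + 1)" by (simp only: of_nat_0_less_iff)
  then have M: "0 < M"
    unfolding M_def using L spread_total_pos by (intro mult_pos_pos zero_less_power) auto
  have sp: "spread (copies_at \<H> n g) (remainder g) (m - 1) ?p ?K"
    using n L p by (intro spread_copies) auto
  have "seq_avg k (complete_edges n) (\<lambda>xs. ?X xs ^ q) \<le>
      (?K * real (q * (m - 1) + 1) ^ (m - 1)) ^ q"
  proof (rule moment_bound[OF sp less_imp_le[OF p]])
    fix C :: "nat set set" assume "finite C"
    then have "seq_avg k (complete_edges n) (\<lambda>xs. of_bool (C \<subseteq> set xs)) \<le>
        (2 * real k / real (N n)) ^ card C"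
      using k by (intro hit_prob)
    also have "\<dots> \<le> ?p ^ card C" using L by (intro power_mono) auto
    finally show "seq_avg k (complete_edges n) (\<lambda>xs. of_bool (C \<subseteq> set xs)) \<le> ?p ^ card C" .
  qed
  also have "\<dots> \<le> M ^ q"
    unfolding M_def using spread_sum_le[OF L(1)] spread_nonneg[OF sp less_imp_le[OF p]]
    by (intro power_mono mult_right_mono mult_nonneg_nonneg) auto
  finally have moment: "seq_avg k (complete_edges n) (\<lambda>xs. ?X xs ^ q) \<le> M ^ q" .
  have "(exp 1 * M) ^ q * seq_avg k (complete_edges n) (\<lambda>xs. of_bool ((exp 1 * M) ^ q \<le> ?X xs ^ q)) \<le>
      seq_avg k (complete_edges n) (\<lambda>xs. ?X xs ^ q)"
    by (intro markov zero_le_power sum_nonneg) simp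
  with moment have "(exp 1 * M) ^ q *
      seq_avg k (complete_edges n) (\<lambda>xs. of_bool ((exp 1 * M) ^ q \<le> ?X xs ^ q)) \<le> M ^ q"
    by linarith
  then have "seq_avg k (complete_edges n) (\<lambda>xs. of_bool ((exp 1 * M) ^ q \<le> ?X xs ^ q)) \<le> exp (- real q)"
    using M by (simp add: power_mult_distrib exp_minus field_simps flip: exp_of_nat_mult)
  moreover have "seq_avg k (complete_edges n) (\<lambda>xs. of_bool (exp 1 * M \<le> ?X xs)) \<le>
      seq_avg k (complete_edges n) (\<lambda>xs. of_bool ((exp 1 * M) ^ q \<le> ?X xs ^ q))"
    using M by (intro prob_mono power_mono) auto
  ultimately show ?thesis by linarith
qed

text \<open>The 16 collects 2 from \<open>block_le\<close>, 4 from \<open>ratio_le\<close> and 2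
  from asking the prefix to fit into half of the order.\<close>

lemma prefix_small:
  assumes "2 \<le> n" "16 * real (num_edges H - 1) * real l * threshold n \<le> 1"
  shows "2 * real (l * block n) / real (N n) \<le> 16 * real (num_edges H - 1) * real l * threshold n"
    and "2 * (l * block n) \<le> N n" "0 < N n"
proof -
  show N: "0 < N n"
    using card_complete_edges_bounds(1)[OF assms(1)] assms(1) by (intro gr0I) auto
  have "real (l * block n) \<le> 2 * real (num_edges H - 1) * magnitude n * real l"
    using mult_right_mono[OF block_le[of n], of "real l"] assms(1) by (simp add: mult_ac)
  then have "2 * real (l * block n) / real (N n) \<le>
      4 * (4 * real (num_edges H - 1) * real l) * threshold n"
    using assms(1) by (intro ratio_le) (auto simp: mult_ac)
  then show ratio: "2 * real (l * block n) / real (N n) \<le>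
      16 * real (num_edges H - 1) * real l * threshold n" by simp
  have "2 * real (l * block n) / real (N n) \<le> 1" using ratio assms(2) by linarith
  then have "real (2 * (l * block n)) \<le> real (N n)" using N by (simp add: divide_le_eq)
  then show "2 * (l * block n) \<le> N n" by (simp only: of_nat_le_iff)
qed

text \<open>By \<open>1 - \<delta> \<le> exp (- \<delta>)\<close> the failure probability is
  exponentially small in \<open>l\<close>. The cube in \<open>small\<close> is sized for the slack
  term of \<open>final_concentration\<close>, a product of three factors of order
  \<open>N n\<close>.\<close>

lemma mean_prefix_close:
  assumes \<delta>: "0 < \<delta>" "\<And>y. y \<in> complete_edges n \<Longrightarrow>
      \<delta> \<le> iid_avg (complete_edges n) (block n) (\<lambda>U. of_bool (closes (\<C> n) U y))"
    and n: "1 \<le> n" and N: "l * block n \<le> N n" "0 < N n"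
    and small: "(real (N n) + 2) ^ 3 * exp (- \<delta> * real l) \<le> 1"
  shows "(1 - \<delta>) ^ l \<le> exp (- \<delta> * real l)" "\<delta> \<le> 1"
    and "\<bar>final_mean n - seq_avg (N n) (complete_edges n)
      (\<lambda>xs. real (survivors (\<C> n) (l * block n) xs))\<bar> \<le> 1"
proof -
  let ?N = "real (N n)" and ?x = "exp (- \<delta> * real l)"
  obtain y where y: "y \<in> complete_edges n" using N by (auto simp: card_gt_0_iff)
  show \<delta>1: "\<delta> \<le> 1" using \<delta>(2)[OF y] iid_block_le_one[OF y] by (rule order_trans)
  have "(1 - \<delta>) ^ l \<le> exp (- \<delta>) ^ l"
    using \<delta>1 exp_ge_add_one_self[of "- \<delta>"] by (intro power_mono) auto
  also have "\<dots> = ?x" by (simp add: mult.commute flip: exp_of_nat_mult)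
  finally show x: "(1 - \<delta>) ^ l \<le> ?x" .
  have "\<bar>final_mean n - seq_avg (N n) (complete_edges n)
      (\<lambda>xs. real (survivors (\<C> n) (l * block n) xs))\<bar> \<le> ?N * (?N * (1 - \<delta>) ^ l)"
    using mean_prefix_diff[OF \<delta>(2) N(1)] block_pos[OF n] by simp
  also have "\<dots> \<le> ?N * (?N * ?x)" using x by (intro mult_left_mono) auto
  also have "\<dots> = ?N ^ 2 * ?x" by (simp add: power2_eq_square)
  also have "\<dots> \<le> (?N + 2) ^ 3 * ?x"
  proof (rule mult_right_mono)
    have "?N ^ 2 \<le> (?N + 2) ^ 2" by (intro power_mono) auto
    also have "\<dots> \<le> (?N + 2) ^ 3" by (intro power_increasing) auto
    finally show "?N ^ 2 \<le> (?N + 2) ^ 3" .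
  qed simp
  finally show "\<bar>final_mean n - seq_avg (N n) (complete_edges n)
      (\<lambda>xs. real (survivors (\<C> n) (l * block n) xs))\<bar> \<le> 1"
    using small by linarith
qed

text \<open>The level in \<open>codegree_tail\<close> for moment order \<open>q = l\<close> and
  \<open>L = 16 * (num_edges H - 1) * l\<close>, multiplied by the \<open>m\<close> of
  \<open>codegree_le\<close>.\<close>

definition "codegree_bound l =
  real m * (exp 1 * (spread_total * (16 * real (num_edges H - 1) * real l) ^ (m - 1) *
    real (l * (m - 1) + 1) ^ (m - 1)))"

text \<open>The good set consists of the sequences in which all codegrees are at most
  \<open>D0\<close>. By \<open>codegree_tail\<close> with \<open>q = l\<close> and a union bound
  over edges it is missed with probability at most \<open>N n * exp (- l)\<close>, and on it
  \<open>survivors_lipschitz\<close> supplies the constant \<open>D0 + 1\<close>.\<close>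

lemma prefix_concentration:
  assumes n: "2 \<le> n" and l: "1 \<le> l" "16 * real (num_edges H - 1) * real l * threshold n \<le> 1"
    and t: "0 < t"
  defines "k \<equiv> l * block n"
  obtains D where "0 < D" "D \<le> codegree_bound l + 1" "D \<le> real (N n) + 1" "2 * k \<le> N n"
    and "seq_avg k (complete_edges n) (\<lambda>xs. of_bool
        (t + (real k + D * real k) * (real (N n) * exp (- real l)) \<le>
          \<bar>real (survivors (\<C> n) k xs) -
            seq_avg k (complete_edges n) (\<lambda>xs. real (survivors (\<C> n) k xs))\<bar>)) \<le>
      2 * exp (- 2 * t\<^sup>2 / (real k * (2 * D)\<^sup>2)) + real (N n) * exp (- real l)"
proof -
  let ?h = "num_edges H - 1"
  define L where "L = 16 * real ?h * real l"
  define M where "M = spread_total * L ^ (m - 1) * real (l * (m - 1) + 1) ^ (m - 1)"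
  \<comment> \<open>No codegree exceeds \<open>N n\<close>, so the minimum costs nothing; it makes
    the error from outside the good set polynomial in \<open>N n\<close>.\<close>
  define D0 where "D0 = min (N n) (nat \<lfloor>codegree_bound l\<rfloor>)"
  define cod where "cod g V = card {e. \<exists>C\<in>\<C> n. g \<in> C \<and> e \<in> C \<and> C \<subseteq> V}" for g V
  have n1: "1 \<le> n" using n by simp
  have h: "1 \<le> ?h" using edges_ge_2[OF H] by simp
  have N: "0 < N n" using prefix_small(3)[OF n l(2)] .
  have "1 * 1 \<le> real ?h * real l" using h l by (intro mult_mono) auto
  then have L: "1 \<le> L" unfolding L_def mult.assoc by linarith
  have cb: "codegree_bound l = real m * (exp 1 * M)"
    by (simp add: codegree_bound_def M_def L_def)
  have "0 < real (l * (m - 1) + 1)" by (simp only: of_nat_0_less_iff)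
  then have M: "0 < M"
    unfolding M_def using L spread_total_pos by (intro mult_pos_pos zero_less_power) auto
  have ratio: "2 * real k / real (N n) \<le> L * threshold n"
    using prefix_small(1)[OF n l(2)] by (simp add: L_def k_def)
  have L1: "L * threshold n \<le> 1" using l by (simp add: L_def)
  have kN: "2 * k \<le> N n"
    using prefix_small(2)[OF n l(2)] by (simp add: k_def)
  have k0: "0 < k" using l block_pos[OF n1] by (simp add: k_def)
  interpret averaging "seq_avg k (complete_edges n)" "inj_seqs k (complete_edges n)"
    using kN by (intro averaging_seq) simp
  define \<Gamma> where "\<Gamma> = {xs \<in> inj_seqs k (complete_edges n). \<forall>g\<in>complete_edges n. cod g (set xs) \<le> D0}"
  have bad: "seq_avg k (complete_edges n) (\<lambda>xs. of_bool (xs \<notin> \<Gamma>)) \<le> real (N n) * exp (- real l)"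
  proof -
    have "seq_avg k (complete_edges n) (\<lambda>xs. of_bool (xs \<notin> \<Gamma>)) \<le>
        seq_avg k (complete_edges n) (\<lambda>xs. of_bool (\<exists>g\<in>complete_edges n. exp 1 * M \<le>
          (\<Sum>i\<in>copies_at \<H> n g. of_bool (remainder g i \<subseteq> set xs))))"
    proof (rule prob_mono)
      fix xs assume xs: "xs \<in> inj_seqs k (complete_edges n)" "xs \<notin> \<Gamma>"
      then obtain g where g: "g \<in> complete_edges n" "D0 < cod g (set xs)"
        by (auto simp: \<Gamma>_def not_le)
      have "cod g (set xs) \<le> card (set xs)"
        unfolding cod_def by (intro card_mono) auto
      also have "\<dots> \<le> N n"
        using xs by (intro card_mono finite_complete_edges) (auto simp: inj_seqs_def)
      finally have "cod g (set xs) \<le> N n" .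
      then have "nat \<lfloor>codegree_bound l\<rfloor> < cod g (set xs)"
        using g(2) by (simp add: D0_def)
      then have "codegree_bound l < real (cod g (set xs))" by linarith
      also have "\<dots> \<le> real m * (\<Sum>i\<in>copies_at \<H> n g. of_bool (remainder g i \<subseteq> set xs))"
        unfolding cod_def by (rule codegree_le[OF fin simple max_edges])
      finally have "exp 1 * M \<le> (\<Sum>i\<in>copies_at \<H> n g. of_bool (remainder g i \<subseteq> set xs))"
        using m_ge_2 unfolding cb by simp
      then show "\<exists>g\<in>complete_edges n. exp 1 * M \<le>
          (\<Sum>i\<in>copies_at \<H> n g. of_bool (remainder g i \<subseteq> set xs))"
        using g(1) by blast
    qed
    also have "\<dots> \<le> (\<Sum>g\<in>complete_edges n. seq_avg k (complete_edges n) (\<lambda>xs. of_bool (exp 1 * M \<le>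
          (\<Sum>i\<in>copies_at \<H> n g. of_bool (remainder g i \<subseteq> set xs)))))"
      by (rule prob_bex[OF finite_complete_edges])
    also have "\<dots> \<le> (\<Sum>g\<in>complete_edges n. exp (- real l))"
      unfolding M_def using n1 kN N L ratio L1 by (intro sum_mono codegree_tail)
    finally show ?thesis by simp
  qed
  show thesis
  proof (rule that[of "real D0 + 1"])
    have "0 \<le> codegree_bound l" using M by (simp add: cb)
    then show "real D0 + 1 \<le> codegree_bound l + 1"
      unfolding D0_def by linarith
    show "real D0 + 1 \<le> real (N n) + 1" by (simp add: D0_def)
    show "2 * k \<le> N n" by (rule kN)
    show "seq_avg k (complete_edges n) (\<lambda>xs. of_bool
        (t + (real k + (real D0 + 1) * real k) * (real (N n) * exp (- real l)) \<le>
          \<bar>real (survivors (\<C> n) k xs) -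
            seq_avg k (complete_edges n) (\<lambda>xs. real (survivors (\<C> n) k xs))\<bar>)) \<le>
      2 * exp (- 2 * t\<^sup>2 / (real k * (2 * (real D0 + 1))\<^sup>2)) + real (N n) * exp (- real l)"
    proof (rule seq_avg_concentration[OF finite_complete_edges k0 _ t _ _ _ _ bad])
      show "k \<le> N n" using kN by simp
      show "\<Gamma> \<subseteq> inj_seqs k (complete_edges n)" by (auto simp: \<Gamma>_def)
      show "0 \<le> real (survivors (\<C> n) k xs) \<and> real (survivors (\<C> n) k xs) \<le> real k" for xs
        using survivors_le by simp
      show "real (survivors (\<C> n) k xs) \<le>
          real (survivors (\<C> n) k ys) + (real D0 + 1) * real (hamming k xs ys)"
        if "xs \<in> \<Gamma>" "ys \<in> \<Gamma>" for xs ys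
      proof -
        have "survivors (\<C> n) k xs \<le> survivors (\<C> n) k ys + (D0 + 1) * hamming k xs ys"
          using that by (intro survivors_lipschitz) (auto simp: \<Gamma>_def inj_seqs_def cod_def)
        then have "real (survivors (\<C> n) k xs) \<le>
            real (survivors (\<C> n) k ys + (D0 + 1) * hamming k xs ys)"
          by (simp only: of_nat_le_iff)
        then show ?thesis by (simp add: distrib_right add.commute)
      qed
    qed simp
  qed simp
qed

text \<open>Replace the full count by that of the first \<open>l\<close> batches, in value by
  \<open>late_survivors\<close> and in mean by \<open>mean_prefix_close\<close>. All exponentially
  small errors are measured by \<open>exp (- \<delta> * l)\<close>, the weakest of them since
  \<open>\<delta> \<le> 1\<close>.\<close>

lemma final_concentration:
  assumes n: "2 \<le> n" and l: "1 \<le> l" "16 * real (num_edges H - 1) * real l * threshold n \<le> 1"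
    and \<delta>: "0 < \<delta>" "\<And>y. y \<in> complete_edges n \<Longrightarrow>
      \<delta> \<le> iid_avg (complete_edges n) (block n) (\<lambda>U. of_bool (closes (\<C> n) U y))"
    and small: "(real (N n) + 2) ^ 3 * exp (- \<delta> * real l) \<le> 1"
    and \<Delta>: "5 \<le> \<Delta>"
  shows "seq_avg (N n) (complete_edges n)
      (\<lambda>xs. of_bool (\<not> \<bar>real (survivors (\<C> n) (N n) xs) - final_mean n\<bar> \<le> \<Delta>)) \<le>
    2 * real (N n) * exp (- \<delta> * real l) +
    2 * exp (- \<Delta>\<^sup>2 / (8 * real (l * block n) * (codegree_bound l + 1)\<^sup>2))"
proof -
  define k where "k = l * block n"
  \<comment> \<open>The other half of \<open>\<Delta>\<close> absorbs two errors of at most 1 each: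
    the slack from outside the good set and the shift of the mean.\<close>
  define t where "t = \<Delta> / 2"
  define x where "x = exp (- \<delta> * real l)"
  have t: "0 < t" using \<Delta> by (simp add: t_def)
  obtain D where D: "0 < D" "D \<le> codegree_bound l + 1" "D \<le> real (N n) + 1" "2 * k \<le> N n"
    and conc: "seq_avg k (complete_edges n) (\<lambda>xs. of_bool
        (t + (real k + D * real k) * (real (N n) * exp (- real l)) \<le>
          \<bar>real (survivors (\<C> n) k xs) -
            seq_avg k (complete_edges n) (\<lambda>xs. real (survivors (\<C> n) k xs))\<bar>)) \<le>
      2 * exp (- 2 * t\<^sup>2 / (real k * (2 * D)\<^sup>2)) + real (N n) * exp (- real l)"
    using prefix_concentration[OF n l t, folded k_def] by metis
  have n1: "1 \<le> n" using n by simp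
  have N: "0 < N n" using prefix_small(3)[OF n l(2)] .
  have k0: "0 < k" using l block_pos[OF n1] by (simp add: k_def)
  have kN: "k \<le> N n" using D(4) by simp
  have kdiv: "k div block n = l" using block_pos[OF n1] by (simp add: k_def)
  note close = mean_prefix_close[OF \<delta> n1 kN[unfolded k_def] N small]
  have x: "0 \<le> x" "(1 - \<delta>) ^ l \<le> x" "exp (- real l) \<le> x"
    using close(1,2) mult_right_mono[of \<delta> 1 "real l"] by (simp_all add: x_def)
  let ?N = "real (N n)"
  let ?mean = "seq_avg k (complete_edges n) (\<lambda>xs. real (survivors (\<C> n) k xs))"
  have mean_diff: "\<bar>final_mean n - ?mean\<bar> \<le> 1"
    using close(3) seq_avg_prefix[OF kN, of "\<lambda>xs. real (survivors (\<C> n) k xs)"]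
    by (simp add: survivors_take k_def)
  have slack: "(real k + D * real k) * (?N * exp (- real l)) \<le> 1"
  proof -
    have "real k + D * real k \<le> ?N * (?N + 2)"
    proof -
      have "real k * (1 + D) \<le> ?N * (1 + (?N + 1))"
        using kN D by (intro mult_mono) auto
      then show ?thesis by (simp add: algebra_simps)
    qed
    then have "(real k + D * real k) * (?N * exp (- real l)) \<le> (?N * (?N + 2)) * (?N * x)"
      using x D by (intro mult_mono) auto
    also have "\<dots> = (?N * (?N + 2) * ?N) * x" by simp
    also have "\<dots> \<le> ((?N + 2) * (?N + 2) * (?N + 2)) * x"
      using x by (intro mult_right_mono mult_mono) auto
    finally show ?thesis using small by (simp add: x_def power3_eq_cube)
  qed
  interpret n: averaging "seq_avg (N n) (complete_edges n)" "inj_seqs (N n) (complete_edges n)"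
    by (rule averaging_seq) simp
  let ?far = "\<lambda>xs. t + (real k + D * real k) * (?N * exp (- real l)) \<le>
    \<bar>real (survivors (\<C> n) k xs) - ?mean\<bar>"
  have "seq_avg (N n) (complete_edges n)
      (\<lambda>xs. of_bool (\<not> \<bar>real (survivors (\<C> n) (N n) xs) - final_mean n\<bar> \<le> \<Delta>)) \<le>
    seq_avg (N n) (complete_edges n)
      (\<lambda>xs. of_bool (survivors (\<C> n) (N n) xs \<noteq> survivors (\<C> n) k xs \<or> ?far xs))"
    using mean_diff slack \<Delta> by (intro n.prob_mono) (auto simp: t_def)
  also have "\<dots> \<le> seq_avg (N n) (complete_edges n)
        (\<lambda>xs. of_bool (survivors (\<C> n) (N n) xs \<noteq> survivors (\<C> n) k xs)) +
      seq_avg (N n) (complete_edges n) (\<lambda>xs. of_bool (?far xs))"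
    by (rule n.prob_disj)
  also have "\<dots> \<le> ?N * x + (2 * exp (- 2 * t\<^sup>2 / (real k * (2 * D)\<^sup>2)) + ?N * x)"
  proof (rule add_mono)
    have "seq_avg (N n) (complete_edges n)
        (\<lambda>xs. of_bool (survivors (\<C> n) (N n) xs \<noteq> survivors (\<C> n) k xs)) \<le> ?N * (1 - \<delta>) ^ l"
      using late_survivors[OF \<delta>(2) kN] by (simp add: kdiv)
    also have "\<dots> \<le> ?N * x" using x by (intro mult_left_mono) auto
    finally show "seq_avg (N n) (complete_edges n)
        (\<lambda>xs. of_bool (survivors (\<C> n) (N n) xs \<noteq> survivors (\<C> n) k xs)) \<le> ?N * x" .
    have "seq_avg (N n) (complete_edges n) (\<lambda>xs. of_bool (?far xs)) =
        seq_avg k (complete_edges n) (\<lambda>xs. of_bool (?far xs))"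
      using seq_avg_prefix[OF kN, of "\<lambda>xs. of_bool (?far xs)"] by (simp add: survivors_take)
    also have "\<dots> \<le> 2 * exp (- 2 * t\<^sup>2 / (real k * (2 * D)\<^sup>2)) + ?N * exp (- real l)"
      by (rule conc)
    also have "\<dots> \<le> 2 * exp (- 2 * t\<^sup>2 / (real k * (2 * D)\<^sup>2)) + ?N * x"
      using x by (intro add_left_mono mult_left_mono) auto
    finally show "seq_avg (N n) (complete_edges n) (\<lambda>xs. of_bool (?far xs)) \<le>
        2 * exp (- 2 * t\<^sup>2 / (real k * (2 * D)\<^sup>2)) + ?N * x" .
  qed
  also have "\<dots> \<le> 2 * ?N * x + 2 * exp (- \<Delta>\<^sup>2 / (8 * real k * (codegree_bound l + 1)\<^sup>2))"
  proof -
    have "\<Delta>\<^sup>2 / (8 * real k * (codegree_bound l + 1)\<^sup>2) \<le> \<Delta>\<^sup>2 / (8 * real k * D\<^sup>2)"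
      using k0 D by (intro divide_left_mono mult_left_mono power_mono mult_pos_pos) auto
    also have "\<dots> = 2 * t\<^sup>2 / (real k * (2 * D)\<^sup>2)"
      by (simp add: t_def power_divide power_mult_distrib)
    finally show ?thesis by simp
  qed
  finally show ?thesis by (simp add: x_def k_def)
qed

section \<open>Asymptotic choice of the parameters\<close>

lemma eventually_threshold: "\<forall>\<^sub>F n in sequentially. B * (ln (real n) * threshold n) \<le> 1"
proof -
  have "(\<lambda>n. B * (ln (real n) / real n powr (1 / d2 H))) \<longlonglongrightarrow> B * 0"
    using d2_H by (intro tendsto_mult_left lim_ln_over_power) simp
  then have "\<forall>\<^sub>F n in sequentially. B * (ln (real n) / real n powr (1 / d2 H)) < 1"
    by (rule order_tendstoD) simp
  then show ?thesis
    by eventually_elim (simp add: threshold_def powr_minus divide_inverse)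
qed

lemma eventually_ln_ge: "\<forall>\<^sub>F n in sequentially. c \<le> ln (real n)"
proof -
  have "filterlim (\<lambda>n. ln (real n)) at_top sequentially"
    by (rule filterlim_compose[OF ln_at_top filterlim_real_sequentially])
  then show ?thesis by (simp add: filterlim_at_top)
qed

definition "blocks \<kappa> n = nat \<lceil>\<kappa> * ln (real n)\<rceil>"

lemma eventually_parameters:
  fixes L \<Lambda> :: real
  assumes "0 < \<kappa>" "1 \<le> L"
  shows "\<forall>\<^sub>F n in sequentially. 6 * num_verts H \<le> n \<and> 4 \<le> n \<and> L * threshold n \<le> 1 \<and>
    1 \<le> blocks \<kappa> n \<and> \<kappa> * ln (real n) \<le> real (blocks \<kappa> n) \<and>
    real (blocks \<kappa> n) \<le> (\<kappa> + 1) * ln (real n) \<and>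
    16 * real (num_edges H - 1) * real (blocks \<kappa> n) * threshold n \<le> 1 \<and>
    \<Lambda> \<le> ln (real n) \<and> 1 \<le> ln (real n)"
proof -
  let ?h = "real (num_edges H - 1)"
  show ?thesis
    using eventually_threshold[of L] eventually_threshold[of "16 * ?h * (\<kappa> + 1)"]
      eventually_ln_ge[of \<Lambda>] eventually_ln_ge[of 1]
      eventually_ge_at_top[of 4] eventually_ge_at_top[of "6 * num_verts H"]
  proof eventually_elim
    case (elim n)
    let ?x = "ln (real n)"
    have thr: "0 < threshold n" using elim by (intro threshold_pos) simp
    have \<kappa>x: "0 < \<kappa> * ?x" using assms elim by simp
    have l1: "1 \<le> blocks \<kappa> n" and l2: "\<kappa> * ?x \<le> real (blocks \<kappa> n)"
      and l3: "real (blocks \<kappa> n) \<le> \<kappa> * ?x + 1"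
      unfolding blocks_def using \<kappa>x by linarith+
    have l4: "real (blocks \<kappa> n) \<le> (\<kappa> + 1) * ?x"
      using l3 elim by (simp add: distrib_right)
    have "L * threshold n \<le> L * (?x * threshold n)"
      using elim thr assms by (intro mult_left_mono) auto
    moreover have "16 * ?h * real (blocks \<kappa> n) * threshold n \<le> 16 * ?h * ((\<kappa> + 1) * ?x) * threshold n"
      using l4 thr by (intro mult_right_mono mult_left_mono) auto
    ultimately show ?case
      using elim l1 l2 l4 by (simp add: mult_ac)
  qed
qed

text \<open>For \<open>n \<ge> 4\<close> one has \<open>N n + 2 \<le> n^2\<close>, so the cube costs
  \<open>n^6\<close>; the 9 in the exponent pays for this and leaves room.\<close>

lemma error_small:
  assumes "4 \<le> n" "0 < \<delta>" "((c + 9) / \<delta>) * ln (real n) \<le> real l" "0 \<le> c"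
  shows "exp (- \<delta> * real l) \<le> real n powr - (c + 9)"
    and "(real (N n) + 2) ^ 3 * exp (- \<delta> * real l) \<le> 1"
    and "real (N n) * exp (- \<delta> * real l) \<le> real n powr - (c + 1)"
proof -
  have "(c + 9) * ln (real n) \<le> \<delta> * real l"
    using assms by (simp add: field_simps)
  then show e: "exp (- \<delta> * real l) \<le> real n powr - (c + 9)"
    using assms by (simp add: powr_def algebra_simps)
  have N: "real (N n) \<le> (real n)\<^sup>2 / 2" using assms by (intro card_complete_edges_bounds) simp
  have n2: "16 \<le> (real n)\<^sup>2"
    using power_mono[of 4 "real n" 2] assms by simp
  have "(real (N n) + 2) ^ 3 * exp (- \<delta> * real l) \<le> ((real n)\<^sup>2) ^ 3 * real n powr - (c + 9)"
    using N n2 e by (intro mult_mono power_mono) auto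
  also have "\<dots> = real n powr 6 * real n powr - (c + 9)"
    using assms powr_realpow[of "real n" 6] by simp
  also have "\<dots> = real n powr (- c - 3)"
    unfolding powr_add[symmetric] by (rule arg_cong[of _ _ "(powr) (real n)"]) simp
  also have "\<dots> \<le> real n powr 0"
    using assms by (intro powr_mono) auto
  finally show "(real (N n) + 2) ^ 3 * exp (- \<delta> * real l) \<le> 1" using assms by simp
  have "real (N n) \<le> (real n)\<^sup>2" using N n2 by linarith
  then have "real (N n) * exp (- \<delta> * real l) \<le> (real n)\<^sup>2 * real n powr - (c + 9)"
    using e by (intro mult_mono) auto
  also have "\<dots> = real n powr 2 * real n powr - (c + 9)"
    using assms by simp
  also have "\<dots> = real n powr (- c - 7)"
    unfolding powr_add[symmetric] by (rule arg_cong[of _ _ "(powr) (real n)"]) simp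
  also have "\<dots> \<le> real n powr - (c + 1)"
    using assms by (intro powr_mono) auto
  finally show "real (N n) * exp (- \<delta> * real l) \<le> real n powr - (c + 1)" .
qed

theorem mean_order:
  obtains a A where "0 < a" "0 < A"
    "\<forall>\<^sub>F n in sequentially. a * magnitude n \<le> final_mean n \<and> final_mean n \<le> A * magnitude n"
proof -
  obtain \<delta> L :: real where \<delta>: "0 < \<delta>" "1 \<le> L"
    "\<And>n y. 6 * num_verts H \<le> n \<Longrightarrow> L * threshold n \<le> 1 \<Longrightarrow> y \<in> complete_edges n \<Longrightarrow>
      \<delta> \<le> iid_avg (complete_edges n) (block n) (\<lambda>U. of_bool (closes (\<C> n) U y))"
    using block_hits by blast
  obtain a where a: "0 < a"
    "\<And>n. 2 \<le> n \<Longrightarrow> 2 * draws n \<le> N n \<Longrightarrow> a * magnitude n \<le> final_mean n"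
    using mean_lower by blast
  \<comment> \<open>The value required by \<open>error_small\<close> at
    \<open>c = 0\<close>.\<close>
  define \<kappa> where "\<kappa> = (0 + 9) / \<delta>"
  \<comment> \<open>The bound \<open>2 * block n / \<delta>\<close> of
    \<open>mean_prefix_upper\<close>, plus 1 for the edges after the prefix, absorbed by
    \<open>magnitude n \<ge> 1\<close>.\<close>
  define A where "A = 4 * real (num_edges H - 1) / \<delta> + 1"
  have \<kappa>: "0 < \<kappa>" using \<delta> by (simp add: \<kappa>_def)
  have A: "0 < A" using \<delta> unfolding A_def by (intro add_nonneg_pos) auto
  have "\<forall>\<^sub>F n in sequentially. a * magnitude n \<le> final_mean n \<and> final_mean n \<le> A * magnitude n"
    using eventually_parameters[OF \<kappa> \<delta>(2), of 1]
  proof eventually_elim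
    case (elim n)
    define l where "l = blocks \<kappa> n"
    have n: "2 \<le> n" "1 \<le> n" "4 \<le> n" using elim by auto
    have hit: "\<delta> \<le> iid_avg (complete_edges n) (block n) (\<lambda>U. of_bool (closes (\<C> n) U y))"
      if "y \<in> complete_edges n" for y
      using \<delta>(3) elim that by blast
    have small: "16 * real (num_edges H - 1) * real l * threshold n \<le> 1"
      using elim by (simp add: l_def)
    note kN = prefix_small(2,3)[OF n(1) small]
    have l: "1 \<le> l" using elim by (simp add: l_def)
    have "1 * block n \<le> l * block n" using l by (intro mult_right_mono) auto
    then have "2 * draws n \<le> N n"
      using kN(1) draws_le_block[of n] by linarith
    then have lower: "a * magnitude n \<le> final_mean n" using a n by simp
    have err: "(real (N n) + 2) ^ 3 * exp (- \<delta> * real l) \<le> 1"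
    proof (rule error_small(2)[OF n(3) \<delta>(1)])
      show "(0 + 9) / \<delta> * ln (real n) \<le> real l" using elim unfolding \<kappa>_def l_def by simp
    qed simp
    have "l * block n \<le> N n" using kN by simp
    then have "final_mean n \<le> seq_avg (N n) (complete_edges n)
        (\<lambda>xs. real (survivors (\<C> n) (l * block n) xs)) + 1"
      using mean_prefix_close(3)[OF \<delta>(1) hit n(2) _ kN(2) err] by linarith
    also have "\<dots> \<le> 2 * real (block n) / \<delta> + 1"
      using mean_prefix_upper[OF \<delta>(1) hit n(1) kN(1)] by simp
    also have "\<dots> \<le> 2 * (2 * real (num_edges H - 1) * magnitude n) / \<delta> + magnitude n"
      using block_le[OF n(2)] magnitude_ge_one[OF n(2)] \<delta>(1)
      by (intro add_mono divide_right_mono mult_left_mono) auto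
    also have "\<dots> = A * magnitude n" by (simp add: A_def algebra_simps)
    finally show ?case using lower by simp
  qed
  then show thesis using that a(1) A by blast
qed

text \<open>One factor \<open>l ^ (m - 1)\<close> stems from the density of \<open>l\<close>
  batches, the other from the moment order \<open>l\<close>.\<close>

lemma codegree_bound_le:
  obtains C where "0 < C" "\<And>l. 1 \<le> l \<Longrightarrow> 0 \<le> codegree_bound l"
    "\<And>l. 1 \<le> l \<Longrightarrow> codegree_bound l + 1 \<le> C * real l ^ (2 * (m - 1))"
proof -
  define B where "B = real m * (exp 1 * (spread_total * (16 * real m) ^ (m - 1) * real m ^ (m - 1)))"
  have B: "0 \<le> B" using spread_total_pos by (simp add: B_def)
  show thesis
  proof (rule that[of "B + 1"])
    show "0 < B + 1" using B by simp
    fix l :: nat assume l: "1 \<le> l"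
    show "0 \<le> codegree_bound l"
      using spread_total_pos by (simp add: codegree_bound_def)
    have "l * (m - 1) + 1 \<le> l * (m - 1) + l" using l by simp
    also have "\<dots> = l * m" using m_ge_2 by (cases m) auto
    finally have lm: "real (l * (m - 1) + 1) \<le> real l * real m"
      by (simp only: of_nat_mult[symmetric] of_nat_le_iff)
    have h: "real (num_edges H - 1) \<le> real m" using max_edges[OF H] by simp
    have "codegree_bound l \<le>
        real m * (exp 1 * (spread_total * (16 * real m * real l) ^ (m - 1) * (real l * real m) ^ (m - 1)))"
      unfolding codegree_bound_def using lm h spread_total_pos
      by (intro mult_left_mono mult_mono power_mono mult_right_mono) auto
    also have "\<dots> = B * real l ^ (2 * (m - 1))"
      by (simp add: B_def power_mult_distrib mult_2 power_add mult_ac)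
    finally have "codegree_bound l \<le> B * real l ^ (2 * (m - 1))" .
    moreover have "1 \<le> real l ^ (2 * (m - 1))" using l by (intro one_le_power) simp
    ultimately show "codegree_bound l + 1 \<le> (B + 1) * real l ^ (2 * (m - 1))"
      by (simp add: distrib_right)
  qed
qed

text \<open>The denominator in \<open>final_concentration\<close> is at most
  \<open>C2 * magnitude n * x ^ (4 * m)\<close> with \<open>x = ln n\<close>, because
  \<open>l * l ^ (4 * (m - 1)) \<le> l ^ (4 * m)\<close>. The squared deviation is at least
  \<open>a * magnitude n * x ^ (8 * m)\<close>. The quotient is at least
  \<open>a / C2 * x ^ (4 * m)\<close>, which exceeds any multiple of \<open>x\<close>.\<close>

theorem concentration:
  assumes c: "0 < c"
  shows "\<forall>\<^sub>F n in sequentially. seq_avg (N n) (complete_edges n)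
      (\<lambda>xs. of_bool (\<not> \<bar>real (survivors (\<C> n) (N n) xs) - final_mean n\<bar> \<le>
        sqrt (final_mean n) * ln (real n) ^ (4 * m))) \<le> real n powr - c"
proof -
  obtain \<delta> L :: real where \<delta>: "0 < \<delta>" "1 \<le> L"
    "\<And>n y. 6 * num_verts H \<le> n \<Longrightarrow> L * threshold n \<le> 1 \<Longrightarrow> y \<in> complete_edges n \<Longrightarrow>
      \<delta> \<le> iid_avg (complete_edges n) (block n) (\<lambda>U. of_bool (closes (\<C> n) U y))"
    using block_hits by blast
  obtain a where a: "0 < a"
    "\<And>n. 2 \<le> n \<Longrightarrow> 2 * draws n \<le> N n \<Longrightarrow> a * magnitude n \<le> final_mean n"
    using mean_lower by blast
  obtain C where C: "0 < C" "\<And>l. 1 \<le> l \<Longrightarrow> 0 \<le> codegree_bound l"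
    "\<And>l. 1 \<le> l \<Longrightarrow> codegree_bound l + 1 \<le> C * real l ^ (2 * (m - 1))"
    using codegree_bound_le by blast
  define \<kappa> where "\<kappa> = (c + 9) / \<delta>"
  define C2 where "C2 = 16 * real m * C\<^sup>2 * (\<kappa> + 1) ^ (4 * m)"
  have \<kappa>: "0 < \<kappa>" using \<delta> c by (simp add: \<kappa>_def)
  have C2: "0 < C2" using C m_ge_2 \<kappa> by (simp add: C2_def)
  show ?thesis
    \<comment> \<open>The first bound on \<open>ln n\<close> brings the tail exponent up to
      \<open>(c + 1) * ln n\<close>, the second ensures \<open>\<Delta> \<ge> 5\<close>.\<close>
    using eventually_parameters[OF \<kappa> \<delta>(2), of "max ((c + 1) * C2 / a) (5 / sqrt a)"]
  proof eventually_elim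
    case (elim n)
    define l where "l = blocks \<kappa> n"
    define x where "x = ln (real n)"
    define \<Delta> where "\<Delta> = sqrt (final_mean n) * x ^ (4 * m)"
    have n: "2 \<le> n" "1 \<le> n" "4 \<le> n" using elim by auto
    have hit: "\<delta> \<le> iid_avg (complete_edges n) (block n) (\<lambda>U. of_bool (closes (\<C> n) U y))"
      if "y \<in> complete_edges n" for y
      using \<delta>(3) elim that by blast
    have small: "16 * real (num_edges H - 1) * real l * threshold n \<le> 1"
      using elim by (simp add: l_def)
    note kN = prefix_small(2,3)[OF n(1) small]
    have l: "1 \<le> l" "real l \<le> (\<kappa> + 1) * x" "\<kappa> * x \<le> real l"
      using elim by (simp_all add: l_def x_def)
    have x: "1 \<le> x" "(c + 1) * C2 / a \<le> x" "5 / sqrt a \<le> x" using elim by (simp_all add: x_def)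
    have X: "1 \<le> magnitude n" using magnitude_ge_one[OF n(2)] .
    have "1 * block n \<le> l * block n" using l by (intro mult_right_mono) auto
    then have "2 * draws n \<le> N n"
      using kN(1) draws_le_block[of n] by linarith
    then have lower: "a * magnitude n \<le> final_mean n" using a n by simp
    have err: "(real (N n) + 2) ^ 3 * exp (- \<delta> * real l) \<le> 1"
      "real (N n) * exp (- \<delta> * real l) \<le> real n powr - (c + 1)"
      using error_small(2,3)[OF n(3) \<delta>(1) l(3)[unfolded \<kappa>_def x_def] less_imp_le[OF c]] .
    have "a * 1 \<le> a * magnitude n" using X a by (intro mult_left_mono) auto
    then have mean: "a \<le> final_mean n" "0 < final_mean n" using lower a by linarith+
    have "5 \<le> sqrt a * x" using x a by (simp add: divide_le_eq mult.commute)
    also have "\<dots> \<le> sqrt (final_mean n) * x ^ (4 * m)"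
      using x mean m_ge_2 a power_increasing[of 1 "4 * m" x] by (intro mult_mono) auto
    finally have \<Delta>5: "5 \<le> \<Delta>" by (simp add: \<Delta>_def)
    have denom: "8 * real (l * block n) * (codegree_bound l + 1)\<^sup>2 \<le> C2 * magnitude n * x ^ (4 * m)"
    proof -
      have "real (block n) \<le> 2 * real m * magnitude n"
      proof -
        have "real (num_edges H - 1) * magnitude n \<le> real m * magnitude n"
          using X max_edges[OF H] by (intro mult_right_mono) auto
        then show ?thesis using block_le[OF n(2)] by simp
      qed
      then have "8 * (real l * real (block n)) \<le> 8 * (real l * (2 * real m * magnitude n))"
        by (intro mult_left_mono) auto
      moreover have "(codegree_bound l + 1)\<^sup>2 \<le> (C * real l ^ (2 * (m - 1)))\<^sup>2"
        using C(2,3)[OF l(1)] by (intro power_mono) auto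
      ultimately have "8 * (real l * real (block n)) * (codegree_bound l + 1)\<^sup>2 \<le>
          8 * (real l * (2 * real m * magnitude n)) * (C * real l ^ (2 * (m - 1)))\<^sup>2"
        by (rule mult_mono) (use X in auto)
      also have "\<dots> = 16 * real m * C\<^sup>2 * magnitude n * (real l * (real l ^ (2 * (m - 1)))\<^sup>2)"
        by (simp add: power_mult_distrib mult_ac)
      also have "real l * (real l ^ (2 * (m - 1)))\<^sup>2 = real l ^ Suc (2 * (m - 1) * 2)"
        by (simp only: power_Suc power_mult)
      also have "16 * real m * C\<^sup>2 * magnitude n * real l ^ Suc (2 * (m - 1) * 2) \<le>
          16 * real m * C\<^sup>2 * magnitude n * real l ^ (4 * m)"
        using l X m_ge_2 by (intro mult_left_mono power_increasing) auto
      also have "\<dots> \<le> 16 * real m * C\<^sup>2 * magnitude n * ((\<kappa> + 1) * x) ^ (4 * m)"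
        using l X by (intro mult_left_mono power_mono) auto
      also have "\<dots> = C2 * magnitude n * x ^ (4 * m)"
        by (simp add: C2_def power_mult_distrib mult_ac)
      finally show ?thesis by (simp add: mult_ac)
    qed
    have "0 < real (block n)" using block_pos[OF n(2)] by simp
    then have denom_pos: "0 < 8 * real (l * block n) * (codegree_bound l + 1)\<^sup>2"
      using l C(2)[OF l(1)] by simp
    have "(c + 1) * x \<le> \<Delta>\<^sup>2 / (8 * real (l * block n) * (codegree_bound l + 1)\<^sup>2)"
    proof -
      have "(c + 1) * C2 \<le> a * x" using x a by (simp add: divide_le_eq mult.commute)
      then have "(c + 1) * C2 * x \<le> a * x * x" using x by (intro mult_right_mono) auto
      also have "\<dots> = a * x ^ 2" by (simp add: power2_eq_square)
      also have "\<dots> \<le> a * x ^ (4 * m)"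
        using x a m_ge_2 by (intro mult_left_mono power_increasing) auto
      finally have "(c + 1) * C2 * x * (magnitude n * x ^ (4 * m)) \<le>
          a * x ^ (4 * m) * (magnitude n * x ^ (4 * m))"
        using X x by (intro mult_right_mono) auto
      also have "\<dots> = a * magnitude n * (x ^ (4 * m))\<^sup>2"
        by (simp add: power2_eq_square)
      also have "\<dots> \<le> final_mean n * (x ^ (4 * m))\<^sup>2"
        using lower by (intro mult_right_mono) auto
      also have "\<dots> = \<Delta>\<^sup>2"
        using mean by (simp add: \<Delta>_def power_mult_distrib)
      finally have "(c + 1) * x * (C2 * magnitude n * x ^ (4 * m)) \<le> \<Delta>\<^sup>2"
        by (simp add: mult_ac)
      moreover have "(c + 1) * x * (8 * real (l * block n) * (codegree_bound l + 1)\<^sup>2) \<le>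
          (c + 1) * x * (C2 * magnitude n * x ^ (4 * m))"
        using denom c x by (intro mult_left_mono) auto
      ultimately show ?thesis
        using denom_pos by (simp only: pos_le_divide_eq)
    qed
    then have "exp (- (\<Delta>\<^sup>2 / (8 * real (l * block n) * (codegree_bound l + 1)\<^sup>2))) \<le> exp (- ((c + 1) * x))"
      by simp
    also have "\<dots> = real n powr - (c + 1)"
      using n by (simp add: powr_def x_def algebra_simps)
    finally have tail: "exp (- \<Delta>\<^sup>2 / (8 * real (l * block n) * (codegree_bound l + 1)\<^sup>2)) \<le>
        real n powr - (c + 1)" by simp
    have "seq_avg (N n) (complete_edges n)
        (\<lambda>xs. of_bool (\<not> \<bar>real (survivors (\<C> n) (N n) xs) - final_mean n\<bar> \<le> \<Delta>)) \<le>
      2 * real (N n) * exp (- \<delta> * real l) +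
      2 * exp (- \<Delta>\<^sup>2 / (8 * real (l * block n) * (codegree_bound l + 1)\<^sup>2))"
      by (rule final_concentration[OF n(1) l(1) small \<delta>(1) hit err(1) \<Delta>5])
    also have "\<dots> \<le> 2 * real n powr - (c + 1) + 2 * real n powr - (c + 1)"
      using err(2) tail by (intro add_mono) auto
    \<comment> \<open>The spare factor \<open>1 / n\<close> from aiming at exponent
      \<open>c + 1\<close> absorbs the constant 4, as \<open>n \<ge> 4\<close>.\<close>
    also have "\<dots> = 4 / real n * real n powr - c"
      using n by (simp add: powr_diff)
    also have "\<dots> \<le> 1 * real n powr - c"
      using n by (intro mult_right_mono) auto
    finally show ?case by (simp add: \<Delta>_def x_def)
  qed
qed

end

theorem theorem20:
  fixes \<H> :: "'a ugraph set" and H J :: "'a ugraph"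
  assumes "finite \<H>"
    and "\<And>F. F \<in> \<H> \<Longrightarrow> two_balanced F"
    and "H \<in> \<H>" and "J \<in> \<H>"
    and "d2 H = Min (d2 ` \<H>)"
    and "num_edges J = Max (num_edges ` \<H>)"
  shows "(\<exists>a>0. \<exists>A>0. \<forall>\<^sub>F n in sequentially.
            a * real n powr (2 - 1 / d2 H) \<le> expected_final_edges \<H> n \<and>
            expected_final_edges \<H> n \<le> A * real n powr (2 - 1 / d2 H))
       \<and> (\<forall>c>0. \<forall>\<^sub>F n in sequentially.
            measure_pmf.prob (final_edges \<H> n)
              {m. \<bar>real m - expected_final_edges \<H> n\<bar>
                    \<le> sqrt (expected_final_edges \<H> n) * ln (real n) ^ (4 * num_edges J)}
            \<ge> 1 - real n powr (- c))"
proof -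
  interpret balanced_family \<H> H "num_edges J"
    using assms by unfold_locales auto
  have mean: "expected_final_edges \<H> n = final_mean n" for n
    unfolding expected_final_edges_def final_mean_def
    by (rule final_edges_expectation[OF simple])
  \<comment> \<open>A probability is the expectation of an indicator, so it transfers to random
    orders like the mean.\<close>
  have prob: "measure_pmf.prob (final_edges \<H> n) {k. P k} =
      1 - seq_avg (N n) (complete_edges n) (\<lambda>xs. of_bool (\<not> P (survivors (\<C> n) (N n) xs)))" for P n
  proof -
    interpret averaging "seq_avg (N n) (complete_edges n)" "inj_seqs (N n) (complete_edges n)"
      by (rule averaging_seq) simp
    have "measure_pmf.prob (final_edges \<H> n) {k. P k} =
        measure_pmf.expectation (final_edges \<H> n) (\<lambda>k. of_bool (P k))"
    proof -
      have "(\<lambda>k. of_bool (P k) :: real) = indicator {k. P k}"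
        by (auto simp: indicator_def)
      then show ?thesis by simp
    qed
    also have "\<dots> = seq_avg (N n) (complete_edges n) (\<lambda>xs. of_bool (P (survivors (\<C> n) (N n) xs)))"
      by (rule final_edges_expectation[OF simple])
    finally show ?thesis by (simp add: prob_not)
  qed
  show ?thesis
  proof
    show "\<exists>a>0. \<exists>A>0. \<forall>\<^sub>F n in sequentially.
        a * real n powr (2 - 1 / d2 H) \<le> expected_final_edges \<H> n \<and>
        expected_final_edges \<H> n \<le> A * real n powr (2 - 1 / d2 H)"
    proof -
      obtain a A where "0 < a" "0 < A"
        "\<forall>\<^sub>F n in sequentially. a * magnitude n \<le> final_mean n \<and> final_mean n \<le> A * magnitude n"
        by (rule mean_order)
      then show ?thesis unfolding mean magnitude_def by (intro exI conjI)
    qed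
    show "\<forall>c>0. \<forall>\<^sub>F n in sequentially.
        measure_pmf.prob (final_edges \<H> n)
          {m. \<bar>real m - expected_final_edges \<H> n\<bar>
                \<le> sqrt (expected_final_edges \<H> n) * ln (real n) ^ (4 * num_edges J)}
        \<ge> 1 - real n powr (- c)"
    proof (intro allI impI)
      fix c :: real assume "0 < c"
      from concentration[OF this] show "\<forall>\<^sub>F n in sequentially.
        measure_pmf.prob (final_edges \<H> n)
          {m. \<bar>real m - expected_final_edges \<H> n\<bar>
                \<le> sqrt (expected_final_edges \<H> n) * ln (real n) ^ (4 * num_edges J)}
        \<ge> 1 - real n powr (- c)"
        unfolding mean prob by eventually_elim simp
    qed
  qed
qed

end
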